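(* Let $n\in\mathbb N$, let $\alpha\in(0,1]$ and let $1<p<q<\infty$ satisfy $q\le p+\alpha\max\left(1,\frac pd\right)$. Let $\psi:\overline\Omega\times\mathbb R^+\to\mathbb R^+$ satisfy the structural conditions (A1)--(A5) with exponents $p,q$ and the continuity condition (Cont), and for $\mathbf u:\Omega\to\mathbb R^n$ let $\mathcal H(\mathbf u,\Omega)=\int_\Omega\psi(x,|\nabla\mathbf u(x)|)\,dx$. Then for all $\mathbf u_0\in W^{1,q}(\Omega)$ (with values in $\mathbb R^n$) $$\inf_{\mathbf u\in\mathbf u_0+W^{1,p}_0(\Omega)}\mathcal H(\mathbf u,\Omega)=\inf_{\mathbf u\in\mathbf u_0+W^{1,q}_0(\Omega)}\mathcal H(\mathbf u,\Omega)=\inf_{\mathbf u\in\mathbf u_0+C_c^\infty(\Omega)}\mathcal H(\mathbf u,\Omega).$$ Moreover, $C_c^\infty(\Omega)$ is dense in the Musielak--Orlicz--Sobolev space $W^{1,\psi}_0(\Omega)$. All function spaces here consist of $\mathbb R^n$-valued functions.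
   Context: $\mathbb R^+=[0,\infty)$; $\Omega\subset\mathbb R^d$ is a bounded Lipschitz domain; $B_\gamma(x)$ is the open ball of radius $\gamma$ and center $x$. For $\mathbf u=(u^1,\dots,u^n)$, $|\nabla\mathbf u|$ is the Euclidean (Frobenius) norm of the matrix of all first partial derivatives of all components. The map $x\mapsto\psi(x,\xi)$ is measurable for each $\xi$. Structural conditions (for all $x$): (A1) $\psi(x,\xi)=0$ if and only if $\xi=0$; (A2) $\xi\mapsto\psi(x,\xi)$ is convex on $\mathbb R^+$; (A3) there is a strictly increasing continuous $m_\psi:\mathbb R^+\to\mathbb R^+$ with $m_\psi(0)=0$, $m_\psi(\xi)\le\psi(x,\xi)$ for all $\xi \geq 0$, and $m_\psi(\xi)/\xi\to\infty$ as $\xi\to\infty$; (A4) there are $\xi_0\ge1$ and constants $C_1,C_2>0$ such that $C_1\xi^p\le\psi(x,\xi)$ for $\xi\ge\xi_0$, and $\psi(x,\xi)\le C_2(1+\xi^q)$ for all $\xi\ge0$; (A5) there is a constant $C_4$ such that $\psi(x,2\xi)\le C_4\psi(x,\xi)$ for all $\xi\ge0$. (Cont): for all $D>1$ there are constants $M=M(p,q,D)$ and $N=N(p,q,D)$ such that $\psi(z,\xi)\le M\psi(y,\xi)+N$ for all balls $B_\gamma(x)$, all $y,z\in\overline{B_\gamma(x)}\cap\overline\Omega$, all $\xi\in[0,D\gamma^{-\min(1,d/p)}]$ and all $\gamma\in(0,\frac12)$ (so $M,N$ do not depend on $x,y,z,\xi,\gamma$). Spaces: $\|f\|_\psi=\inf\{\lambda>0:\int_\Omega\psi(x,|f(x)|/\lambda)\,dx\le1\}$;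 $W^{1,\psi}(\Omega)=\{w\in W^{1,1}(\Omega):\|\nabla w\|_\psi<\infty\}$; $W^{1,\psi}_0(\Omega)=W^{1,1}_0(\Omega)\cap W^{1,\psi}(\Omega)$; norm $\|u\|_{1,\psi}=\|u\|_{L^1(\Omega)}+\|\nabla u\|_\psi$; the same notation is used for $\mathbb R^n$-valued functions. *)

theory Defs
  imports "HOL-Analysis.Analysis"
begin

section \<open>Domains\<close>

text \<open>Near every boundary point, \<open>S\<close> is the strict epigraph, in some direction \<open>e\<close>, of a Lipschitz
  function defined on the hyperplane orthogonal to \<open>e\<close>; that hyperplane, with its Euclidean
  structure, plays the role of the space of the first \<open>d - 1\<close> coordinates after a rotation. Since
  the ball is open, it follows that the boundary is locally the graph.\<close>

definition lipschitz_boundary :: "'a::euclidean_space set \<Rightarrow> bool" where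
  "lipschitz_boundary S \<longleftrightarrow>
     (\<forall>x\<in>frontier S. \<exists>r>0. \<exists>e g L. norm e = 1 \<and> L-lipschitz_on {v. v \<bullet> e = 0} g \<and>
        S \<inter> ball x r = {y \<in> ball x r. g (y - (y \<bullet> e) *\<^sub>R e) < y \<bullet> e})"

definition bounded_lipschitz_domain :: "'a::euclidean_space set \<Rightarrow> bool" where
  "bounded_lipschitz_domain S \<longleftrightarrow>
     open S \<and> connected S \<and> S \<noteq> {} \<and> bounded S \<and> lipschitz_boundary S"


section \<open>Smooth functions with compact support\<close>

definition partial_deriv :: "'d::finite \<Rightarrow> (real^'d \<Rightarrow> 'b::real_normed_vector) \<Rightarrow> real^'d \<Rightarrow> 'b" where
  "partial_deriv j f x = frechet_derivative f (at x) (axis j 1)"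

primrec Ck :: "nat \<Rightarrow> (real^'d::finite \<Rightarrow> 'b::real_normed_vector) \<Rightarrow> bool" where
  "Ck 0 f \<longleftrightarrow> continuous_on UNIV f"
| "Ck (Suc k) f \<longleftrightarrow> f differentiable_on UNIV \<and> (\<forall>j. Ck k (partial_deriv j f))"

text \<open>Functions on an open set \<open>S\<close> are represented by total functions of which only the values on \<open>S\<close>
  matter. Elements of \<open>C_c^\<infinity>(S)\<close> are taken extended by zero.\<close>

definition Cc_inf :: "(real^'d::finite) set \<Rightarrow> (real^'d \<Rightarrow> 'b::real_normed_vector) set" where
  "Cc_inf S = {f. (\<forall>k. Ck k f) \<and> compact (closure {x. f x \<noteq> 0}) \<and> closure {x. f x \<noteq> 0} \<subseteq> S}"


section \<open>Lebesgue and Sobolev spaces\<close>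

definition Lp :: "'a::euclidean_space set \<Rightarrow> real \<Rightarrow> ('a \<Rightarrow> 'b::euclidean_space) set" where
  "Lp S p = {f \<in> borel_measurable (lebesgue_on S). integrable (lebesgue_on S) (\<lambda>x. norm (f x) powr p)}"

definition Lp_norm :: "'a::euclidean_space set \<Rightarrow> real \<Rightarrow> ('a \<Rightarrow> 'b::euclidean_space) \<Rightarrow> real" where
  "Lp_norm S p f = (\<integral>x. norm (f x) powr p \<partial>lebesgue_on S) powr (1 / p)"

definition locally_integrable_on :: "('a::euclidean_space \<Rightarrow> 'b::euclidean_space) \<Rightarrow> 'a set \<Rightarrow> bool" where
  "locally_integrable_on f S \<longleftrightarrow> (\<forall>K. compact K \<and> K \<subseteq> S \<longrightarrow> integrable (lebesgue_on K) f)"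

text \<open>Row \<open>i\<close> of \<open>G x\<close> is the gradient of the component \<open>u\<^sup>i\<close>. The norm of the type
  \<open>real^'d^'n\<close> is the Frobenius norm.\<close>

definition is_weak_grad ::
    "(real^'d::finite) set \<Rightarrow> (real^'d \<Rightarrow> real^'n::finite) \<Rightarrow> (real^'d \<Rightarrow> real^'d^'n) \<Rightarrow> bool" where
  "is_weak_grad S u G \<longleftrightarrow>
     locally_integrable_on u S \<and> locally_integrable_on G S \<and>
     (\<forall>\<phi>::real^'d \<Rightarrow> real. \<phi> \<in> Cc_inf S \<longrightarrow>
        (\<forall>i j. (\<integral>x. u x $ i * partial_deriv j \<phi> x \<partial>lebesgue_on S)
               = - (\<integral>x. G x $ i $ j * \<phi> x \<partial>lebesgue_on S)))"

text \<open>The weak gradient is determined almost everywhere in \<open>S\<close>; \<open>weak_grad\<close> picks a representative,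
  and is meaningful only if a weak gradient exists.\<close>

definition weak_grad ::
    "(real^'d::finite) set \<Rightarrow> (real^'d \<Rightarrow> real^'n::finite) \<Rightarrow> real^'d \<Rightarrow> real^'d^'n" where
  "weak_grad S u = (SOME G. is_weak_grad S u G)"

definition W1p :: "(real^'d::finite) set \<Rightarrow> real \<Rightarrow> (real^'d \<Rightarrow> real^'n::finite) set" where
  "W1p S p = {u \<in> Lp S p. \<exists>G \<in> Lp S p. is_weak_grad S u G}"

definition W1p_norm :: "(real^'d::finite) set \<Rightarrow> real \<Rightarrow> (real^'d \<Rightarrow> real^'n::finite) \<Rightarrow> real" where
  "W1p_norm S p u = Lp_norm S p u + Lp_norm S p (weak_grad S u)"

definition W1p0 :: "(real^'d::finite) set \<Rightarrow> real \<Rightarrow> (real^'d \<Rightarrow> real^'n::finite) set" where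
  "W1p0 S p = {u \<in> W1p S p. \<forall>\<epsilon>>0. \<exists>\<phi>\<in>Cc_inf S. W1p_norm S p (\<lambda>x. u x - \<phi> x) < \<epsilon>}"


section \<open>Musielak--Orlicz--Sobolev spaces\<close>

text \<open>The Luxemburg norm and the functional take values in \<open>[0, \<infinity>]\<close>; the infimum of the empty set
  is \<open>\<infinity>\<close>.\<close>

definition lux_norm ::
    "'a::euclidean_space set \<Rightarrow> ('a \<Rightarrow> real \<Rightarrow> real) \<Rightarrow> ('a \<Rightarrow> 'b::euclidean_space) \<Rightarrow> ennreal" where
  "lux_norm S \<psi> f =
     (INF l \<in> {l. 0 < l \<and> (\<integral>\<^sup>+x. ennreal (\<psi> x (norm (f x) / l)) \<partial>lebesgue_on S) \<le> 1}. ennreal l)"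

definition W1psi ::
    "(real^'d::finite) set \<Rightarrow> (real^'d \<Rightarrow> real \<Rightarrow> real) \<Rightarrow> (real^'d \<Rightarrow> real^'n::finite) set" where
  "W1psi S \<psi> = {w \<in> W1p S 1. lux_norm S \<psi> (weak_grad S w) < \<infinity>}"

definition W1psi0 ::
    "(real^'d::finite) set \<Rightarrow> (real^'d \<Rightarrow> real \<Rightarrow> real) \<Rightarrow> (real^'d \<Rightarrow> real^'n::finite) set" where
  "W1psi0 S \<psi> = W1p0 S 1 \<inter> W1psi S \<psi>"

definition W1psi_norm ::
    "(real^'d::finite) set \<Rightarrow> (real^'d \<Rightarrow> real \<Rightarrow> real) \<Rightarrow> (real^'d \<Rightarrow> real^'n::finite) \<Rightarrow> ennreal" where
  "W1psi_norm S \<psi> u = ennreal (Lp_norm S 1 u) + lux_norm S \<psi> (weak_grad S u)"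

definition energy ::
    "(real^'d::finite) set \<Rightarrow> (real^'d \<Rightarrow> real \<Rightarrow> real) \<Rightarrow> (real^'d \<Rightarrow> real^'n::finite) \<Rightarrow> ennreal" where
  "energy S \<psi> u = (\<integral>\<^sup>+x. ennreal (\<psi> x (norm (weak_grad S u x))) \<partial>lebesgue_on S)"


section \<open>Conditions on the integrand\<close>

text \<open>\<open>\<psi>\<close> is a function on \<open>closure S \<times> [0, \<infinity>)\<close>; its values elsewhere are irrelevant.\<close>

definition integrand :: "'a::euclidean_space set \<Rightarrow> ('a \<Rightarrow> real \<Rightarrow> real) \<Rightarrow> bool" where
  "integrand S \<psi> \<longleftrightarrow>
     (\<forall>x\<in>closure S. \<forall>\<xi>\<ge>0. 0 \<le> \<psi> x \<xi>) \<and>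
     (\<forall>\<xi>\<ge>0. (\<lambda>x. \<psi> x \<xi>) \<in> borel_measurable (lebesgue_on (closure S)))"

definition cond_A1 :: "'a::euclidean_space set \<Rightarrow> ('a \<Rightarrow> real \<Rightarrow> real) \<Rightarrow> bool" where
  "cond_A1 S \<psi> \<longleftrightarrow> (\<forall>x\<in>closure S. \<forall>\<xi>\<ge>0. \<psi> x \<xi> = 0 \<longleftrightarrow> \<xi> = 0)"

definition cond_A2 :: "'a::euclidean_space set \<Rightarrow> ('a \<Rightarrow> real \<Rightarrow> real) \<Rightarrow> bool" where
  "cond_A2 S \<psi> \<longleftrightarrow> (\<forall>x\<in>closure S. convex_on {0..} (\<psi> x))"

definition cond_A3 :: "'a::euclidean_space set \<Rightarrow> ('a \<Rightarrow> real \<Rightarrow> real) \<Rightarrow> bool" where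
  "cond_A3 S \<psi> \<longleftrightarrow>
     (\<exists>m. (\<forall>\<xi>\<ge>0. 0 \<le> m \<xi>) \<and> strict_mono_on {0..} m \<and> continuous_on {0..} m \<and> m 0 = 0 \<and>
        (\<forall>x\<in>closure S. \<forall>\<xi>\<ge>0. m \<xi> \<le> \<psi> x \<xi>) \<and>
        filterlim (\<lambda>\<xi>. m \<xi> / \<xi>) at_top at_top)"

definition cond_A4 ::
    "'a::euclidean_space set \<Rightarrow> ('a \<Rightarrow> real \<Rightarrow> real) \<Rightarrow> real \<Rightarrow> real \<Rightarrow> bool" where
  "cond_A4 S \<psi> p q \<longleftrightarrow>
     (\<exists>\<xi>\<^sub>0\<ge>1. \<exists>C\<^sub>1>0. \<exists>C\<^sub>2>0. \<forall>x\<in>closure S.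
        (\<forall>\<xi>\<ge>\<xi>\<^sub>0. C\<^sub>1 * \<xi> powr p \<le> \<psi> x \<xi>) \<and>
        (\<forall>\<xi>\<ge>0. \<psi> x \<xi> \<le> C\<^sub>2 * (1 + \<xi> powr q)))"

definition cond_A5 :: "'a::euclidean_space set \<Rightarrow> ('a \<Rightarrow> real \<Rightarrow> real) \<Rightarrow> bool" where
  "cond_A5 S \<psi> \<longleftrightarrow> (\<exists>C\<^sub>4. \<forall>x\<in>closure S. \<forall>\<xi>\<ge>0. \<psi> x (2 * \<xi>) \<le> C\<^sub>4 * \<psi> x \<xi>)"

definition cond_Cont :: "'a::euclidean_space set \<Rightarrow> ('a \<Rightarrow> real \<Rightarrow> real) \<Rightarrow> real \<Rightarrow> bool" where
  "cond_Cont S \<psi> p \<longleftrightarrow>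
     (\<forall>D>1. \<exists>M N. \<forall>\<gamma>\<in>{0<..<1/2}. \<forall>x. \<forall>y\<in>closure (ball x \<gamma>) \<inter> closure S.
        \<forall>z\<in>closure (ball x \<gamma>) \<inter> closure S.
        \<forall>\<xi>\<in>{0..D * \<gamma> powr (- min 1 (real DIM('a) / p))}. \<psi> z \<xi> \<le> M * \<psi> y \<xi> + N)"

end

theory Submission
  imports Defs
begin

text \<open>Both claims follow from density in the modular: a function \<open>v\<close> in \<open>W\<^sub>0\<^sup>1\<^sup>,\<^sup>1\<close> for which the integral
  of \<open>g = \<psi>(\<cdot>, |\<nabla>v|)\<close> is finite is approximated by test functions \<open>\<phi>\<close> such that the integral of
  \<open>\<psi>(\<cdot>, |\<nabla>v - \<nabla>\<phi>|)\<close> is small. Doubling turns this into smallness of the Luxemburg norm, and convexity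
  compares the energies of \<open>u\<^sub>0 + v\<close> and \<open>u\<^sub>0 + \<phi>\<close>.

  By truncation of the components, \<open>v\<close> may be assumed bounded, and by a partition into local pieces one may
  mollify with kernels \<open>\<kappa>\<^sub>t\<close>, of radius comparable to \<open>t\<close>, that are shifted so as to move the support of
  \<open>v\<close> into the domain, along the direction in which the boundary is a Lipschitz graph. The gradient of
  \<open>\<kappa>\<^sub>t * v\<close> is at most \<open>C / t\<close> because \<open>v\<close> is bounded, and at most \<open>C t\<^sup>-\<^sup>d\<^sup>/\<^sup>p\<close> because \<open>\<nabla>v\<close> is in \<open>L\<^sup>p\<close>;
  this is the range in which (Cont) applies. Jensen's inequality then bounds \<open>\<psi>(\<cdot>, |\<nabla>(\<kappa>\<^sub>t * v)|)\<close> by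
  \<open>M (\<kappa>\<^sub>t * g) + N\<close>, which converges in \<open>L\<^sup>1\<close>, and dominated convergence concludes.\<close>

section \<open>Smooth functions with compact support\<close>

text \<open>The obstacle is that (Cont) compares \<psi> at nearby points only for arguments below a
  power of the distance, while the gradient to be averaged is unbounded. Only the average respects
  that range; hence \<psi> x is frozen and Jensen's inequality is used through a support line at the
  average. Truncation precedes localisation because the gradient of \<eta> v contains the product of
  v with the gradient of \<eta>: for bounded v this term is bounded, and the upper growth bound
  gives it finite modular. Truncation by K arctan(s / K) keeps the chain rule classical and never
  enlarges the gradient. Functions with zero boundary values are extended by zero, so that all
  convolutions live on the whole space and the boundary enters only through the shift of the kernel.
  The modular is subadditive only up to the doubling constant. This suffices for density, but the
  infima are compared with a factor arbitrarily close to 1 in front of the energy, which convexity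
  supplies at the price of a large factor on the small error.\<close>

lemma Ck_Suc_imp_Ck: "Ck (Suc k) f \<Longrightarrow> Ck k f"
proof (induction k arbitrary: f)
  case 0
  then show ?case by (simp add: differentiable_imp_continuous_on)
next
  case (Suc k)
  then show ?case by simp
qed

lemma Ck_continuous: "Ck k f \<Longrightarrow> continuous_on UNIV f"
  by (cases k) (auto simp: differentiable_imp_continuous_on)

lemma partial_deriv_eqI: "(f has_derivative f') (at x) \<Longrightarrow> partial_deriv j f x = f' (axis j 1)"
  unfolding partial_deriv_def by (metis frechet_derivative_at)

text \<open>Derivatives are kept in coordinate form throughout, because \<open>Ck\<close> speaks of
  partial derivatives only; evaluation at \<open>axis j 1\<close> then recovers the
  \<open>j\<close>-th one.\<close>

lemma has_derivative_partial_derivs: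
  fixes f :: "real^'d::finite \<Rightarrow> 'b::real_normed_vector"
  assumes "f differentiable (at x)"
  shows "(f has_derivative (\<lambda>h. \<Sum>j\<in>UNIV. h $ j *\<^sub>R partial_deriv j f x)) (at x)"
proof -
  let ?f' = "frechet_derivative f (at x)"
  have f': "(f has_derivative ?f') (at x)"
    using assms frechet_derivative_works by blast
  then interpret bounded_linear ?f' by (rule has_derivative_bounded_linear)
  have "?f' = (\<lambda>h. \<Sum>j\<in>UNIV. h $ j *\<^sub>R partial_deriv j f x)"
  proof
    fix h
    have "?f' h = ?f' (\<Sum>j\<in>UNIV. h $ j *\<^sub>R axis j 1)"
      by (metis (mono_tags, lifting) basis_expansion sum.cong vector_smult_lid scalar_mult_eq_scaleR)
    then show "?f' h = (\<Sum>j\<in>UNIV. h $ j *\<^sub>R partial_deriv j f x)"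
      by (simp add: sum scaleR partial_deriv_def)
  qed
  with f' show ?thesis by simp
qed

lemma sum_axis_scaleR [simp]:
  fixes X :: "'d::finite \<Rightarrow> 'b::real_vector"
  shows "(\<Sum>i\<in>UNIV. axis j 1 $ i *\<^sub>R X i) = X j"
proof -
  have "(\<Sum>i\<in>UNIV. axis j 1 $ i *\<^sub>R X i) = (\<Sum>i\<in>UNIV. if i = j then X j else 0)"
    by (rule sum.cong) (auto simp: axis_def)
  then show ?thesis by simp
qed

lemma sum_axis_mult [simp]: "(\<Sum>i\<in>UNIV. axis j 1 $ i * X i) = (X j :: real)"
  using sum_axis_scaleR[of j X] by simp

lemma Ck_has_derivative:
  "Ck (Suc k) f \<Longrightarrow> (f has_derivative (\<lambda>h. \<Sum>j\<in>UNIV. h $ j *\<^sub>R partial_deriv j f x)) (at x)"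
  by (rule has_derivative_partial_derivs) (auto simp: differentiable_on_def)

text \<open>Any explicit candidate derivative will do: derivatives are unique, so its value at
  \<open>axis j 1\<close> is the partial derivative. The closure properties of \<open>Ck\<close> are
  inductions through this rule.\<close>

lemma Ck_SucI:
  assumes "\<And>x. (f has_derivative f' x) (at x)" and "\<And>j. Ck k (\<lambda>x. f' x (axis j 1))"
  shows "Ck (Suc k) f"
proof -
  have "partial_deriv j f = (\<lambda>x. f' x (axis j 1))" for j
    using assms(1) partial_deriv_eqI by fast
  moreover have "f differentiable_on UNIV"
    using assms(1) by (auto simp: differentiable_on_def differentiable_def)
  ultimately show ?thesis using assms(2) by simp
qed

lemma Ck_const: "Ck k (\<lambda>x. c)"
proof (induction k arbitrary: c)
  case (Suc k)
  show ?case
    by (rule Ck_SucI[where f' = "\<lambda>x h. 0"]) (auto intro: Suc.IH)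
qed auto

lemma Ck_bounded_linear:
  assumes "bounded_linear T" shows "Ck k f \<Longrightarrow> Ck k (\<lambda>x. T (f x))"
proof (induction k arbitrary: f)
  case 0
  then show ?case by (simp add: bounded_linear.continuous_on[OF assms])
next
  case (Suc k)
  interpret bounded_linear T by fact
  show ?case
  proof (rule Ck_SucI)
    show "((\<lambda>x. T (f x)) has_derivative (\<lambda>h. T (\<Sum>j\<in>UNIV. h $ j *\<^sub>R partial_deriv j f x))) (at x)" for x
      by (rule has_derivative) (rule Ck_has_derivative[OF Suc.prems])
    show "Ck k (\<lambda>x. T (\<Sum>ja\<in>UNIV. axis j 1 $ ja *\<^sub>R partial_deriv ja f x))" for j
      using Suc by simp
  qed
qed

lemma Ck_add: "Ck k f \<Longrightarrow> Ck k g \<Longrightarrow> Ck k (\<lambda>x. f x + g x)"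
proof (induction k arbitrary: f g)
  case 0
  then show ?case by (auto intro: continuous_intros)
next
  case (Suc k)
  show ?case
    by (rule Ck_SucI, rule has_derivative_add[OF Ck_has_derivative[OF Suc.prems(1)] Ck_has_derivative[OF Suc.prems(2)]])
      (use Suc in \<open>simp\<close>)
qed

text \<open>Each summand of the product rule pairs a derivative of order \<open>k\<close> with an
  undifferentiated factor whose order is lowered from \<open>Suc k\<close> to \<open>k\<close>;
  hence the induction generalises both functions.\<close>

lemma Ck_scaleR:
  fixes f :: "real^'d::finite \<Rightarrow> real"
  shows "Ck k f \<Longrightarrow> Ck k g \<Longrightarrow> Ck k (\<lambda>x. f x *\<^sub>R g x)"
proof (induction k arbitrary: f g)
  case 0
  then show ?case by (auto intro: continuous_intros)
next
  case (Suc k)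
  show ?case
  proof (rule Ck_SucI, rule has_derivative_scaleR[OF Ck_has_derivative[OF Suc.prems(1)] Ck_has_derivative[OF Suc.prems(2)]])
    show "Ck k (\<lambda>x. f x *\<^sub>R (\<Sum>ja\<in>UNIV. axis j 1 $ ja *\<^sub>R partial_deriv ja g x) +
               (\<Sum>ja\<in>UNIV. axis j 1 $ ja *\<^sub>R partial_deriv ja f x) *\<^sub>R g x)" for j
    proof -
      have "Ck k (partial_deriv j f)" "Ck k (partial_deriv j g)" using Suc.prems by simp_all
      note Ck_add[OF Suc.IH[OF Ck_Suc_imp_Ck[OF Suc.prems(1)] this(2)] Suc.IH[OF this(1) Ck_Suc_imp_Ck[OF Suc.prems(2)]]]
      then show ?thesis
        by simp
    qed
  qed
qed

lemma has_derivative_affine: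
  assumes "f differentiable_on UNIV"
  shows "((\<lambda>x. f (a *\<^sub>R x + b)) has_derivative
      (\<lambda>h. a *\<^sub>R (\<Sum>j\<in>UNIV. h $ j *\<^sub>R partial_deriv j f (a *\<^sub>R x + b)))) (at x)"
proof -
  have "(f has_derivative (\<lambda>h. \<Sum>j\<in>UNIV. h $ j *\<^sub>R partial_deriv j f (a *\<^sub>R x + b))) (at (a *\<^sub>R x + b))"
    by (rule has_derivative_partial_derivs) (use assms in \<open>simp add: differentiable_on_def\<close>)
  moreover have "((\<lambda>x. a *\<^sub>R x + b) has_derivative (\<lambda>h. a *\<^sub>R h)) (at x)"
    by (auto intro!: derivative_eq_intros)
  ultimately have "((\<lambda>x. f (a *\<^sub>R x + b)) has_derivative
      (\<lambda>h. \<Sum>j\<in>UNIV. (a *\<^sub>R h) $ j *\<^sub>R partial_deriv j f (a *\<^sub>R x + b))) (at x)"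
    by (rule has_derivative_compose[rotated])
  then show ?thesis by (simp add: scaleR_sum_right)
qed

lemma partial_deriv_affine:
  assumes "f differentiable_on UNIV"
  shows "partial_deriv j (\<lambda>x. f (a *\<^sub>R x + b)) x = a *\<^sub>R partial_deriv j f (a *\<^sub>R x + b)"
  using partial_deriv_eqI[OF has_derivative_affine[OF assms], of j] by simp

lemma Ck_affine: "Ck k f \<Longrightarrow> Ck k (\<lambda>x. f (a *\<^sub>R x + b))"
proof (induction k arbitrary: f)
  case 0
  then show ?case by (auto intro!: continuous_on_compose2[of UNIV f] continuous_intros)
next
  case (Suc k)
  then have d: "f differentiable_on UNIV" by simp
  show ?case
    by (rule Ck_SucI[OF has_derivative_affine[OF d]]) (use Suc in \<open>simp add: Ck_scaleR Ck_const\<close>)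
qed

lemma partial_deriv_bounded_linear:
  assumes "bounded_linear T" "f differentiable_on UNIV"
  shows "partial_deriv j (\<lambda>x. T (f x)) x = T (partial_deriv j f x)"
proof -
  have "(f has_derivative (\<lambda>h. \<Sum>j\<in>UNIV. h $ j *\<^sub>R partial_deriv j f x)) (at x)"
    using assms by (intro has_derivative_partial_derivs) (auto simp: differentiable_on_def)
  from partial_deriv_eqI[OF bounded_linear.has_derivative[OF assms(1) this], of j]
  show ?thesis by simp
qed

lemma partial_deriv_scaleR:
  fixes f :: "real^'d::finite \<Rightarrow> real"
  assumes "f differentiable_on UNIV" "g differentiable_on UNIV"
  shows "partial_deriv j (\<lambda>x. f x *\<^sub>R g x) x = f x *\<^sub>R partial_deriv j g x + partial_deriv j f x *\<^sub>R g x"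
proof -
  have "(f has_derivative (\<lambda>h. \<Sum>j\<in>UNIV. h $ j *\<^sub>R partial_deriv j f x)) (at x)"
    "(g has_derivative (\<lambda>h. \<Sum>j\<in>UNIV. h $ j *\<^sub>R partial_deriv j g x)) (at x)"
    by (rule has_derivative_partial_derivs, use assms in \<open>simp add: differentiable_on_def\<close>)+
  from partial_deriv_eqI[OF has_derivative_scaleR[OF this], of j]
  show ?thesis
    by simp
qed

lemma partial_deriv_add:
  assumes "f differentiable_on UNIV" "g differentiable_on UNIV"
  shows "partial_deriv j (\<lambda>x. f x + g x) x = partial_deriv j f x + partial_deriv j g x"
proof -
  have "(f has_derivative (\<lambda>h. \<Sum>j\<in>UNIV. h $ j *\<^sub>R partial_deriv j f x)) (at x)"
    "(g has_derivative (\<lambda>h. \<Sum>j\<in>UNIV. h $ j *\<^sub>R partial_deriv j g x)) (at x)"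
    by (rule has_derivative_partial_derivs, use assms in \<open>simp add: differentiable_on_def\<close>)+
  from partial_deriv_eqI[OF has_derivative_add[OF this], of j]
  show ?thesis by simp
qed

lemma partial_deriv_locally_const:
  assumes "open U" "x \<in> U" "\<And>y. y \<in> U \<Longrightarrow> f y = c"
  shows "partial_deriv j f x = 0"
proof -
  have "(f has_derivative (\<lambda>h. 0)) (at x)"
    by (rule has_derivative_transform_within_open[where f = "\<lambda>x. c" and s = U]) (use assms in auto)
  then show ?thesis by (rule partial_deriv_eqI)
qed

lemma partial_deriv_eq_0:
  "open U \<Longrightarrow> x \<in> U \<Longrightarrow> (\<And>y. y \<in> U \<Longrightarrow> f y = 0) \<Longrightarrow> partial_deriv j f x = 0"
  by (rule partial_deriv_locally_const)

section \<open>Closure properties of the test functions\<close>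

lemma Cc_infI:
  assumes "\<And>k. Ck k f" "compact K" "K \<subseteq> S" "\<And>x. x \<notin> K \<Longrightarrow> f x = 0"
  shows "f \<in> Cc_inf S"
proof -
  have "closure {x. f x \<noteq> 0} \<subseteq> K"
    by (rule closure_minimal) (use assms in \<open>auto intro: compact_imp_closed\<close>)
  moreover from this have "compact (closure {x. f x \<noteq> 0})"
    using assms(2) bounded_subset[of K] by (simp add: compact_eq_bounded_closed)
  ultimately show ?thesis using assms by (auto simp: Cc_inf_def)
qed

text \<open>The witness is the closed support. Its complement is open and \<open>f\<close> vanishes
  there, so the partial derivatives vanish there too.\<close>

lemma Cc_infE:
  assumes "f \<in> Cc_inf S"
  obtains K where "\<And>k. Ck k f" "compact K" "K \<subseteq> S" "\<And>x. x \<notin> K \<Longrightarrow> f x = 0"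
    "\<And>x j. x \<notin> K \<Longrightarrow> partial_deriv j f x = 0"
proof (rule that)
  let ?K = "closure {x. f x \<noteq> 0}"
  show "Ck k f" for k using assms by (auto simp: Cc_inf_def)
  show "compact ?K" "?K \<subseteq> S" using assms by (auto simp: Cc_inf_def)
  show 1: "x \<notin> ?K \<Longrightarrow> f x = 0" for x using closure_subset[of "{x. f x \<noteq> 0}"] by blast
  show "x \<notin> ?K \<Longrightarrow> partial_deriv j f x = 0" for x j
    by (rule partial_deriv_eq_0[OF open_Compl[OF closed_closure], of _ "{x. f x \<noteq> 0}"]) (use 1 in blast)+
qed

lemma Cc_inf_Ck: "f \<in> Cc_inf S \<Longrightarrow> Ck k f"
  by (simp add: Cc_inf_def)

lemma Cc_inf_differentiable: "f \<in> Cc_inf S \<Longrightarrow> f differentiable_on UNIV"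
  using Cc_inf_Ck[of f S "Suc 0"] by simp

lemma Cc_inf_mono: "S \<subseteq> T \<Longrightarrow> Cc_inf S \<subseteq> Cc_inf T"
  by (auto simp: Cc_inf_def)

lemma Cc_inf_partial_deriv: "f \<in> Cc_inf S \<Longrightarrow> partial_deriv j f \<in> Cc_inf S"
proof (erule Cc_infE)
  fix K assume "\<And>k. Ck k f" "compact K" "K \<subseteq> S" "\<And>x j. x \<notin> K \<Longrightarrow> partial_deriv j f x = 0"
  then show ?thesis
    using Ck.simps(2) by (intro Cc_infI[of _ K]) blast+
qed

lemma Cc_inf_zero: "(\<lambda>x. 0) \<in> Cc_inf S"
  by (rule Cc_infI[of _ "{}"]) (auto simp: Ck_const)

lemma Cc_inf_add: "f \<in> Cc_inf S \<Longrightarrow> g \<in> Cc_inf S \<Longrightarrow> (\<lambda>x. f x + g x) \<in> Cc_inf S"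
proof (elim Cc_infE)
  fix K L assume "\<And>k. Ck k f" "compact K" "K \<subseteq> S" "\<And>x. x \<notin> K \<Longrightarrow> f x = 0"
    "\<And>k. Ck k g" "compact L" "L \<subseteq> S" "\<And>x. x \<notin> L \<Longrightarrow> g x = 0"
  then show ?thesis
    by (intro Cc_infI[of _ "K \<union> L"]) (auto intro: Ck_add)
qed

lemma Cc_inf_scaleR_Ck: "(\<And>k. Ck k f) \<Longrightarrow> g \<in> Cc_inf S \<Longrightarrow> (\<lambda>x. f x *\<^sub>R g x) \<in> Cc_inf S"
proof (erule Cc_infE)
  fix K assume "\<And>k. Ck k f" "compact K" "K \<subseteq> S" "\<And>x. x \<notin> K \<Longrightarrow> g x = 0"
    "\<And>k. Ck k g"
  then show ?thesis
    by (intro Cc_infI[of _ K]) (auto intro: Ck_scaleR)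
qed

lemma Cc_inf_bounded_linear:
  assumes "bounded_linear T" "f \<in> Cc_inf S" shows "(\<lambda>x. T (f x)) \<in> Cc_inf S"
  using assms(2)
proof (rule Cc_infE)
  fix K assume "\<And>k. Ck k f" "compact K" "K \<subseteq> S" "\<And>x. x \<notin> K \<Longrightarrow> f x = 0"
  then show ?thesis
    using assms(1) by (intro Cc_infI[of _ K]) (auto intro: Ck_bounded_linear simp: linear_simps)
qed

lemma Cc_inf_affine:
  assumes "a \<noteq> 0" and f: "f \<in> Cc_inf UNIV"
  shows "(\<lambda>x. f (a *\<^sub>R x + b)) \<in> Cc_inf UNIV"
  using f
proof (rule Cc_infE)
  fix K assume K: "\<And>k. Ck k f" "compact K" "\<And>x. x \<notin> K \<Longrightarrow> f x = 0"
  show ?thesis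
  proof (rule Cc_infI)
    let ?K = "(\<lambda>x. (1/a) *\<^sub>R (x - b)) ` K"
    show "compact ?K" using K by (intro compact_continuous_image continuous_intros)
    show "f (a *\<^sub>R x + b) = 0" if "x \<notin> ?K" for x
    proof (rule K(3))
      have "x = (1/a) *\<^sub>R ((a *\<^sub>R x + b) - b)" using assms by simp
      then show "a *\<^sub>R x + b \<notin> K" using that by blast
    qed
  qed (use K in \<open>auto intro: Ck_affine\<close>)
qed

lemma Cc_inf_bounded:
  assumes "f \<in> Cc_inf S" obtains B where "B > 0" "\<And>x. norm (f x) \<le> B"
  using assms
proof (rule Cc_infE)
  fix K assume K: "\<And>k. Ck k f" "compact K" "\<And>x. x \<notin> K \<Longrightarrow> f x = 0"
  have "bounded (f ` K)"
    using K Ck_continuous[OF K(1)[of 0]] by (meson compact_continuous_image compact_imp_bounded continuous_on_subset subset_UNIV)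
  then obtain B where "B > 0" "\<And>x. x \<in> K \<Longrightarrow> norm (f x) \<le> B"
    by (auto simp: bounded_pos)
  with K have "norm (f x) \<le> B" for x by (cases "x \<in> K") auto
  with \<open>B > 0\<close> show ?thesis using that by blast
qed

lemma Cc_inf_integrable:
  fixes f :: "real^'d::finite \<Rightarrow> 'b::euclidean_space"
  assumes "f \<in> Cc_inf S" shows "integrable lborel f"
  using assms
proof (rule Cc_infE)
  fix K assume K: "\<And>k. Ck k f" "compact K" "\<And>x. x \<notin> K \<Longrightarrow> f x = 0"
  have "set_integrable lborel K f"
    unfolding set_integrable_def using K Ck_continuous[OF K(1)[of 0]]
    by (intro borel_integrable_compact) (auto intro: continuous_on_subset)
  moreover have "indicator K x *\<^sub>R f x = f x" for x using K(3) by (auto simp: indicator_def)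
  ultimately show ?thesis by (simp add: set_integrable_def)
qed

lemma Cc_inf_borel [measurable_dest]:
  fixes f :: "real^'d::finite \<Rightarrow> 'b::euclidean_space"
  shows "f \<in> Cc_inf S \<Longrightarrow> f \<in> borel_measurable borel"
  using borel_measurable_continuous_onI Ck_continuous Cc_inf_Ck by blast

section \<open>A smooth bump function and mollifying kernels\<close>

text \<open>The weights (1/t)^m are included because differentiating exp(-1/t) produces them; the
  family is closed under differentiation up to linear combinations, which turns smoothness into an
  induction.\<close>

definition exp_bump :: "nat \<Rightarrow> real \<Rightarrow> real" where
  "exp_bump m t = (if t > 0 then (1 / t) ^ m * exp (- (1 / t)) else 0)"

text \<open>With s = 1/t this is the limit of s^m / exp s at infinity; it settles the derivative at
  the origin.\<close>

lemma exp_bump_tendsto_0: "(exp_bump m \<longlongrightarrow> 0) (at_right 0)"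
proof -
  have "((\<lambda>t. (inverse t) ^ m / exp (inverse t)) \<longlongrightarrow> (0::real)) (at_right 0)"
    by (rule filterlim_compose[OF tendsto_power_div_exp_0 filterlim_inverse_at_top_right])
  then show ?thesis
    by (rule Lim_transform_eventually)
      (auto simp: eventually_at_filter exp_bump_def exp_minus field_simps)
qed

lemma exp_bump_DERIV:
  "(exp_bump m has_real_derivative (exp_bump (m + 2) t - real m * exp_bump (m + 1) t)) (at t)"
proof -
  consider "t > 0" | "t < 0" | "t = 0" by linarith
  then show ?thesis
  proof cases
    case 1
    have "((\<lambda>t. inverse t ^ m * exp (- inverse t)) has_real_derivative
        real m * inverse t ^ (m - 1) * (- (inverse t * inverse t)) * exp (- inverse t)
          + inverse t ^ m * (exp (- inverse t) * (inverse t * inverse t))) (at t)"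
      using 1 by (auto intro!: derivative_eq_intros)
    moreover have "real m * inverse t ^ (m - 1) * (- (inverse t * inverse t)) * exp (- inverse t)
          + inverse t ^ m * (exp (- inverse t) * (inverse t * inverse t))
        = exp_bump (m + 2) t - real m * exp_bump (m + 1) t"
      using 1 by (cases m) (simp_all add: exp_bump_def inverse_eq_divide[symmetric] algebra_simps)
    ultimately have "((\<lambda>t. inverse t ^ m * exp (- inverse t)) has_real_derivative
        (exp_bump (m + 2) t - real m * exp_bump (m + 1) t)) (at t)"
      by simp
    then show ?thesis
      by (rule has_field_derivative_transform_within_open[where S = "{0<..}"])
        (use 1 in \<open>auto simp: exp_bump_def inverse_eq_divide\<close>)
  next
    case 2
    have "((\<lambda>t. 0) has_real_derivative (exp_bump (m + 2) t - real m * exp_bump (m + 1) t)) (at t)"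
      using 2 by (auto simp: exp_bump_def)
    then show ?thesis
      by (rule has_field_derivative_transform_within_open[where S = "{..<0}"])
        (use 2 in \<open>auto simp: exp_bump_def\<close>)
  next
    case 3
    \<comment> \<open>Division by \<open>h\<close> adds one factor 1/h, so the quotient is
      \<open>exp_bump (Suc m)\<close>, which tends to 0 from the right; from the left everything is
      0.\<close>
    have "((\<lambda>h. exp_bump m h / h) \<longlongrightarrow> 0) (at_right 0)"
      by (rule Lim_transform_eventually[OF exp_bump_tendsto_0[of "Suc m"]])
        (auto simp: eventually_at_filter exp_bump_def)
    moreover have "((\<lambda>h. exp_bump m h / h) \<longlongrightarrow> 0) (at_left 0)"
      by (rule Lim_transform_eventually[OF tendsto_const])
        (auto simp: eventually_at_filter exp_bump_def)
    ultimately have "((\<lambda>h. exp_bump m h / h) \<longlongrightarrow> 0) (at 0)"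
      by (rule filterlim_split_at[rotated])
    then have "(exp_bump m has_real_derivative 0) (at 0)"
      by (simp add: DERIV_def exp_bump_def)
    then show ?thesis using 3 by (simp add: exp_bump_def)
  qed
qed

text \<open>The induction ranges over all \<open>m\<close>, since the derivative involves the
  weights \<open>m + 1\<close> and \<open>m + 2\<close>; the inner function contributes a linear
  factor.\<close>

lemma Ck_exp_bump: "Ck k (\<lambda>x::real^'d::finite. exp_bump m (1 - x \<bullet> x))"
proof (induction k arbitrary: m)
  case 0
  have "continuous_on UNIV (exp_bump m)"
    by (rule DERIV_continuous_on[OF exp_bump_DERIV[THEN has_field_derivative_at_within]])
  then show ?case
    by (simp, rule continuous_on_compose2[of UNIV "exp_bump m"]) (auto intro!: continuous_intros)
next
  case (Suc k)
  let ?e = "\<lambda>m (x::real^'d). exp_bump m (1 - x \<bullet> x)"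
  show ?case
  proof (rule Ck_SucI)
    fix x :: "real^'d"
    show "(?e m has_derivative (\<lambda>h. (?e (m + 2) x - real m * ?e (m + 1) x) * (0 - (x \<bullet> h + h \<bullet> x)))) (at x)"
      by (rule has_derivative_compose[OF _ exp_bump_DERIV[unfolded has_field_derivative_def]])
        (auto intro!: derivative_eq_intros)
  next
    fix j :: 'd
    have *: "(?e (m + 2) x - real m * ?e (m + 1) x) * (0 - (x \<bullet> axis j 1 + axis j 1 \<bullet> x))
      = (?e (m + 2) x + (- real m) *\<^sub>R ?e (m + 1) x) *\<^sub>R ((- 2) * (x \<bullet> axis j 1))" for x
      by (simp add: inner_commute)
    have "Ck n (\<lambda>x::real^'d. 1 *\<^sub>R x + 0)" for n
    proof (induction n)
      case (Suc n)
      show ?case by (rule Ck_SucI[where f' = "\<lambda>x h. h"]) (auto simp: Ck_const)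
    qed auto
    then have id: "Ck n (\<lambda>x::real^'d. x)" for n by simp
    have "bounded_linear (\<lambda>x::real^'d. (- 2) * (x \<bullet> axis j 1))"
      by (intro bounded_linear_intros)
    from Ck_bounded_linear[OF this id]
    show "Ck k (\<lambda>x. (?e (m + 2) x - real m * ?e (m + 1) x) * (0 - (x \<bullet> axis j 1 + axis j 1 \<bullet> x)))"
      unfolding * by (intro Ck_scaleR Ck_add Suc.IH Ck_const) auto
  qed
qed

text \<open>The centre is arbitrary: kernels around 0 serve the whole-space arguments, while the
  approximation near the boundary takes one concentrated around the inward direction.\<close>

lemma ex_mollifier:
  fixes e :: "real^'d::finite"
  assumes "c > 0"
  obtains k :: "real^'d \<Rightarrow> real"
  where "k \<in> Cc_inf UNIV" "\<And>x. k x \<ge> 0" "\<And>x. x \<notin> ball e c \<Longrightarrow> k x = 0" "(\<integral>x. k x \<partial>lborel) = 1"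
proof -
  define b where "b x = exp_bump 0 (1 - x \<bullet> x)" for x :: "real^'d"
  have b0: "b x = 0" if "x \<notin> ball 0 1" for x
    using that by (auto simp: b_def exp_bump_def dot_square_norm) (smt (verit) one_le_power)
  have bpos: "b x \<ge> 0" for x by (simp add: b_def exp_bump_def)
  have bC: "b \<in> Cc_inf UNIV"
    unfolding b_def by (rule Cc_infI[of _ "cball 0 1"]) (use b0[unfolded b_def] in \<open>auto intro: Ck_exp_bump\<close>)
  define f where "f x = b ((1/c) *\<^sub>R x + (- (1/c) *\<^sub>R e))" for x
  have fC: "f \<in> Cc_inf UNIV"
    unfolding f_def by (rule Cc_inf_affine) (use assms bC in auto)
  have fi: "integrable lborel f" using Cc_inf_integrable[OF fC] .
  have f0: "f x = 0" if "x \<notin> ball e c" for x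
  proof -
    have "(1/c) *\<^sub>R x + (- (1/c) *\<^sub>R e) = (1/c) *\<^sub>R (x - e)" by (simp add: algebra_simps)
    then show ?thesis unfolding f_def using that assms
      by (intro b0) (auto simp: dist_norm norm_minus_commute divide_simps)
  qed
  have fpos: "f x \<ge> 0" for x using bpos by (simp add: f_def)
  let ?I = "\<integral>x. f x \<partial>lborel"
  \<comment> \<open>A vanishing integral would make f = 0 almost everywhere, hence everywhere since
    the zero set is closed; but f is positive at the centre \<open>e\<close>.\<close>
  have "?I \<noteq> 0"
  proof
    assume "?I = 0"
    then have "AE x in lborel. f x = 0"
      using integral_nonneg_eq_0_iff_AE[OF fi] fpos by auto
    moreover have "closed {x. f x = 0}"
      using Ck_continuous[OF Cc_inf_Ck[OF fC]] by (intro closed_Collect_eq continuous_intros)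
    ultimately have "f e = 0"
      using mem_closed_if_AE_lebesgue[of "{x. f x = 0}" e] by (simp add: AE_completion_iff)
    moreover have "f e > 0" using assms by (simp add: f_def b_def exp_bump_def)
    ultimately show False by simp
  qed
  moreover have "?I \<ge> 0" using fpos by simp
  ultimately have I: "?I > 0" by linarith
  show ?thesis
  proof (rule that[of "\<lambda>x. (1 / ?I) *\<^sub>R f x"])
    show "(\<lambda>x. (1 / ?I) *\<^sub>R f x) \<in> Cc_inf UNIV"
      using fC by (intro Cc_inf_scaleR_Ck) (auto simp: Ck_const)
  qed (use I fpos f0 in auto)
qed

section \<open>Translations and integration by parts\<close>

lemma nn_integral_lborel_translate:
  fixes f :: "'a::euclidean_space \<Rightarrow> ennreal"
  assumes "f \<in> borel_measurable borel"
  shows "(\<integral>\<^sup>+x. f (x + h) \<partial>lborel) = (\<integral>\<^sup>+x. f x \<partial>lborel)"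
proof -
  have "(\<integral>\<^sup>+x. f x \<partial>lborel) = (\<integral>\<^sup>+x. f x \<partial>distr lborel borel ((+) h))"
    by (simp add: lborel_distr_plus)
  also have "\<dots> = (\<integral>\<^sup>+x. f (x + h) \<partial>lborel)"
    using assms by (subst nn_integral_distr) (auto simp: add.commute)
  finally show ?thesis by simp
qed

lemma
  fixes f :: "'a::euclidean_space \<Rightarrow> 'b::euclidean_space"
  assumes "f \<in> borel_measurable borel"
  shows integral_lborel_translate: "(\<integral>x. f (x + h) \<partial>lborel) = (\<integral>x. f x \<partial>lborel)"
    and integrable_lborel_translate: "integrable lborel (\<lambda>x. f (x + h)) \<longleftrightarrow> integrable lborel f"
proof -
  have "(\<integral>x. f x \<partial>lborel) = (\<integral>x. f x \<partial>distr lborel borel ((+) h))"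
    by (simp add: lborel_distr_plus)
  also have "\<dots> = (\<integral>x. f (x + h) \<partial>lborel)"
    using assms by (subst integral_distr) (auto simp: add.commute)
  finally show "(\<integral>x. f (x + h) \<partial>lborel) = (\<integral>x. f x \<partial>lborel)" by simp
  have "integrable lborel f \<longleftrightarrow> integrable (distr lborel borel ((+) h)) f"
    by (simp add: lborel_distr_plus)
  also have "\<dots> \<longleftrightarrow> integrable lborel (\<lambda>x. f (x + h))"
    using assms by (subst integrable_distr_eq) (auto simp: add.commute)
  finally show "integrable lborel (\<lambda>x. f (x + h)) \<longleftrightarrow> integrable lborel f" by simp
qed

lemma nn_integral_norm_add_le:
  fixes f g :: "'a \<Rightarrow> 'b::euclidean_space"
  assumes [measurable]: "f \<in> borel_measurable M" "g \<in> borel_measurable M"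
  shows "(\<integral>\<^sup>+x. norm (f x + g x) \<partial>M) \<le> (\<integral>\<^sup>+x. norm (f x) \<partial>M) + (\<integral>\<^sup>+x. norm (g x) \<partial>M)"
proof -
  have "(\<integral>\<^sup>+x. norm (f x + g x) \<partial>M) \<le> (\<integral>\<^sup>+x. ennreal (norm (f x)) + ennreal (norm (g x)) \<partial>M)"
    by (intro nn_integral_mono) (auto simp flip: ennreal_plus intro!: ennreal_leI norm_triangle_ineq)
  also have "\<dots> = (\<integral>\<^sup>+x. norm (f x) \<partial>M) + (\<integral>\<^sup>+x. norm (g x) \<partial>M)" by (rule nn_integral_add) auto
  finally show ?thesis .
qed

lemma nn_integral_translate_diff_le:
  fixes f :: "'a::euclidean_space \<Rightarrow> 'b::euclidean_space"
  assumes [measurable]: "f \<in> borel_measurable borel"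
  shows "(\<integral>\<^sup>+x. norm (f (x + h) - f x) \<partial>lborel) \<le> 2 * (\<integral>\<^sup>+x. norm (f x) \<partial>lborel)"
  using nn_integral_norm_add_le[of "\<lambda>x. f (x + h)" lborel "\<lambda>x. - f x"]
    nn_integral_lborel_translate[of "\<lambda>x. ennreal (norm (f x))" h] by (simp add: mult_2)

lemma integral_lborel_affine:
  fixes f :: "'a::euclidean_space \<Rightarrow> 'b::euclidean_space"
  assumes [measurable]: "f \<in> borel_measurable borel" and "c \<noteq> 0"
  shows "(\<integral>x. f x \<partial>lborel) = \<bar>c\<bar> ^ DIM('a) *\<^sub>R (\<integral>x. f (b + c *\<^sub>R x) \<partial>lborel)"
proof -
  have "(\<integral>x. f x \<partial>lborel)
      = (\<integral>x. f x \<partial>density (distr lborel borel (\<lambda>x. b + c *\<^sub>R x)) (\<lambda>_. ennreal (\<bar>c\<bar> ^ DIM('a))))"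
    using lborel_affine[OF \<open>c \<noteq> 0\<close>, of b] by simp
  also have "\<dots> = (\<integral>x. \<bar>c\<bar> ^ DIM('a) *\<^sub>R f x \<partial>distr lborel borel (\<lambda>x. b + c *\<^sub>R x))"
    by (subst integral_density) auto
  also have "\<dots> = (\<integral>x. \<bar>c\<bar> ^ DIM('a) *\<^sub>R f (b + c *\<^sub>R x) \<partial>lborel)"
    by (subst integral_distr) auto
  finally show ?thesis by simp
qed

section \<open>Continuity of translations in L1\<close>

text \<open>Approximation in L1, run through \<open>integrable_induct\<close>: indicators of open
  sets, then of Borel sets by outer regularity, then sums and limits. The class of good functions is
  closed under L1 limits because a translation error is at most twice the norm.\<close>

lemma translation_continuous_L1:
  fixes f :: "'a::euclidean_space \<Rightarrow> 'b::euclidean_space"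
  assumes "integrable lborel f" and h: "h \<longlonglongrightarrow> 0"
  shows "(\<lambda>n. \<integral>\<^sup>+x. norm (f (x + h n) - f x) \<partial>lborel) \<longlonglongrightarrow> 0"
proof -
  define D where "D f n = (\<integral>\<^sup>+x. norm (f (x + h n) - f x) \<partial>lborel)" for f :: "'a \<Rightarrow> 'b" and n
  define P where "P f \<longleftrightarrow> D f \<longlonglongrightarrow> 0" for f
  have D_add: "D (\<lambda>x. f x + g x) n \<le> D f n + D g n"
    if [measurable]: "f \<in> borel_measurable borel" "g \<in> borel_measurable borel" for f g n
    using nn_integral_norm_add_le[of "\<lambda>x. f (x + h n) - f x" lborel "\<lambda>x. g (x + h n) - g x"]
    by (simp add: D_def add_diff_add)
  have D_le: "D f n \<le> 2 * (\<integral>\<^sup>+x. norm (f x) \<partial>lborel)" if "f \<in> borel_measurable borel" for f n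
    unfolding D_def by (rule nn_integral_translate_diff_le[OF that])
  have P_add: "P (\<lambda>x. f x + g x)"
    if "f \<in> borel_measurable borel" "g \<in> borel_measurable borel" "P f" "P g" for f g
  proof -
    have "(\<lambda>n. D f n + D g n) \<longlonglongrightarrow> 0 + 0" using that unfolding P_def by (intro tendsto_add) auto
    then have lim: "(\<lambda>n. D f n + D g n) \<longlonglongrightarrow> 0" by simp
    show ?thesis unfolding P_def
    proof (rule tendsto_sandwich[OF _ _ tendsto_const lim])
      show "eventually (\<lambda>n. D (\<lambda>x. f x + g x) n \<le> D f n + D g n) sequentially"
        by (rule always_eventually, rule allI) (rule D_add[OF that(1,2)])
    qed simp
  qed
  have P_approx: "P f" if [measurable]: "f \<in> borel_measurable borel"
    and g: "\<And>e. (0::real) < e \<Longrightarrow> \<exists>g\<in>borel_measurable borel. P g \<and> (\<integral>\<^sup>+x. norm (f x - g x) \<partial>lborel) \<le> e" for f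
    unfolding P_def
  proof (rule order_tendstoI)
    fix a :: ennreal assume "a > 0"
    then obtain e :: real where e: "e > 0" "ennreal (3 * e) < a"
    proof -
      obtain b where "0 < b" "b < a" using dense \<open>a > 0\<close> by blast
      then obtain r where "b = ennreal r" "r > 0" by (cases b) auto
      then show ?thesis using that[of "r / 3"] \<open>b < a\<close> by simp
    qed
    obtain g where [measurable]: "g \<in> borel_measurable borel" and g: "P g" "(\<integral>\<^sup>+x. norm (f x - g x) \<partial>lborel) \<le> e"
      using g[OF e(1)] by blast
    have "eventually (\<lambda>n. D g n < e) sequentially"
      using g(1) e(1) unfolding P_def by (intro order_tendstoD) auto
    then show "eventually (\<lambda>n. D f n < a) sequentially"
    proof eventually_elim
      case (elim n)
      have "D f n \<le> D g n + D (\<lambda>x. f x - g x) n"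
        using D_add[of g "\<lambda>x. f x - g x" n] by simp
      also have "\<dots> \<le> ennreal e + 2 * ennreal e"
      proof (rule add_mono)
        have "D (\<lambda>x. f x - g x) n \<le> 2 * (\<integral>\<^sup>+x. norm (f x - g x) \<partial>lborel)" by (rule D_le) measurable
        also have "\<dots> \<le> 2 * ennreal e" using g(2) by (intro mult_left_mono) auto
        finally show "D (\<lambda>x. f x - g x) n \<le> 2 * ennreal e" .
      qed (use elim in auto)
      also have "\<dots> = ennreal (3 * e)"
        using e(1) by (simp add: ennreal_mult' flip: distrib_left mult_2) (simp flip: ennreal_numeral ennreal_plus ennreal_mult')
      also have "\<dots> < a" by fact
      finally show ?case .
    qed
  qed auto
  have P_open: "P (\<lambda>x. indicator U x *\<^sub>R c)" if U: "open U" "emeasure lborel U < \<infinity>" for U c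
  proof -
    \<comment> \<open>The part of \<open>U\<close> lost under translation lies in \<open>U\<close>,
      which dominates it; the part gained lies in no fixed set. Since \<open>s n\<close> has
      integral zero, the integral of its absolute value is twice that of its positive part, so
      control of the lost part suffices.\<close>
    define s where "s n x = (indicator U x - indicator U (x + h n) :: real)" for n x
    have [measurable]: "U \<in> sets borel" using U by simp
    have int: "integrable lborel (indicator U :: 'a \<Rightarrow> real)"
      using U by (intro integrable_real_indicator) auto
    have inth: "integrable lborel (\<lambda>x. indicator U (x + h n) :: real)" for n
      using int integrable_lborel_translate[of "indicator U :: 'a \<Rightarrow> real" "h n"] by simp
    have ints: "integrable lborel (s n)" for n unfolding s_def using int inth by auto
    have s0: "(\<integral>x. s n x \<partial>lborel) = 0" for n
      unfolding s_def using int inth[of n] integral_lborel_translate[of "indicator U :: 'a \<Rightarrow> real" "h n"]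
      by simp
    have "(\<lambda>n. \<integral>x. max 0 (s n x) \<partial>lborel) \<longlonglongrightarrow> (\<integral>x. 0 \<partial>(lborel :: 'a measure))"
    proof (rule integral_dominated_convergence)
      show "AE x in lborel. (\<lambda>n. max 0 (s n x)) \<longlonglongrightarrow> 0"
      proof (rule AE_I2)
        fix x
        have "eventually (\<lambda>n. max 0 (s n x) = 0) sequentially"
        proof (cases "x \<in> U")
          case True
          \<comment> \<open>Openness of \<open>U\<close> enters here: small shifts keep
            \<open>x\<close> in \<open>U\<close>.\<close>
          have "(\<lambda>n. x + h n) \<longlonglongrightarrow> x + 0" by (intro tendsto_intros h)
          then have "eventually (\<lambda>n. x + h n \<in> U) sequentially"
            using U(1) True by (intro topological_tendstoD) auto
          then show ?thesis by eventually_elim (use True in \<open>simp add: s_def\<close>)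
        qed (simp add: s_def)
        then show "(\<lambda>n. max 0 (s n x)) \<longlonglongrightarrow> 0" by (rule tendsto_eventually)
      qed
      show "integrable lborel (indicator U :: 'a \<Rightarrow> real)" by fact
    qed (auto simp: s_def indicator_def)
    then have "(\<lambda>n. ennreal (2 * norm c * (\<integral>x. max 0 (s n x) \<partial>lborel))) \<longlonglongrightarrow> ennreal (2 * norm c * 0)"
      by (intro tendsto_ennrealI tendsto_mult tendsto_const) simp
    moreover have "D (\<lambda>x. indicator U x *\<^sub>R c) n = ennreal (2 * norm c * (\<integral>x. max 0 (s n x) \<partial>lborel))" for n
    proof -
      have "D (\<lambda>x. indicator U x *\<^sub>R c) n = (\<integral>\<^sup>+x. ennreal (\<bar>s n x\<bar> * norm c) \<partial>lborel)"
        unfolding D_def by (intro nn_integral_cong) (auto simp: s_def indicator_def)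
      also have "\<dots> = ennreal (\<integral>x. \<bar>s n x\<bar> * norm c \<partial>lborel)"
        using ints by (intro nn_integral_eq_integral) auto
      also have "(\<integral>x. \<bar>s n x\<bar> * norm c \<partial>lborel) = (\<integral>x. 2 * norm c * max 0 (s n x) - norm c * s n x \<partial>lborel)"
        by (intro Bochner_Integration.integral_cong) (auto simp: max_def)
      also have "\<dots> = 2 * norm c * (\<integral>x. max 0 (s n x) \<partial>lborel)"
        using ints[of n] s0[of n] by (subst Bochner_Integration.integral_diff) (auto intro!: integrable_max)
      finally show ?thesis .
    qed
    then have "D (\<lambda>x. indicator U x *\<^sub>R c) = (\<lambda>n. ennreal (2 * norm c * (\<integral>x. max 0 (s n x) \<partial>lborel)))"
      by (rule ext)
    ultimately show ?thesis by (simp add: P_def)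
  qed
  have "P f"
    using assms(1)
  proof (induction rule: integrable_induct)
    case (base A c)
    then have [measurable]: "A \<in> sets borel" by simp
    show ?case
    proof (rule P_approx)
      fix e :: real assume e: "e > 0"
      \<comment> \<open>The summand 1 keeps the quotient meaningful when c = 0.\<close>
      define e' where "e' = e / (norm c + 1)"
      have e': "e' > 0" "e' * norm c \<le> e" using e by (auto simp: e'_def field_simps add_pos_nonneg)
      obtain U where U: "open U" "A \<subseteq> U" "emeasure lborel (U - A) < e'"
        using outer_regular_lborel[OF \<open>A \<in> sets borel\<close> e'(1)] .
      have "emeasure lborel U \<le> emeasure lborel A + emeasure lborel (U - A)"
        using U emeasure_subadditive[of A lborel "U - A"] by (simp add: Un_absorb1)
      also have "\<dots> < \<infinity>" using base(2) U(3) by (auto simp: ennreal_add_less_top intro: less_trans)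
      finally have "P (\<lambda>x. indicator U x *\<^sub>R c)" using U(1) by (rule P_open[rotated])
      moreover have "(\<integral>\<^sup>+x. norm (indicator A x *\<^sub>R c - indicator U x *\<^sub>R c) \<partial>lborel) \<le> e"
      proof -
        have "(\<integral>\<^sup>+x. norm (indicator A x *\<^sub>R c - indicator U x *\<^sub>R c) \<partial>lborel)
          = (\<integral>\<^sup>+x. ennreal (norm c) * indicator (U - A) x \<partial>lborel)"
          using U(2) by (intro nn_integral_cong) (auto simp: indicator_def)
        also have "\<dots> = ennreal (norm c) * emeasure lborel (U - A)"
          using U(1) by (subst nn_integral_cmult_indicator) auto
        also have "\<dots> \<le> ennreal (norm c) * ennreal e'" using U(3) by (intro mult_left_mono) auto
        also have "\<dots> = ennreal (e' * norm c)" using e' by (simp add: mult.commute flip: ennreal_mult)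
        also have "\<dots> \<le> e" using e' by (intro ennreal_leI)
        finally show ?thesis .
      qed
      moreover have "(\<lambda>x. indicator U x *\<^sub>R c) \<in> borel_measurable borel"
        using U(1) by (intro borel_measurable_scaleR borel_measurable_indicator) auto
      ultimately show "\<exists>g\<in>borel_measurable borel. P g \<and> (\<integral>\<^sup>+x. norm (indicator A x *\<^sub>R c - g x) \<partial>lborel) \<le> e"
        by blast
    qed measurable
  next
    case (add f g)
    then show ?case by (intro P_add) auto
  next
    case (lim f s)
    then have [measurable]: "f \<in> borel_measurable borel" "\<And>i. s i \<in> borel_measurable borel"
      by (simp_all add: borel_measurable_integrable[where M=lborel, simplified])
    show ?case
    proof (rule P_approx)
      fix e :: real assume e: "e > 0"
      have "(\<lambda>i. (\<integral>\<^sup>+x. norm (f x - s i x) \<partial>lborel)) \<longlonglongrightarrow> 0"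
      proof (rule nn_integral_dominated_convergence_norm[where w = "\<lambda>x. 2 * norm (f x)"])
        have "(\<integral>\<^sup>+ x. ennreal (2 * norm (f x)) \<partial>lborel) = ennreal (\<integral>x. 2 * norm (f x) \<partial>lborel)"
          using lim by (intro nn_integral_eq_integral) auto
        then show "(\<integral>\<^sup>+ x. ennreal (2 * norm (f x)) \<partial>lborel) < \<infinity>" by simp
      qed (use lim in auto)
      then have "eventually (\<lambda>i. (\<integral>\<^sup>+x. norm (f x - s i x) \<partial>lborel) < ennreal e) sequentially"
        using e by (intro order_tendstoD) auto
      then obtain i where "(\<integral>\<^sup>+x. norm (f x - s i x) \<partial>lborel) < ennreal e"
        by (auto simp: eventually_sequentially)
      with lim show "\<exists>g\<in>borel_measurable borel. P g \<and> (\<integral>\<^sup>+x. norm (f x - g x) \<partial>lborel) \<le> e"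
        by (intro bexI[of _ "s i"]) auto
    qed measurable
  qed
  then show ?thesis by (simp add: P_def D_def[abs_def])
qed

section \<open>Integration by parts for functions with compact support\<close>

lemma partial_deriv_bound:
  fixes f :: "real^'d::finite \<Rightarrow> 'b::euclidean_space"
  assumes "Ck (Suc 0) f" "\<And>j x. norm (partial_deriv j f x) \<le> B"
  shows "norm (f x - f y) \<le> real CARD('d) * B * norm (x - y)"
proof (rule differentiable_bound[of UNIV f "\<lambda>x h. \<Sum>j\<in>UNIV. h $ j *\<^sub>R partial_deriv j f x"])
  show "(f has_derivative (\<lambda>h. \<Sum>j\<in>UNIV. h $ j *\<^sub>R partial_deriv j f x)) (at x within UNIV)" for x
    using Ck_has_derivative[OF assms(1)] by simp
  show "onorm (\<lambda>h. \<Sum>j\<in>UNIV. h $ j *\<^sub>R partial_deriv j f x) \<le> real CARD('d) * B" for x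
  proof (rule onorm_le)
    fix h :: "real^'d"
    have "norm (\<Sum>j\<in>UNIV. h $ j *\<^sub>R partial_deriv j f x) \<le> (\<Sum>j::'d\<in>UNIV. norm h * B)"
      by (intro sum_norm_le) (auto intro!: mult_mono component_le_norm_cart assms)
    then show "norm (\<Sum>j\<in>UNIV. h $ j *\<^sub>R partial_deriv j f x) \<le> real CARD('d) * B * norm h"
      by (simp add: mult_ac)
  qed
qed auto

text \<open>Difference quotients in a coordinate direction have integral zero by translation
  invariance, and they converge to the partial derivative; compact support gives a Lipschitz bound
  and hence a dominating function.\<close>

lemma integral_partial_deriv_eq_0:
  fixes f :: "real^'d::finite \<Rightarrow> 'b::euclidean_space"
  assumes C1: "Ck (Suc 0) f" and K: "compact K" "\<And>x. x \<notin> K \<Longrightarrow> f x = 0"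
  shows "(\<integral>x. partial_deriv j f x \<partial>lborel) = 0"
proof -
  have pd0: "partial_deriv i f x = 0" if "x \<notin> K" for x i
    by (rule partial_deriv_eq_0[of "- K"]) (use that K compact_imp_closed in auto)
  have cont: "continuous_on UNIV f" "\<And>i. continuous_on UNIV (partial_deriv i f)"
    using Ck_continuous[OF C1] C1 by simp_all
  then have [measurable]: "f \<in> borel_measurable borel" "\<And>i. partial_deriv i f \<in> borel_measurable borel"
    using borel_measurable_continuous_onI by blast+
  have "bounded (\<Union>i. partial_deriv i f ` K)"
    using cont K by (intro bounded_UN) (auto intro!: compact_imp_bounded compact_continuous_image intro: continuous_on_subset)
  then obtain B where "B > 0" and B: "\<And>i x. x \<in> K \<Longrightarrow> norm (partial_deriv i f x) \<le> B"
    by (fastforce simp: bounded_pos)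
  have B: "norm (partial_deriv i f x) \<le> B" for i x
    using B \<open>B > 0\<close> pd0 by (cases "x \<in> K") auto
  define C where "C = real CARD('d) * B"
  have lip: "norm (f x - f y) \<le> C * norm (x - y)" for x y
    unfolding C_def by (rule partial_deriv_bound[OF C1 B])
  have C0: "C \<ge> 0" using \<open>B > 0\<close> by (simp add: C_def)
  obtain R where R: "\<And>x. x \<in> K \<Longrightarrow> norm x \<le> R" using K compact_imp_bounded bounded_iff by metis
  define e :: "real^'d" where "e = axis j 1"
  define q where "q n x = real (Suc n) *\<^sub>R (f (x + (1 / real (Suc n)) *\<^sub>R e) - f x)" for n x
  have ne: "norm e = 1" by (simp add: e_def)
  have fint: "integrable lborel f"
  proof -
    have "set_integrable lborel K f"
      unfolding set_integrable_def using K cont(1)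
      by (intro borel_integrable_compact) (auto intro: continuous_on_subset)
    moreover have "indicator K x *\<^sub>R f x = f x" for x using K(2) by (auto simp: indicator_def)
    ultimately show ?thesis by (simp add: set_integrable_def)
  qed
  have "(\<integral>x. q n x \<partial>lborel) = 0" for n
    unfolding q_def using fint integral_lborel_translate[of f] integrable_lborel_translate[of f]
    by simp
  moreover have "(\<lambda>n. \<integral>x. q n x \<partial>lborel) \<longlonglongrightarrow> (\<integral>x. partial_deriv j f x \<partial>lborel)"
  proof (rule integral_dominated_convergence)
    \<comment> \<open>The step length is at most 1, so outside the ball of radius
      \<open>R + 1\<close> both points of the quotient miss \<open>K\<close>.\<close>
    show "integrable lborel (\<lambda>x. C * indicator (cball 0 (R + 1)) x :: real)"
      using emeasure_bounded_finite[OF bounded_cball, of 0 "R + 1"]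
      by (intro integrable_mult_right integrable_real_indicator) (auto simp: top.not_eq_extremum)
    show "AE x in lborel. norm (q n x) \<le> C * indicator (cball 0 (R + 1)) x" for n
    proof (rule AE_I2)
      fix x
      show "norm (q n x) \<le> C * indicator (cball 0 (R + 1)) x"
      proof (cases "x \<in> cball 0 (R + 1)")
        case True
        have "norm (q n x) = real (Suc n) * norm (f (x + (1 / real (Suc n)) *\<^sub>R e) - f x)"
          by (simp add: q_def)
        also have "\<dots> \<le> real (Suc n) * (C * norm ((x + (1 / real (Suc n)) *\<^sub>R e) - x))"
          by (intro mult_left_mono lip) auto
        also have "\<dots> = C" by (simp add: ne)
        finally show ?thesis using True by simp
      next
        case False
        have "norm x - norm ((1 / real (Suc n)) *\<^sub>R e) \<le> norm (x + (1 / real (Suc n)) *\<^sub>R e)"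
          by (metis add.commute norm_diff_ineq)
        moreover have "norm ((1 / real (Suc n)) *\<^sub>R e) \<le> 1" by (simp add: ne)
        moreover have "R + 1 < norm x" using False by simp
        ultimately have "R < norm (x + (1 / real (Suc n)) *\<^sub>R e)" "R < norm x" by linarith+
        then have "x + (1 / real (Suc n)) *\<^sub>R e \<notin> K" "x \<notin> K"
          using R[of x] R[of "x + (1 / real (Suc n)) *\<^sub>R e"] by auto
        then show ?thesis using K(2) False by (simp add: q_def)
      qed
    qed
    show "AE x in lborel. (\<lambda>n. q n x) \<longlonglongrightarrow> partial_deriv j f x"
    proof (rule AE_I2)
      fix x
      let ?D = "\<lambda>h. \<Sum>j\<in>UNIV. h $ j *\<^sub>R partial_deriv j f x"
      have "(f has_derivative ?D) (at x)"
        using Ck_has_derivative[OF C1] .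
      moreover have "((\<lambda>t::real. x + t *\<^sub>R e) has_derivative (\<lambda>t. t *\<^sub>R e)) (at 0)"
        by (auto intro!: derivative_eq_intros)
      ultimately have "((\<lambda>t. f (x + t *\<^sub>R e)) has_derivative (\<lambda>t. ?D (t *\<^sub>R e))) (at 0)"
        using has_derivative_compose[of "\<lambda>t. x + t *\<^sub>R e" "\<lambda>t. t *\<^sub>R e" 0 UNIV f ?D] by simp
      moreover have "?D (t *\<^sub>R e) = t *\<^sub>R partial_deriv j f x" for t
        by (simp add: e_def flip: scaleR_scaleR scaleR_sum_right)
      ultimately have "((\<lambda>t. f (x + t *\<^sub>R e)) has_vector_derivative partial_deriv j f x) (at 0)"
        by (simp add: has_vector_derivative_def)
      then have "((\<lambda>t. norm (f (x + t *\<^sub>R e) - f x - t *\<^sub>R partial_deriv j f x) / norm t) \<longlongrightarrow> 0) (at 0)"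
        unfolding has_vector_derivative_def has_derivative_at by simp
      then have "((\<lambda>t. norm ((1 / t) *\<^sub>R (f (x + t *\<^sub>R e) - f x) - partial_deriv j f x)) \<longlongrightarrow> 0) (at 0)"
      proof (rule Lim_transform_eventually)
        show "\<forall>\<^sub>F t in at 0. norm (f (x + t *\<^sub>R e) - f x - t *\<^sub>R partial_deriv j f x) / norm t =
             norm ((1 / t) *\<^sub>R (f (x + t *\<^sub>R e) - f x) - partial_deriv j f x)"
        proof (rule eventually_at_filter[THEN iffD2], rule always_eventually, intro allI impI)
          fix t :: real assume "t \<noteq> 0"
          then have "(1 / t) *\<^sub>R (f (x + t *\<^sub>R e) - f x) - partial_deriv j f x
             = (1 / t) *\<^sub>R (f (x + t *\<^sub>R e) - f x - t *\<^sub>R partial_deriv j f x)"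
            by (simp add: scaleR_right_diff_distrib)
          then show "norm (f (x + t *\<^sub>R e) - f x - t *\<^sub>R partial_deriv j f x) / norm t =
             norm ((1 / t) *\<^sub>R (f (x + t *\<^sub>R e) - f x) - partial_deriv j f x)" by simp
        qed
      qed
      then have lim: "((\<lambda>t. (1 / t) *\<^sub>R (f (x + t *\<^sub>R e) - f x)) \<longlongrightarrow> partial_deriv j f x) (at 0)"
        using tendsto_norm_zero_iff LIM_zero_cancel by blast
      have "filterlim (\<lambda>n. 1 / real (Suc n)) (at 0) sequentially"
        using LIMSEQ_inverse_real_of_nat by (intro filterlim_atI) (simp_all add: inverse_eq_divide)
      from filterlim_compose[OF lim this] show "(\<lambda>n. q n x) \<longlonglongrightarrow> partial_deriv j f x"
        by (simp add: q_def)
    qed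
  qed (auto simp: q_def)
  ultimately show ?thesis by (simp add: LIMSEQ_const_iff)
qed

section \<open>Mollification\<close>

definition conv :: "('a::euclidean_space \<Rightarrow> real) \<Rightarrow> ('a \<Rightarrow> 'b::euclidean_space) \<Rightarrow> 'a \<Rightarrow> 'b" where
  "conv k w x = (\<integral>y. k (x - y) *\<^sub>R w y \<partial>lborel)"

lemma integrable_bounded_scaleR:
  fixes k :: "'a::euclidean_space \<Rightarrow> real" and w :: "'a \<Rightarrow> 'b::euclidean_space"
  assumes "k \<in> borel_measurable borel" "\<And>x. \<bar>k x\<bar> \<le> B" "integrable lborel w"
  shows "integrable lborel (\<lambda>y. k y *\<^sub>R w y)"
proof (rule Bochner_Integration.integrable_bound)
  show "integrable lborel (\<lambda>y. B *\<^sub>R w y)" using assms by simp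
  show "AE x in lborel. norm (k x *\<^sub>R w x) \<le> norm (B *\<^sub>R w x)"
    using order.trans[OF assms(2) abs_ge_self] by (intro AE_I2) (simp add: mult_right_mono)
  show "(\<lambda>y. k y *\<^sub>R w y) \<in> borel_measurable lborel"
    using assms borel_measurable_integrable[OF assms(3)] by simp
qed

lemma integrable_conv:
  fixes k :: "real^'d::finite \<Rightarrow> real" and w :: "real^'d \<Rightarrow> 'b::euclidean_space"
  assumes "k \<in> Cc_inf UNIV" "integrable lborel w"
  shows "integrable lborel (\<lambda>y. k (x - y) *\<^sub>R w y)"
proof -
  obtain B where "\<And>x. norm (k x) \<le> B" using Cc_inf_bounded[OF assms(1)] by metis
  then show ?thesis
    using Cc_inf_borel[OF assms(1)] assms(2)
    by (intro integrable_bounded_scaleR[of _ B]) auto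
qed

lemma conv_norm_le:
  fixes k :: "real^'d::finite \<Rightarrow> real" and w :: "real^'d \<Rightarrow> 'b::euclidean_space"
  assumes "k \<in> borel_measurable borel" "\<And>x. \<bar>k x\<bar> \<le> B" "integrable lborel w"
  shows "norm (conv k w x) \<le> B * (\<integral>y. norm (w y) \<partial>lborel)"
proof -
  have "integrable lborel (\<lambda>y. k (x - y) *\<^sub>R w y)"
    using assms by (intro integrable_bounded_scaleR[of _ B]) auto
  have "norm (conv k w x) \<le> (\<integral>y. norm (k (x - y) *\<^sub>R w y) \<partial>lborel)"
    unfolding conv_def by (rule Bochner_Integration.integral_norm_bound)
  also have "\<dots> \<le> (\<integral>y. B * norm (w y) \<partial>lborel)"
    using integrable_norm[OF \<open>integrable lborel (\<lambda>y. k (x - y) *\<^sub>R w y)\<close>] assms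
    by (intro integral_mono) (auto intro!: mult_right_mono)
  finally show ?thesis by simp
qed

section \<open>Differentiation of a convolution\<close>

text \<open>Bounded second derivatives make the first-order Taylor remainder quadratic in
  \<open>h\<close>, uniformly in the base point. Uniformity is what allows the remainder to be
  integrated against an arbitrary integrable function.\<close>

lemma Cc_inf_linearization:
  fixes k :: "real^'d::finite \<Rightarrow> real"
  assumes k: "k \<in> Cc_inf UNIV"
  obtains C where "C \<ge> 0"
    "\<And>z h. \<bar>k (z + h) - k z - (\<Sum>j\<in>UNIV. h $ j *\<^sub>R partial_deriv j k z)\<bar> \<le> C * (norm h)\<^sup>2"
proof -
  have "\<exists>B>0. \<forall>i x. norm (partial_deriv i (partial_deriv j k) x) \<le> B" for j
  proof -
    have "\<exists>B>0. \<forall>x. norm (partial_deriv i (partial_deriv j k) x) \<le> B" for i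
      using Cc_inf_bounded[OF Cc_inf_partial_deriv[OF Cc_inf_partial_deriv[OF k]]] by metis
    then obtain B where "\<And>i. B i > 0" "\<And>i x. norm (partial_deriv i (partial_deriv j k) x) \<le> B i" by metis
    then show ?thesis by (intro exI[of _ "Max (range B)"]) (auto simp: Max_ge_iff Max_gr_iff)
  qed
  then obtain B where B: "\<And>j. B j > 0" "\<And>i j x. norm (partial_deriv i (partial_deriv j k) x) \<le> B j" by metis
  have lip: "\<bar>partial_deriv j k x - partial_deriv j k y\<bar> \<le> real CARD('d) * B j * norm (x - y)" for j x y
    using partial_deriv_bound[OF Cc_inf_Ck[OF Cc_inf_partial_deriv[OF k]] B(2)] by simp
  define C where "C = (\<Sum>j\<in>UNIV. real CARD('d) * B j)"
  show ?thesis
  proof (rule that)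
    show "C \<ge> 0" unfolding C_def by (intro sum_nonneg mult_nonneg_nonneg) (simp_all add: less_imp_le B)
    fix z h :: "real^'d"
    let ?D = "\<lambda>x h. \<Sum>j\<in>UNIV. h $ j *\<^sub>R partial_deriv j k x"
    \<comment> \<open>On the ball of radius \<open>norm h\<close> the derivative differs from that
      at \<open>z\<close> by at most \<open>C * norm h\<close>, by the Lipschitz bound; the mean
      value inequality supplies the second factor \<open>norm h\<close>.\<close>
    have "norm (k (z + h) - k z - ?D z (z + h - z)) \<le> norm (z + h - z) * (C * norm h)"
    proof (rule differentiable_bound_linearization[where S = "cball z (norm h)"])
      show "(k has_derivative ?D x) (at x within cball z (norm h))" for x
        by (rule has_derivative_at_withinI, rule Ck_has_derivative[OF Cc_inf_Ck[OF k]])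
      show "z + t *\<^sub>R (z + h - z) \<in> cball z (norm h)" if "t \<in> {0..1}" for t
        using that by (auto simp: dist_norm mult_left_le_one_le)
      show "onorm (?D x - ?D z) \<le> C * norm h" if "x \<in> cball z (norm h)" for x
      proof (rule onorm_le)
        fix v :: "real^'d"
        have "norm ((?D x - ?D z) v) = norm (\<Sum>j\<in>UNIV. v $ j * (partial_deriv j k x - partial_deriv j k z))"
          by (simp add: sum_subtractf algebra_simps)
        also have "\<dots> \<le> (\<Sum>j\<in>UNIV. norm v * (real CARD('d) * B j * norm h))"
        proof (rule sum_norm_le)
          fix j
          have "\<bar>partial_deriv j k x - partial_deriv j k z\<bar> \<le> real CARD('d) * B j * norm h"
            using that B(1)[of j] by (intro order.trans[OF lip mult_left_mono]) (auto simp: dist_norm norm_minus_commute less_imp_le)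
          then show "norm (v $ j * (partial_deriv j k x - partial_deriv j k z)) \<le> norm v * (real CARD('d) * B j * norm h)"
            by (auto simp: abs_mult intro!: mult_mono component_le_norm_cart)
        qed
        also have "\<dots> = C * norm h * norm v" by (simp add: C_def sum_distrib_left sum_distrib_right algebra_simps)
        finally show "norm ((?D x - ?D z) v) \<le> C * norm h * norm v" .
      qed
    qed auto
    then show "\<bar>k (z + h) - k z - (\<Sum>j\<in>UNIV. h $ j *\<^sub>R partial_deriv j k z)\<bar> \<le> C * (norm h)\<^sup>2"
      by (simp add: power2_eq_square mult_ac)
  qed
qed

text \<open>The Taylor remainder of the convolution is the convolution with the Taylor remainder
  \<open>r\<close> of the kernel, hence at most a constant times the square of \<open>norm h\<close>
  times the L1 norm of \<open>w\<close>.\<close>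

lemma conv_has_derivative:
  fixes k :: "real^'d::finite \<Rightarrow> real" and w :: "real^'d \<Rightarrow> 'b::euclidean_space"
  assumes k: "k \<in> Cc_inf UNIV" and w: "integrable lborel w"
  shows "(conv k w has_derivative (\<lambda>h. \<Sum>j\<in>UNIV. h $ j *\<^sub>R conv (partial_deriv j k) w x)) (at x)"
    (is "(_ has_derivative ?D) _")
proof -
  obtain C where C: "C \<ge> 0"
    "\<And>z h. \<bar>k (z + h) - k z - (\<Sum>j\<in>UNIV. h $ j *\<^sub>R partial_deriv j k z)\<bar> \<le> C * (norm h)\<^sup>2"
    by (rule Cc_inf_linearization[OF k]) blast
  have pk: "partial_deriv j k \<in> Cc_inf UNIV" for j by (rule Cc_inf_partial_deriv[OF k])
  have [measurable]: "k \<in> borel_measurable borel" "\<And>j. partial_deriv j k \<in> borel_measurable borel"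
    using Cc_inf_borel[OF k] Cc_inf_borel[OF pk] .
  define W where "W = (\<integral>y. norm (w y) \<partial>lborel)"
  have bd: "norm (conv k w (x + h) - conv k w x - ?D h) \<le> C * (norm h)\<^sup>2 * W" for h
  proof -
    define r where "r z = k (z + h) - k z - (\<Sum>j\<in>UNIV. h $ j *\<^sub>R partial_deriv j k z)" for z
    have "conv k w (x + h) - conv k w x - ?D h
      = (\<integral>y. k (x + h - y) *\<^sub>R w y - k (x - y) *\<^sub>R w y - (\<Sum>j\<in>UNIV. h $ j *\<^sub>R partial_deriv j k (x - y) *\<^sub>R w y) \<partial>lborel)"
      unfolding conv_def using integrable_conv[OF k w] integrable_conv[OF pk w] by (simp del: scaleR_scaleR)
    also have "\<dots> = conv r w x"
      unfolding conv_def r_def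
      by (intro Bochner_Integration.integral_cong)
        (auto simp: scaleR_diff_left scaleR_sum_left algebra_simps)
    finally have "norm (conv k w (x + h) - conv k w x - ?D h) = norm (conv r w x)" by simp
    also have "\<dots> \<le> C * (norm h)\<^sup>2 * W"
      unfolding W_def
    proof (rule conv_norm_le[OF _ _ w])
      show "r \<in> borel_measurable borel" unfolding r_def by measurable
    qed (use C(2)[of _ h] in \<open>simp add: r_def\<close>)
    finally show ?thesis .
  qed
  have lim: "((\<lambda>h. norm (conv k w (x + h) - conv k w x - ?D h) / norm h) \<longlongrightarrow> 0) (at 0)"
  proof (rule Lim_null_comparison)
    show "\<forall>\<^sub>F h in at 0. norm (norm (conv k w (x + h) - conv k w x - ?D h) / norm h) \<le> C * norm h * W"
    proof (rule eventually_at_filter[THEN iffD2], rule always_eventually, intro allI impI)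
      fix h :: "real^'d" assume "h \<noteq> 0"
      then show "norm (norm (conv k w (x + h) - conv k w x - ?D h) / norm h) \<le> C * norm h * W"
        using bd[of h] by (simp add: field_simps power2_eq_square)
    qed
    show "((\<lambda>h::real^'d. C * norm h * W) \<longlongrightarrow> 0) (at 0)"
      by (intro tendsto_eq_intros | simp)+
  qed
  have "bounded_linear ?D"
    by (intro bounded_linear_intros bounded_linear_vec_nth)
  with lim show ?thesis unfolding has_derivative_at by blast
qed

lemma conv_differentiable:
  fixes k :: "real^'d::finite \<Rightarrow> real" and w :: "real^'d \<Rightarrow> 'b::euclidean_space"
  assumes "k \<in> Cc_inf UNIV" "integrable lborel w"
  shows "conv k w differentiable_on UNIV"
  using conv_has_derivative[OF assms] unfolding differentiable_on_def differentiable_def by auto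

lemma partial_deriv_conv:
  fixes k :: "real^'d::finite \<Rightarrow> real" and w :: "real^'d \<Rightarrow> 'b::euclidean_space"
  assumes "k \<in> Cc_inf UNIV" "integrable lborel w"
  shows "partial_deriv j (conv k w) x = conv (partial_deriv j k) w x"
  using partial_deriv_eqI[OF conv_has_derivative[OF assms], of j] by simp

text \<open>The kernel is generalised in the induction: every derivative falls on it, and partial
  derivatives of a test function are again test functions.\<close>

lemma Ck_conv:
  fixes k :: "real^'d::finite \<Rightarrow> real" and w :: "real^'d \<Rightarrow> 'b::euclidean_space"
  assumes "k \<in> Cc_inf UNIV" "integrable lborel w"
  shows "Ck n (conv k w)"
  using assms(1)
proof (induction n arbitrary: k)
  case 0
  then show ?case using conv_differentiable[OF _ assms(2)] by (auto intro: differentiable_imp_continuous_on)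
next
  case (Suc n)
  show ?case
    by (rule Ck_SucI[OF conv_has_derivative[OF Suc.prems assms(2)]])
      (use Suc in \<open>auto intro: Cc_inf_partial_deriv\<close>)
qed

lemma conv_borel_measurable:
  fixes k :: "real^'d::finite \<Rightarrow> real" and w :: "real^'d \<Rightarrow> 'b::euclidean_space"
  assumes "k \<in> Cc_inf UNIV" "integrable lborel w"
  shows "conv k w \<in> borel_measurable borel"
  using Ck_conv[OF assms, of 0] by (auto intro: borel_measurable_continuous_onI)

text \<open>Weak gradients on the whole space, with integrability in place of local integrability.
  For \<open>u\<close> vanishing outside a domain, testing with functions that need not vanish at
  its boundary expresses zero boundary values.\<close>

definition wgrad :: "(real^'d::finite \<Rightarrow> real^'n::finite) \<Rightarrow> (real^'d \<Rightarrow> real^'d^'n) \<Rightarrow> bool" where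
  "wgrad u G \<longleftrightarrow> integrable lborel u \<and> integrable lborel G \<and>
     (\<forall>\<phi>\<in>Cc_inf UNIV. \<forall>i j. (\<integral>x. u x $ i * partial_deriv j \<phi> x \<partial>lborel) = - (\<integral>x. G x $ i $ j * \<phi> x \<partial>lborel))"

lemma integrable_vec_nth: "integrable M f \<Longrightarrow> integrable M (\<lambda>x. f x $ i)"
  using integrable_bounded_linear[OF bounded_linear_vec_nth] .

lemma integral_vec_nth: "integrable M f \<Longrightarrow> (\<integral>x. f x $ i \<partial>M) = (\<integral>x. f x \<partial>M) $ i"
  using integral_bounded_linear[OF bounded_linear_vec_nth] .

lemma conv_vec_nth:
  fixes k :: "real^'d::finite \<Rightarrow> real" and w :: "real^'d \<Rightarrow> 'b::euclidean_space^'n::finite"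
  assumes "k \<in> Cc_inf UNIV" "integrable lborel w"
  shows "conv k w x $ i = conv k (\<lambda>x. w x $ i) x"
  unfolding conv_def using integral_vec_nth[OF integrable_conv[OF assms], of x i] by simp

text \<open>The reflected kernel, as a function of the integration variable, is a legitimate test
  function; the sign of the reflection cancels that of the integration by parts.\<close>

lemma wgrad_conv:
  assumes "wgrad u G" "k \<in> Cc_inf UNIV"
  shows "partial_deriv j (conv k u) x $ i = conv k G x $ i $ j"
proof -
  have u: "integrable lborel u" and G: "integrable lborel G" using assms by (auto simp: wgrad_def)
  define \<phi> where "\<phi> y = k ((-1) *\<^sub>R y + x)" for y
  have \<phi>: "\<phi> \<in> Cc_inf UNIV" unfolding \<phi>_def by (rule Cc_inf_affine) (use assms in auto)
  have pd: "partial_deriv j \<phi> y = - partial_deriv j k (x - y)" for y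
    unfolding \<phi>_def using partial_deriv_affine[OF Cc_inf_differentiable[OF assms(2)], of j "-1" x y] by simp
  have "partial_deriv j (conv k u) x $ i = conv (partial_deriv j k) (\<lambda>x. u x $ i) x"
    using assms u by (simp add: partial_deriv_conv conv_vec_nth Cc_inf_partial_deriv)
  also have "\<dots> = - (\<integral>y. u y $ i * partial_deriv j \<phi> y \<partial>lborel)"
    by (simp add: conv_def pd mult.commute)
  also have "\<dots> = (\<integral>y. G y $ i $ j * \<phi> y \<partial>lborel)"
    using assms(1) \<phi> by (simp add: wgrad_def)
  also have "\<dots> = conv k (\<lambda>x. G x $ i $ j) x"
    by (simp add: conv_def \<phi>_def mult.commute)
  also have "\<dots> = conv k G x $ i $ j"
    using assms G by (simp add: conv_vec_nth integrable_vec_nth)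
  finally show ?thesis .
qed

section \<open>Dilated kernels and their convergence in L1\<close>

text \<open>The prefactor preserves the integral, so that the dilations of a mollifier are
  mollifiers.\<close>

definition rescale :: "real \<Rightarrow> (real^'d::finite \<Rightarrow> real) \<Rightarrow> real^'d \<Rightarrow> real" where
  "rescale t k z = (1 / t) ^ CARD('d) *\<^sub>R k ((1 / t) *\<^sub>R z)"

lemma rescale_Cc_inf:
  assumes "k \<in> Cc_inf UNIV" "t > 0" shows "rescale t k \<in> Cc_inf UNIV"
  unfolding rescale_def
  using Cc_inf_affine[OF _ assms(1), of "1/t" 0] assms(2) by (intro Cc_inf_scaleR_Ck) (auto simp: Ck_const)

lemma partial_deriv_rescale:
  fixes k :: "real^'d::finite \<Rightarrow> real"
  assumes "k \<in> Cc_inf UNIV" "t > 0"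
  shows "partial_deriv j (rescale t k) x = (1 / t) * rescale t (partial_deriv j k) x"
proof -
  have "partial_deriv j (rescale t k) x
    = (1 / t) ^ CARD('d) *\<^sub>R partial_deriv j (\<lambda>z. k ((1 / t) *\<^sub>R z + 0)) x"
    unfolding rescale_def using Cc_inf_differentiable[OF Cc_inf_affine[OF _ assms(1), of "1/t" 0]] assms(2)
    by (subst partial_deriv_bounded_linear[OF bounded_linear_scaleR_right]) simp_all
  then show ?thesis
    by (simp only: partial_deriv_affine[OF Cc_inf_differentiable[OF assms(1)]]) (simp add: rescale_def)
qed

text \<open>The substitution y = x - t z frees the kernel of \<open>t\<close>, which is the form
  suited to limits as t tends to 0.\<close>

lemma conv_rescale:
  fixes f :: "real^'d::finite \<Rightarrow> 'b::euclidean_space"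
  assumes [measurable]: "k \<in> borel_measurable borel" "f \<in> borel_measurable borel" and "t > 0"
  shows "conv (rescale t k) f x = (\<integral>z. k z *\<^sub>R f (x - t *\<^sub>R z) \<partial>lborel)"
proof -
  have "conv (rescale t k) f x = t ^ CARD('d) *\<^sub>R (\<integral>z. rescale t k (t *\<^sub>R z) *\<^sub>R f (x - t *\<^sub>R z) \<partial>lborel)"
    unfolding conv_def using \<open>t > 0\<close>
    by (subst integral_lborel_affine[where b = x and c = "- t"]) (auto simp: rescale_def)
  also have "\<dots> = (\<integral>z. k z *\<^sub>R f (x - t *\<^sub>R z) \<partial>lborel)"
    using \<open>t > 0\<close> by (simp flip: integral_scaleR_right add: rescale_def power_one_over)
  finally show ?thesis .
qed

lemma rescale_eq_0: "(\<And>z. z \<notin> ball 0 r \<Longrightarrow> k z = 0) \<Longrightarrow> t > 0 \<Longrightarrow> z \<notin> ball 0 (t * r) \<Longrightarrow> rescale t k z = 0"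
  by (auto simp: rescale_def divide_simps mult.commute)

text \<open>By Tonelli, the L1 error is at most the average, with weight \<open>k\<close>, of the
  translation errors \<open>D (- t n *\<^sub>R z)\<close>. These tend to 0 for each \<open>z\<close>
  and are bounded, so dominated convergence applies, also when the kernel is concentrated away from
  0.\<close>

lemma conv_rescale_tendsto_L1:
  fixes f :: "real^'d::finite \<Rightarrow> 'b::euclidean_space"
  assumes k: "k \<in> Cc_inf UNIV" "\<And>x. k x \<ge> 0" "(\<integral>x. k x \<partial>lborel) = 1"
    and f: "integrable lborel f" and t: "\<And>n. t n > 0" "t \<longlonglongrightarrow> 0"
  shows "(\<lambda>n. \<integral>\<^sup>+x. norm (conv (rescale (t n) k) f x - f x) \<partial>lborel) \<longlonglongrightarrow> 0"
proof -
  have [measurable]: "k \<in> borel_measurable borel" "f \<in> borel_measurable borel"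
    using Cc_inf_borel[OF k(1)] borel_measurable_integrable[OF f] by auto
  obtain B where B: "\<And>x. norm (k x) \<le> B" using Cc_inf_bounded[OF k(1)] by metis
  have kint: "integrable lborel k" by (rule Cc_inf_integrable[OF k(1)])
  define D where "D h = (\<integral>\<^sup>+x. norm (f (x + h) - f x) \<partial>lborel)" for h
  have Dm[measurable]: "D \<in> borel_measurable borel" unfolding D_def by measurable
  define F where "F = (\<integral>x. norm (f x) \<partial>lborel)"
  have "(\<integral>\<^sup>+x. norm (f x) \<partial>lborel) = ennreal F"
    unfolding F_def using f by (intro nn_integral_eq_integral) auto
  then have D_le: "D h \<le> ennreal (2 * F)" for h
    using nn_integral_translate_diff_le[of f h] by (simp add: D_def ennreal_mult')
  have le: "(\<integral>\<^sup>+x. norm (conv (rescale (t n) k) f x - f x) \<partial>lborel) \<le> (\<integral>\<^sup>+z. ennreal (k z) * D (- t n *\<^sub>R z) \<partial>lborel)" for n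
  proof -
    have "norm (conv (rescale (t n) k) f x - f x) \<le> (\<integral>\<^sup>+z. ennreal (k z) * norm (f (x - t n *\<^sub>R z) - f x) \<partial>lborel)" for x
    proof -
      \<comment> \<open>\<open>f\<close> is merely integrable, so integrability of the substituted
        integrand is taken from the affine transformation of Lebesgue measure.\<close>
      have i1: "integrable lborel (\<lambda>z. k z *\<^sub>R f (x - t n *\<^sub>R z))"
      proof (rule integrable_bounded_scaleR[of _ B])
        have "integrable (density (distr lborel borel (\<lambda>z. x + (- t n) *\<^sub>R z)) (\<lambda>_. ennreal (\<bar>- t n\<bar> ^ DIM(real^'d)))) f"
          using f lborel_affine[of "- t n" x] t(1)[of n] by simp
        then have "integrable lborel (\<lambda>z. (\<bar>- t n\<bar> ^ DIM(real^'d)) *\<^sub>R f (x + (- t n) *\<^sub>R z))"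
          by (subst (asm) integrable_density) (auto simp: integrable_distr_eq)
        then have "integrable lborel (\<lambda>z. (1 / (\<bar>- t n\<bar> ^ DIM(real^'d))) *\<^sub>R (\<bar>- t n\<bar> ^ DIM(real^'d)) *\<^sub>R f (x + (- t n) *\<^sub>R z))"
          by (rule integrable_scaleR_right)
        then show "integrable lborel (\<lambda>z. f (x - t n *\<^sub>R z))" using t(1)[of n] by simp
      qed (use B in auto)
      have i2: "integrable lborel (\<lambda>z. k z *\<^sub>R f x)" using kint by simp
      have "conv (rescale (t n) k) f x - f x = (\<integral>z. k z *\<^sub>R f (x - t n *\<^sub>R z) \<partial>lborel) - (\<integral>z. k z *\<^sub>R f x \<partial>lborel)"
        using k(3) kint t(1)[of n] by (simp add: conv_rescale)
      also have "\<dots> = (\<integral>z. k z *\<^sub>R (f (x - t n *\<^sub>R z) - f x) \<partial>lborel)"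
        using i1 i2 by (simp add: scaleR_diff_right)
      finally have "ennreal (norm (conv (rescale (t n) k) f x - f x)) = ennreal (norm (\<integral>z. k z *\<^sub>R (f (x - t n *\<^sub>R z) - f x) \<partial>lborel))"
        by simp
      also have "\<dots> \<le> (\<integral>\<^sup>+z. norm (k z *\<^sub>R (f (x - t n *\<^sub>R z) - f x)) \<partial>lborel)"
        using i1 i2 by (intro integral_norm_bound_ennreal) (auto simp: scaleR_diff_right)
      also have "\<dots> = (\<integral>\<^sup>+z. ennreal (k z) * norm (f (x - t n *\<^sub>R z) - f x) \<partial>lborel)"
        using k(2) by (intro nn_integral_cong) (simp add: ennreal_mult')
      finally show ?thesis .
    qed
    then have "(\<integral>\<^sup>+x. norm (conv (rescale (t n) k) f x - f x) \<partial>lborel)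
        \<le> (\<integral>\<^sup>+x. \<integral>\<^sup>+z. ennreal (k z) * norm (f (x - t n *\<^sub>R z) - f x) \<partial>lborel \<partial>lborel)"
      by (intro nn_integral_mono) auto
    also have "\<dots> = (\<integral>\<^sup>+z. \<integral>\<^sup>+x. ennreal (k z) * norm (f (x - t n *\<^sub>R z) - f x) \<partial>lborel \<partial>lborel)"
      by (rule lborel_pair.Fubini'[symmetric]) measurable
    also have "\<dots> = (\<integral>\<^sup>+z. ennreal (k z) * D (- t n *\<^sub>R z) \<partial>lborel)"
      unfolding D_def by (intro nn_integral_cong) (subst nn_integral_cmult, auto)
    finally show ?thesis .
  qed
  have "(\<lambda>n. \<integral>\<^sup>+z. ennreal (k z) * D (- t n *\<^sub>R z) \<partial>lborel) \<longlonglongrightarrow> (\<integral>\<^sup>+z. 0 \<partial>(lborel :: (real^'d) measure))"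
  proof (rule nn_integral_dominated_convergence[where w = "\<lambda>z. ennreal (k z) * ennreal (2 * F)"])
    show "AE z in lborel. ennreal (k z) * D (- t n *\<^sub>R z) \<le> ennreal (k z) * ennreal (2 * F)" for n
      by (intro AE_I2 mult_left_mono D_le) auto
    have "(\<integral>\<^sup>+ z. ennreal (k z) \<partial>lborel) = 1"
      using k kint by (subst nn_integral_eq_integral) auto
    then show "(\<integral>\<^sup>+ z. ennreal (k z) * ennreal (2 * F) \<partial>lborel) < \<infinity>"
      by (simp add: nn_integral_multc)
    show "AE z in lborel. (\<lambda>n. ennreal (k z) * D (- t n *\<^sub>R z)) \<longlonglongrightarrow> 0"
    proof (rule AE_I2)
      fix z :: "real^'d"
      have "(\<lambda>n. - t n *\<^sub>R z) \<longlonglongrightarrow> 0" using tendsto_scaleR[OF tendsto_minus[OF t(2)] tendsto_const, of z] by simp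
      from translation_continuous_L1[OF f this] have "(\<lambda>n. D (- t n *\<^sub>R z)) \<longlonglongrightarrow> 0" by (simp add: D_def)
      then have "(\<lambda>n. ennreal (k z) * D (- t n *\<^sub>R z)) \<longlonglongrightarrow> ennreal (k z) * 0"
        by (intro ennreal_tendsto_cmult) auto
      then show "(\<lambda>n. ennreal (k z) * D (- t n *\<^sub>R z)) \<longlonglongrightarrow> 0" by simp
    qed
  qed measurable
  then have lim: "(\<lambda>n. \<integral>\<^sup>+z. ennreal (k z) * D (- t n *\<^sub>R z) \<partial>lborel) \<longlonglongrightarrow> 0" by simp
  show ?thesis
    by (rule tendsto_sandwich[OF _ _ tendsto_const lim]) (use le in auto)
qed

section \<open>Weak gradients\<close>

lemma Cc_inf_eq_0: "\<phi> \<in> Cc_inf S \<Longrightarrow> x \<notin> S \<Longrightarrow> \<phi> x = 0"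
  using closure_subset[of "{x. \<phi> x \<noteq> 0}"] by (auto simp: Cc_inf_def)

lemma norm_axis: "norm (axis j c :: real^'d::finite) = \<bar>c\<bar>"
proof -
  have "axis j c = c *\<^sub>R (axis j 1 :: real^'d)" by (simp add: vec_eq_iff axis_def)
  then show ?thesis by simp
qed

section \<open>From functions on a set to Borel functions on the whole space\<close>

lemma AE_lebesgue_on_iff:
  "S \<in> sets borel \<Longrightarrow> (AE x in lebesgue_on S. P x) \<longleftrightarrow> (AE x in lborel. x \<in> S \<longrightarrow> P x)"
  by (subst AE_restrict_space_iff) (auto simp: AE_completion_iff)

text \<open>Functions on a domain are measurable for the completed measure and have arbitrary values
  elsewhere; convolution and Tonelli's theorem work with Borel functions on the whole space. This is
  the passage between the two.\<close>

lemma ex_borel_representative: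
  fixes f :: "'a::euclidean_space \<Rightarrow> 'b::euclidean_space"
  assumes S: "S \<in> sets borel" and f: "f \<in> borel_measurable (lebesgue_on S)"
  obtains g where "g \<in> borel_measurable borel" "\<And>x. x \<notin> S \<Longrightarrow> g x = 0" "AE x in lebesgue_on S. f x = g x"
proof -
  have S': "S \<inter> space lebesgue \<in> sets lebesgue" using S by simp
  have m: "(\<lambda>x. indicator S x *\<^sub>R f x) \<in> borel_measurable lebesgue"
    using f borel_measurable_restrict_space_iff[OF S', of f] by simp
  have "\<exists>g\<in>borel_measurable lborel. AE x in lborel. (indicator S x *\<^sub>R f x) \<bullet> b = g x" for b
    by (intro completion_ex_borel_measurable_real borel_measurable_inner m borel_measurable_const)
  then have "\<forall>b. \<exists>g. g \<in> borel_measurable lborel \<and> (AE x in lborel. (indicator S x *\<^sub>R f x) \<bullet> b = g x)"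
    by blast
  from choice[OF this] obtain g where g: "\<And>b. g b \<in> borel_measurable borel"
    "\<And>b. AE x in lborel. (indicator S x *\<^sub>R f x) \<bullet> b = g b x" by auto
  define G where "G x = indicator S x *\<^sub>R (\<Sum>b\<in>Basis. g b x *\<^sub>R b)" for x
  show ?thesis
  proof (rule that)
    show "G \<in> borel_measurable borel" unfolding G_def using g(1) S by (intro borel_measurable_scaleR) auto
    have "AE x in lborel. \<forall>b\<in>Basis. (indicator S x *\<^sub>R f x) \<bullet> b = g b x"
      using g(2) by (intro AE_finite_allI) auto
    then have "AE x in lborel. x \<in> S \<longrightarrow> f x = G x"
    proof eventually_elim
      case (elim x)
      then have "x \<in> S \<Longrightarrow> G x = (\<Sum>b\<in>Basis. (f x \<bullet> b) *\<^sub>R b)" by (simp add: G_def)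
      then show ?case by (simp add: euclidean_representation)
    qed
    then show "AE x in lebesgue_on S. f x = G x" using S by (simp add: AE_lebesgue_on_iff)
  qed (simp add: G_def)
qed

lemma
  fixes g :: "'a::euclidean_space \<Rightarrow> 'b::euclidean_space"
  assumes S: "S \<in> sets borel" and g: "g \<in> borel_measurable borel" "\<And>x. x \<notin> S \<Longrightarrow> g x = 0"
  shows integral_lebesgue_on_zero_outside: "(\<integral>x. g x \<partial>lebesgue_on S) = (\<integral>x. g x \<partial>lborel)"
    and integrable_lebesgue_on_zero_outside: "integrable (lebesgue_on S) g \<longleftrightarrow> integrable lborel g"
proof -
  have S': "S \<inter> space lebesgue \<in> sets lebesgue" using S by simp
  have eq: "(\<lambda>x. indicator S x *\<^sub>R g x) = g" using g(2) by (auto simp: indicator_def)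
  show "(\<integral>x. g x \<partial>lebesgue_on S) = (\<integral>x. g x \<partial>lborel)"
    using integral_restrict_space[OF S', of g] g(1) by (simp add: eq integral_completion)
  show "integrable (lebesgue_on S) g \<longleftrightarrow> integrable lborel g"
    using integrable_restrict_space[OF S', of g] g(1) by (simp add: eq integrable_completion)
qed

lemma borel_measurable_imp_lebesgue_on: "g \<in> borel_measurable borel \<Longrightarrow> g \<in> borel_measurable (lebesgue_on S)"
  by (intro measurable_restrict_space1 measurable_completion) simp

lemma integrable_lborel_imp_lebesgue_on:
  fixes g :: "'a::euclidean_space \<Rightarrow> 'b::euclidean_space"
  assumes "integrable lborel g" "S \<in> sets lebesgue"
  shows "integrable (lebesgue_on S) g"
proof -
  have "integrable lebesgue g" using assms borel_measurable_integrable[OF assms(1)] by (simp add: integrable_completion)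
  then show ?thesis using assms(2) by (simp add: integrable_restrict_space integrable_mult_indicator)
qed

lemma integrable_locally_integrable_on:
  fixes g :: "'a::euclidean_space \<Rightarrow> 'b::euclidean_space"
  assumes "integrable (lebesgue_on S) g" "S \<in> sets borel"
  shows "locally_integrable_on g S"
  unfolding locally_integrable_on_def
proof safe
  fix K assume K: "compact K" "K \<subseteq> S"
  then have Km: "K \<in> sets borel" by (simp add: compact_imp_closed borel_closed)
  have "integrable lebesgue (\<lambda>x. indicator S x *\<^sub>R g x)"
    using assms by (subst integrable_restrict_space[symmetric]) auto
  from integrable_mult_indicator[OF _ this, of K]
  have "integrable lebesgue (\<lambda>x. indicator K x *\<^sub>R indicator S x *\<^sub>R g x)"
    using Km by simp
  moreover have "indicator K x *\<^sub>R indicator S x *\<^sub>R g x = indicator K x *\<^sub>R g x" for x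
    using K by (cases "x \<in> K") auto
  ultimately have "integrable lebesgue (\<lambda>x. indicator K x *\<^sub>R g x)"
    by (simp only:)
  then show "integrable (lebesgue_on K) g"
    using Km by (subst integrable_restrict_space) auto
qed

text \<open>Makes the integrals in \<open>is_weak_grad\<close> genuine ones, as the test function
  confines them to a compact subset of \<open>S\<close>.\<close>

lemma locally_integrable_mult_Cc_inf:
  fixes u :: "real^'d::finite \<Rightarrow> 'b::euclidean_space" and \<phi> :: "real^'d \<Rightarrow> real"
  assumes u: "locally_integrable_on u S" and "open S" and \<phi>: "\<phi> \<in> Cc_inf S"
  shows "integrable (lebesgue_on S) (\<lambda>x. \<phi> x *\<^sub>R u x)"
  using \<phi>
proof (rule Cc_infE)
  fix K assume K: "compact K" "K \<subseteq> S" "\<And>x. x \<notin> K \<Longrightarrow> \<phi> x = 0"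
  then have Km: "K \<in> sets borel" by (simp add: compact_imp_closed borel_closed)
  have uK: "integrable (lebesgue_on K) u" using u K by (auto simp: locally_integrable_on_def)
  obtain B where B: "\<And>x. norm (\<phi> x) \<le> B" using Cc_inf_bounded[OF \<phi>] by metis
  have "integrable (lebesgue_on K) (\<lambda>x. \<phi> x *\<^sub>R u x)"
  proof (rule Bochner_Integration.integrable_bound)
    show "integrable (lebesgue_on K) (\<lambda>y. B *\<^sub>R u y)" using uK by simp
    show "AE x in lebesgue_on K. norm (\<phi> x *\<^sub>R u x) \<le> norm (B *\<^sub>R u x)"
      using order.trans[OF B abs_ge_self] by (intro AE_I2) (simp add: mult_right_mono)
    show "(\<lambda>y. \<phi> y *\<^sub>R u y) \<in> borel_measurable (lebesgue_on K)"
      using uK borel_measurable_imp_lebesgue_on[OF Cc_inf_borel[OF \<phi>]] by (intro borel_measurable_scaleR) auto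
  qed
  then have "integrable lebesgue (\<lambda>x. indicator K x *\<^sub>R \<phi> x *\<^sub>R u x)"
    using Km by (subst (asm) integrable_restrict_space) auto
  moreover have "indicator K x *\<^sub>R \<phi> x *\<^sub>R u x = indicator S x *\<^sub>R \<phi> x *\<^sub>R u x" for x
    using K by (cases "x \<in> K") auto
  ultimately have "integrable lebesgue (\<lambda>x. indicator S x *\<^sub>R \<phi> x *\<^sub>R u x)"
    by (simp only:)
  then show ?thesis
    using \<open>open S\<close> by (subst integrable_restrict_space) auto
qed

section \<open>Uniqueness and algebra of weak gradients\<close>

text \<open>Near a point of \<open>S\<close>, a small kernel reflected about any nearby
  \<open>x\<close> is a test function in \<open>S\<close>, so the mollifications of \<open>h\<close>
  vanish there identically; their L1 limit is \<open>h\<close>. Countably many such balls cover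
  \<open>S\<close> by the Lindelof property.\<close>

lemma du_Bois_Reymond:
  fixes h :: "real^'d::finite \<Rightarrow> real"
  assumes S: "open S" and h: "locally_integrable_on h S"
    and int0: "\<And>\<phi>. \<phi> \<in> Cc_inf S \<Longrightarrow> (\<integral>x. h x * \<phi> x \<partial>lebesgue_on S) = 0"
  shows "AE x in lebesgue_on S. h x = 0"
proof -
  have local: "\<exists>r>0. ball x0 r \<subseteq> S \<and> (AE x in lborel. x \<in> ball x0 r \<longrightarrow> h x = 0)" if x0: "x0 \<in> S" for x0
  proof -
    obtain R where R: "R > 0" "cball x0 R \<subseteq> S" using S x0 open_contains_cball by metis
    \<comment> \<open>Halving leaves room: kernels of radius at most \<open>r\<close>, placed at
      points of \<open>ball x0 r\<close>, see only the compact ball on which \<open>h\<close> is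
      integrable.\<close>
    define r where "r = R / 2"
    have r: "r > 0" "2 * r = R" using R by (auto simp: r_def)
    let ?K = "cball x0 R"
    have hK: "integrable (lebesgue_on ?K) h" using h R by (auto simp: locally_integrable_on_def)
    obtain f where f: "f \<in> borel_measurable borel" "\<And>x. x \<notin> ?K \<Longrightarrow> f x = 0" "AE x in lebesgue_on ?K. h x = f x"
      by (rule ex_borel_representative[OF borel_closed[OF closed_cball] borel_measurable_integrable[OF hK]]) (rule that)
    note [measurable] = f(1)
    have fint: "integrable lborel f"
    proof -
      have "integrable (lebesgue_on ?K) f"
        by (rule integrable_cong_AE_imp[OF hK borel_measurable_imp_lebesgue_on[OF f(1)] f(3)])
      then show ?thesis using f by (subst (asm) integrable_lebesgue_on_zero_outside) auto
    qed
    have hf: "AE x in lborel. x \<in> ?K \<longrightarrow> h x = f x" using f(3) by (simp add: AE_lebesgue_on_iff)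
    obtain k :: "real^'d \<Rightarrow> real" where k: "k \<in> Cc_inf UNIV" "\<And>x. k x \<ge> 0" "\<And>x. x \<notin> ball 0 1 \<Longrightarrow> k x = 0" "(\<integral>x. k x \<partial>lborel) = 1"
      using ex_mollifier[of 1 0] by auto
    define t where "t n = r / real (Suc n)" for n
    have t: "t n > 0" "t n \<le> r" for n using r by (auto simp: t_def field_simps)
    have t0: "t \<longlonglongrightarrow> 0" unfolding t_def
      using tendsto_mult_left[OF LIMSEQ_inverse_real_of_nat, of r] by (simp add: divide_inverse)
    have conv0: "conv (rescale (t n) k) f x = 0" if x: "x \<in> ball x0 r" for n x
    proof -
      define \<phi> where "\<phi> y = rescale (t n) k ((-1) *\<^sub>R y + x)" for y
      have \<phi>0: "\<phi> y = 0" if "y \<notin> ball x r" for y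
        unfolding \<phi>_def
        by (rule rescale_eq_0[OF k(3) t(1)]) (use that t(2)[of n] in \<open>auto simp: dist_norm norm_minus_commute\<close>)
      have sub: "cball x r \<subseteq> ?K"
      proof
        fix y assume "y \<in> cball x r"
        then show "y \<in> ?K" using x r dist_triangle[of x0 y x] by simp
      qed
      have \<phi>: "\<phi> \<in> Cc_inf S"
      proof (rule Cc_infI[of _ "cball x r"])
        show "Ck k \<phi>" for k unfolding \<phi>_def
          by (rule Ck_affine, rule Cc_inf_Ck[OF rescale_Cc_inf[OF k(1) t(1)]])
        show "cball x r \<subseteq> S" using sub R by blast
        show "y \<notin> cball x r \<Longrightarrow> \<phi> y = 0" for y using \<phi>0 by auto
      qed auto
      have "conv (rescale (t n) k) f x = (\<integral>y. f y * \<phi> y \<partial>lborel)"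
        by (simp add: conv_def \<phi>_def mult.commute)
      also have "\<dots> = (\<integral>y. f y * \<phi> y \<partial>lebesgue_on S)"
        using f(1) S Cc_inf_borel[OF \<phi>] Cc_inf_eq_0[OF \<phi>]
        by (subst integral_lebesgue_on_zero_outside) auto
      also have "\<dots> = (\<integral>y. h y * \<phi> y \<partial>lebesgue_on S)"
      proof (rule integral_cong_AE)
        show "(\<lambda>y. f y * \<phi> y) \<in> borel_measurable (lebesgue_on S)"
          using f(1) Cc_inf_borel[OF \<phi>] by (intro borel_measurable_imp_lebesgue_on) simp
        show "(\<lambda>y. h y * \<phi> y) \<in> borel_measurable (lebesgue_on S)"
          using locally_integrable_mult_Cc_inf[OF h S \<phi>] by (simp add: mult.commute)
        show "AE y in lebesgue_on S. f y * \<phi> y = h y * \<phi> y"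
          unfolding AE_lebesgue_on_iff[OF borel_open[OF S]] using hf
          by eventually_elim (use \<phi>0 sub in \<open>force simp: subset_iff\<close>)
      qed
      also have "\<dots> = 0" by (rule int0[OF \<phi>])
      finally show ?thesis .
    qed
    have "(\<integral>\<^sup>+x. indicator (ball x0 r) x * ennreal (norm (f x)) \<partial>lborel) \<le> 0"
    proof (rule LIMSEQ_le_const[OF conv_rescale_tendsto_L1[OF k(1,2,4) fint t(1) t0]], intro exI allI impI)
      fix n
      show "(\<integral>\<^sup>+x. indicator (ball x0 r) x * ennreal (norm (f x)) \<partial>lborel) \<le>
         (\<integral>\<^sup>+x. norm (conv (rescale (t n) k) f x - f x) \<partial>lborel)"
        by (intro nn_integral_mono) (use conv0 in \<open>auto simp: indicator_def\<close>)
    qed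
    then have "AE x in lborel. indicator (ball x0 r) x * ennreal (norm (f x)) = 0"
      by (subst (asm) le_zero_eq, subst (asm) nn_integral_0_iff_AE) (measurable, auto)
    with hf have "AE x in lborel. x \<in> ball x0 r \<longrightarrow> h x = 0"
      by eventually_elim (use r in \<open>auto simp: indicator_def\<close>)
    then show ?thesis using r R by (intro exI[of _ r]) auto
  qed
  define F where "F = {B. open B \<and> B \<subseteq> S \<and> (AE x in lborel. x \<in> B \<longrightarrow> h x = 0)}"
  obtain F' where F': "F' \<subseteq> F" "countable F'" "\<Union>F' = \<Union>F"
    using Lindelof[of F] by (auto simp: F_def)
  have "\<Union>F = S" using local by (force simp: F_def)
  moreover have "AE x in lborel. \<forall>B\<in>F'. x \<in> B \<longrightarrow> h x = 0"
    using F' by (subst AE_ball_countable) (auto simp: F_def)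
  ultimately have "AE x in lborel. x \<in> S \<longrightarrow> h x = 0"
    using F'(3) by (auto elim!: eventually_mono)
  then show ?thesis using S by (simp add: AE_lebesgue_on_iff)
qed

lemma locally_integrable_vec_nth: "locally_integrable_on u S \<Longrightarrow> locally_integrable_on (\<lambda>x. u x $ i) S"
  by (auto simp: locally_integrable_on_def intro: integrable_vec_nth)

lemma locally_integrable_diff:
  "locally_integrable_on u S \<Longrightarrow> locally_integrable_on v S \<Longrightarrow> locally_integrable_on (\<lambda>x. u x - v x) S"
  by (auto simp: locally_integrable_on_def)

lemma locally_integrable_add:
  "locally_integrable_on u S \<Longrightarrow> locally_integrable_on v S \<Longrightarrow> locally_integrable_on (\<lambda>x. u x + v x) S"
  by (auto simp: locally_integrable_on_def)

lemma is_weak_grad_unique: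
  assumes S: "open S" and "is_weak_grad S u G" "is_weak_grad S u H"
  shows "AE x in lebesgue_on S. G x = H x"
proof -
  have G: "locally_integrable_on G S" and H: "locally_integrable_on H S" using assms by (auto simp: is_weak_grad_def)
  have "AE x in lebesgue_on S. G x $ i $ j - H x $ i $ j = 0" for i j
  proof (rule du_Bois_Reymond[OF S])
    show "locally_integrable_on (\<lambda>x. G x $ i $ j - H x $ i $ j) S"
      by (intro locally_integrable_diff locally_integrable_vec_nth G H)
    fix \<phi> :: "real^'a \<Rightarrow> real" assume \<phi>: "\<phi> \<in> Cc_inf S"
    have "integrable (lebesgue_on S) (\<lambda>x. G x $ i $ j * \<phi> x)" "integrable (lebesgue_on S) (\<lambda>x. H x $ i $ j * \<phi> x)"
      using locally_integrable_mult_Cc_inf[OF locally_integrable_vec_nth[OF locally_integrable_vec_nth[OF G]] S \<phi>]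
       locally_integrable_mult_Cc_inf[OF locally_integrable_vec_nth[OF locally_integrable_vec_nth[OF H]] S \<phi>]
      by (auto simp: mult.commute)
    then have "(\<integral>x. (G x $ i $ j - H x $ i $ j) * \<phi> x \<partial>lebesgue_on S)
       = (\<integral>x. G x $ i $ j * \<phi> x \<partial>lebesgue_on S) - (\<integral>x. H x $ i $ j * \<phi> x \<partial>lebesgue_on S)"
      by (simp add: left_diff_distrib)
    also have "\<dots> = 0" using assms(2,3) \<phi> by (auto simp: is_weak_grad_def)
    finally show "(\<integral>x. (G x $ i $ j - H x $ i $ j) * \<phi> x \<partial>lebesgue_on S) = 0" .
  qed
  then have "AE x in lebesgue_on S. \<forall>i\<in>UNIV. \<forall>j\<in>UNIV. G x $ i $ j - H x $ i $ j = 0"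
    by (intro AE_finite_allI) auto
  then show ?thesis by eventually_elim (simp add: vec_eq_iff)
qed

text \<open>Discharges the choice in \<open>weak_grad\<close>: any explicit weak gradient may
  replace it under integrals over \<open>S\<close>.\<close>

lemma weak_grad_AE_eq:
  assumes "open S" "is_weak_grad S u G"
  shows "AE x in lebesgue_on S. weak_grad S u x = G x"
  using is_weak_grad_unique[OF assms(1) _ assms(2)] someI[of "is_weak_grad S u", OF assms(2)]
  unfolding weak_grad_def by blast

lemma is_weak_grad_add:
  assumes S: "open S" and u: "is_weak_grad S u G" and v: "is_weak_grad S v H"
  shows "is_weak_grad S (\<lambda>x. u x + v x) (\<lambda>x. G x + H x)"
proof -
  have int: "integrable (lebesgue_on S) (\<lambda>x. w x $ i * \<phi> x)"
    if "locally_integrable_on w S" "\<phi> \<in> Cc_inf S" for w :: "_ \<Rightarrow> real^'n" and \<phi> :: "_ \<Rightarrow> real" and i :: "'n::finite"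
    using locally_integrable_mult_Cc_inf[OF locally_integrable_vec_nth[OF that(1)] S that(2)] by (simp add: mult.commute)
  have int2: "integrable (lebesgue_on S) (\<lambda>x. w x $ i $ j * \<phi> x)"
    if "locally_integrable_on w S" "\<phi> \<in> Cc_inf S" for w :: "_ \<Rightarrow> real^'m^'n" and \<phi> :: "_ \<Rightarrow> real" and i :: "'n::finite" and j :: "'m::finite"
    using int[OF locally_integrable_vec_nth[OF that(1)] that(2)] .
  show ?thesis
    using assms by (auto simp: is_weak_grad_def distrib_right int int2 Cc_inf_partial_deriv intro!: locally_integrable_add)
qed

lemma is_weak_grad_uminus:
  assumes u: "is_weak_grad S u G"
  shows "is_weak_grad S (\<lambda>x. - u x) (\<lambda>x. - G x)"
  using assms by (auto simp: is_weak_grad_def locally_integrable_on_def)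

lemma is_weak_grad_diff:
  assumes S: "open S" and u: "is_weak_grad S u G" and v: "is_weak_grad S v H"
  shows "is_weak_grad S (\<lambda>x. u x - v x) (\<lambda>x. G x - H x)"
  using is_weak_grad_add[OF S u is_weak_grad_uminus[OF v]] by simp

text \<open>A test function on \<open>S\<close> and its derivatives vanish outside \<open>S\<close>,
  so integrals over \<open>S\<close> and over the whole space agree.\<close>

lemma wgrad_imp_is_weak_grad:
  assumes "open S" "wgrad u G"
  shows "is_weak_grad S u G"
proof -
  have u: "integrable lborel u" "integrable lborel G" using assms by (auto simp: wgrad_def)
  then have [measurable]: "u \<in> borel_measurable borel" "G \<in> borel_measurable borel"
    by (auto dest: borel_measurable_integrable)
  have [measurable]: "(\<lambda>x. u x $ i) \<in> borel_measurable borel" "(\<lambda>x. G x $ i $ j) \<in> borel_measurable borel" for i j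
    using borel_measurable_integrable[OF integrable_vec_nth[OF u(1)]]
     borel_measurable_integrable[OF integrable_vec_nth[OF integrable_vec_nth[OF u(2)]]] by auto
  have S: "S \<in> sets borel" using assms(1) by simp
  have "(\<integral>x. u x $ i * partial_deriv j \<phi> x \<partial>lebesgue_on S) = - (\<integral>x. G x $ i $ j * \<phi> x \<partial>lebesgue_on S)"
    if \<phi>: "\<phi> \<in> Cc_inf S" for \<phi> :: "_ \<Rightarrow> real" and i j
  proof -
    have \<phi>0: "x \<notin> S \<Longrightarrow> \<phi> x = 0" "x \<notin> S \<Longrightarrow> partial_deriv j \<phi> x = 0" for x
      using Cc_inf_eq_0[OF \<phi>] Cc_inf_eq_0[OF Cc_inf_partial_deriv[OF \<phi>]] by auto
    have m: "\<phi> \<in> borel_measurable borel" "partial_deriv j \<phi> \<in> borel_measurable borel"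
      using Cc_inf_borel[OF \<phi>] Cc_inf_borel[OF Cc_inf_partial_deriv[OF \<phi>]] .
    have "(\<integral>x. u x $ i * partial_deriv j \<phi> x \<partial>lebesgue_on S) = (\<integral>x. u x $ i * partial_deriv j \<phi> x \<partial>lborel)"
      using m \<phi>0 S by (intro integral_lebesgue_on_zero_outside) auto
    moreover have "(\<integral>x. G x $ i $ j * \<phi> x \<partial>lebesgue_on S) = (\<integral>x. G x $ i $ j * \<phi> x \<partial>lborel)"
      using m \<phi>0 S by (intro integral_lebesgue_on_zero_outside) auto
    ultimately show ?thesis using assms(2) \<phi> Cc_inf_mono[of S UNIV] by (force simp: wgrad_def)
  qed
  then show ?thesis
    using u S by (auto simp: is_weak_grad_def intro!: integrable_locally_integrable_on integrable_lborel_imp_lebesgue_on)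
qed

section \<open>Classical gradients as weak gradients\<close>

definition grad :: "(real^'d::finite \<Rightarrow> real^'n::finite) \<Rightarrow> real^'d \<Rightarrow> real^'d^'n" where
  "grad u x = (\<chi> i j. partial_deriv j u x $ i)"

text \<open>The matrix is the sum of its single-column parts, whose Frobenius norms are the
  Euclidean norms of the columns.\<close>

lemma norm_columns_le:
  fixes c :: "'d::finite \<Rightarrow> real^'n::finite"
  shows "norm (\<chi> i j. c j $ i :: real^'d^'n) \<le> (\<Sum>j\<in>UNIV. norm (c j))"
proof -
  have "(\<chi> i j. c j $ i :: real^'d^'n) = (\<Sum>j\<in>UNIV. \<chi> i. axis j (c j $ i))"
    by (auto simp: vec_eq_iff axis_def if_distrib cong: if_cong)
  then have "norm (\<chi> i j. c j $ i :: real^'d^'n) \<le> (\<Sum>j\<in>UNIV. norm (\<chi> i. axis j (c j $ i)))"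
    by (simp add: norm_sum)
  moreover have "norm (\<chi> i. axis j (c j $ i)) = norm (c j)" for j
    unfolding norm_vec_def[of "\<chi> i. axis j (c j $ i)"]
    by (simp add: norm_axis) (simp add: norm_vec_def)
  ultimately show ?thesis by simp
qed

lemma grad_norm_le: "norm (grad u x) \<le> (\<Sum>j\<in>UNIV. norm (partial_deriv j u x))"
  unfolding grad_def by (rule norm_columns_le)

lemma grad_eq_0: "(\<And>j. partial_deriv j u x = 0) \<Longrightarrow> grad u x = 0"
  by (simp add: grad_def vec_eq_iff)

lemma borel_measurable_vec_lambda2:
  assumes "\<And>i j. (\<lambda>x. f x i j) \<in> borel_measurable M"
  shows "(\<lambda>x. (\<chi> i j. f x i j) :: real^'d::finite^'n::finite) \<in> borel_measurable M"
proof (subst borel_measurable_euclidean_space, rule ballI)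
  fix b :: "real^'d^'n" assume "b \<in> Basis"
  then obtain i j where "b = axis i (axis j 1)"
    by (auto simp: Basis_vec_def)
  then show "(\<lambda>x. (\<chi> i j. f x i j) \<bullet> b) \<in> borel_measurable M"
    using assms by (simp add: inner_axis)
qed

lemma borel_measurable_vec_lambda1:
  assumes "\<And>i. (\<lambda>x. f x i) \<in> borel_measurable M"
  shows "(\<lambda>x. (\<chi> i. f x i) :: real^'n::finite) \<in> borel_measurable M"
proof (subst borel_measurable_euclidean_space, rule ballI)
  fix b :: "real^'n" assume "b \<in> Basis"
  then obtain i where "b = axis i 1"
    by (auto simp: Basis_vec_def)
  then show "(\<lambda>x. (\<chi> i. f x i) \<bullet> b) \<in> borel_measurable M"
    using assms by (simp add: inner_axis)
qed

lemma grad_borel_measurable: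
  assumes "\<And>k. Ck k u" shows "grad u \<in> borel_measurable borel"
  unfolding grad_def[abs_def]
proof (rule borel_measurable_vec_lambda2)
  fix i j
  have "continuous_on UNIV (partial_deriv j u)" using assms[of "Suc 0"] by simp
  then show "(\<lambda>x. partial_deriv j u x $ i) \<in> borel_measurable borel"
    by (intro borel_measurable_continuous_onI continuous_intros)
qed

lemma Cc_inf_grad_bounded:
  fixes \<phi> :: "real^'d::finite \<Rightarrow> real^'n::finite"
  assumes "\<phi> \<in> Cc_inf S" obtains B where "B > 0" "\<And>x. norm (grad \<phi> x) \<le> B"
proof -
  have "\<exists>B>0. \<forall>x. norm (partial_deriv j \<phi> x) \<le> B" for j
    using Cc_inf_bounded[OF Cc_inf_partial_deriv[OF assms]] by metis
  then obtain B where B: "\<And>j. B j > 0" "\<And>j x. norm (partial_deriv j \<phi> x) \<le> B j" by metis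
  show ?thesis
  proof (rule that)
    show "(\<Sum>j\<in>UNIV. B j) > 0" using B(1) by (intro sum_pos) auto
    show "norm (grad \<phi> x) \<le> (\<Sum>j\<in>UNIV. B j)" for x
      by (rule order.trans[OF grad_norm_le sum_mono]) (use B in auto)
  qed
qed

lemma Cc_inf_grad_integrable:
  fixes \<phi> :: "real^'d::finite \<Rightarrow> real^'n::finite"
  assumes "\<phi> \<in> Cc_inf S" shows "integrable lborel (grad \<phi>)"
proof (rule Bochner_Integration.integrable_bound)
  show "integrable lborel (\<lambda>x. \<Sum>j\<in>UNIV. norm (partial_deriv j \<phi> x))"
    using Cc_inf_integrable[OF Cc_inf_partial_deriv[OF assms]] by auto
  show "AE x in lborel. norm (grad \<phi> x) \<le> norm (\<Sum>j\<in>UNIV. norm (partial_deriv j \<phi> x))"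
    by (intro AE_I2) (simp add: grad_norm_le sum_nonneg)
qed (use grad_borel_measurable Cc_inf_Ck[OF assms] in auto)

text \<open>A component of \<open>\<phi>\<close> times a test function has compact support, so the
  partial derivative of the product integrates to zero; the product rule splits it into the two
  sides.\<close>

lemma Cc_inf_wgrad:
  fixes \<phi> :: "real^'d::finite \<Rightarrow> real^'n::finite"
  assumes \<phi>: "\<phi> \<in> Cc_inf UNIV" shows "wgrad \<phi> (grad \<phi>)"
  unfolding wgrad_def
proof (intro conjI ballI allI)
  show "integrable lborel \<phi>" "integrable lborel (grad \<phi>)"
    using Cc_inf_integrable[OF \<phi>] Cc_inf_grad_integrable[OF \<phi>] .
  fix \<zeta> :: "real^'d \<Rightarrow> real" and i j
  assume \<zeta>: "\<zeta> \<in> Cc_inf UNIV"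
  have \<phi>i: "(\<lambda>x. \<phi> x $ i) \<in> Cc_inf UNIV" by (rule Cc_inf_bounded_linear[OF bounded_linear_vec_nth \<phi>])
  have p: "(\<lambda>x. \<phi> x $ i *\<^sub>R \<zeta> x) \<in> Cc_inf UNIV"
    by (rule Cc_inf_scaleR_Ck[OF Cc_inf_Ck[OF \<phi>i] \<zeta>])
  have "(\<integral>x. partial_deriv j (\<lambda>x. \<phi> x $ i *\<^sub>R \<zeta> x) x \<partial>lborel) = 0"
    using p by (rule Cc_infE) (rule integral_partial_deriv_eq_0)
  moreover have "partial_deriv j (\<lambda>x. \<phi> x $ i *\<^sub>R \<zeta> x) x = \<phi> x $ i * partial_deriv j \<zeta> x + grad \<phi> x $ i $ j * \<zeta> x" for x
    using Cc_inf_differentiable[OF \<phi>i] Cc_inf_differentiable[OF \<zeta>] Cc_inf_differentiable[OF \<phi>]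
    by (subst partial_deriv_scaleR) (auto simp: partial_deriv_bounded_linear[OF bounded_linear_vec_nth] grad_def)
  moreover have "integrable lborel (\<lambda>x. \<phi> x $ i * partial_deriv j \<zeta> x)"
    using Cc_inf_integrable[OF Cc_inf_scaleR_Ck[OF Cc_inf_Ck[OF \<phi>i] Cc_inf_partial_deriv[OF \<zeta>]], of j] by simp
  moreover have "integrable lborel (\<lambda>x. grad \<phi> x $ i $ j * \<zeta> x)"
  proof -
    have "(\<lambda>x. partial_deriv j \<phi> x $ i) \<in> Cc_inf UNIV"
      by (rule Cc_inf_bounded_linear[OF bounded_linear_vec_nth Cc_inf_partial_deriv[OF \<phi>]])
    from Cc_inf_integrable[OF Cc_inf_scaleR_Ck[OF Cc_inf_Ck[OF this] \<zeta>]] show ?thesis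
      by (simp add: grad_def)
  qed
  ultimately show "(\<integral>x. \<phi> x $ i * partial_deriv j \<zeta> x \<partial>lborel) = - (\<integral>x. grad \<phi> x $ i $ j * \<zeta> x \<partial>lborel)"
    by simp
qed

lemma Cc_inf_is_weak_grad:
  fixes \<phi> :: "real^'d::finite \<Rightarrow> real^'n::finite"
  assumes "open S" and \<phi>: "\<phi> \<in> Cc_inf UNIV" shows "is_weak_grad S \<phi> (grad \<phi>)"
  by (rule wgrad_imp_is_weak_grad[OF assms(1) Cc_inf_wgrad[OF \<phi>]])

section \<open>Products and truncation\<close>

lemma norm_matrix_component_le: "\<bar>A $ i $ j\<bar> \<le> norm (A :: real^'d::finite^'n::finite)"
  using component_le_norm_cart[of "A $ i" j] Finite_Cartesian_Product.norm_nth_le[of A i] by linarith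

text \<open>The tensor product of a value of \<open>u\<close> with the gradient of a scalar factor;
  the second argument is a family because partial derivatives come indexed by coordinate.\<close>

definition outer :: "real^'n::finite \<Rightarrow> ('d::finite \<Rightarrow> real) \<Rightarrow> real^'d^'n" where
  "outer a b = (\<chi> i j. a $ i * b j)"

lemma norm_outer_le: "norm (outer a b) \<le> norm a * (\<Sum>j\<in>UNIV. \<bar>b j\<bar>)"
  using norm_columns_le[of "\<lambda>j. b j *\<^sub>R a"] by (simp add: outer_def mult.commute sum_distrib_left)

lemma integrable_mult_Cc_inf:
  fixes u :: "real^'d::finite \<Rightarrow> 'b::euclidean_space" and \<phi> :: "real^'d \<Rightarrow> real"
  assumes "integrable lborel u" "\<phi> \<in> Cc_inf UNIV"
  shows "integrable lborel (\<lambda>x. \<phi> x *\<^sub>R u x)"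
proof -
  obtain B where "\<And>x. norm (\<phi> x) \<le> B" using Cc_inf_bounded[OF assms(2)] by metis
  then show ?thesis using assms Cc_inf_borel[OF assms(2)] by (intro integrable_bounded_scaleR[of _ B]) auto
qed

lemma wgrad_integrable:
  assumes "wgrad u G" "\<phi> \<in> Cc_inf UNIV"
  shows "integrable lborel (\<lambda>x. u x $ i * \<phi> x)" "integrable lborel (\<lambda>x. G x $ i $ j * \<phi> x)"
proof -
  have "integrable lborel u" "integrable lborel G" using assms(1) by (auto simp: wgrad_def)
  then have "integrable lborel (\<lambda>x. u x $ i)" "integrable lborel (\<lambda>x. G x $ i $ j)" by (auto intro: integrable_vec_nth)
  from this[THEN integrable_mult_Cc_inf[OF _ assms(2)]]
  show "integrable lborel (\<lambda>x. u x $ i * \<phi> x)" "integrable lborel (\<lambda>x. G x $ i $ j * \<phi> x)"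
    by (simp_all add: mult.commute)
qed

lemma wgrad_add: "wgrad u G \<Longrightarrow> wgrad v H \<Longrightarrow> wgrad (\<lambda>x. u x + v x) (\<lambda>x. G x + H x)"
  unfolding wgrad_def[of "\<lambda>x. u x + v x"]
  by (auto simp: distrib_right wgrad_integrable Cc_inf_partial_deriv) (auto simp: wgrad_def)

lemma wgrad_uminus: "wgrad u G \<Longrightarrow> wgrad (\<lambda>x. - u x) (\<lambda>x. - G x)"
  by (auto simp: wgrad_def)

lemma wgrad_diff: "wgrad u G \<Longrightarrow> wgrad v H \<Longrightarrow> wgrad (\<lambda>x. u x - v x) (\<lambda>x. G x - H x)"
  using wgrad_add[OF _ wgrad_uminus] by fastforce

lemma wgrad_borel:
  assumes "wgrad u G"
  shows "u \<in> borel_measurable borel" "G \<in> borel_measurable borel"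
    "(\<lambda>x. u x $ i) \<in> borel_measurable borel" "(\<lambda>x. G x $ i $ j) \<in> borel_measurable borel"
proof -
  have "integrable lborel u" "integrable lborel G" using assms(1) by (auto simp: wgrad_def)
  from this this[THEN integrable_vec_nth] this(2)[THEN integrable_vec_nth, THEN integrable_vec_nth]
  show "u \<in> borel_measurable borel" "G \<in> borel_measurable borel"
    "(\<lambda>x. u x $ i) \<in> borel_measurable borel" "(\<lambda>x. G x $ i $ j) \<in> borel_measurable borel"
    by (auto dest!: borel_measurable_integrable)
qed

text \<open>The product \<eta> \<zeta> is inserted as test function in the weak formulation for
  \<open>u\<close>; its classical product rule separates the derivative of \<zeta> from that of
  \<eta>.\<close>

lemma wgrad_mult:
  assumes uG: "wgrad u G" and \<eta>: "\<eta> \<in> Cc_inf UNIV"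
  shows "wgrad (\<lambda>x. \<eta> x *\<^sub>R u x) (\<lambda>x. \<eta> x *\<^sub>R G x + outer (u x) (\<lambda>j. partial_deriv j \<eta> x))"
  unfolding wgrad_def
proof (intro conjI ballI allI)
  have u: "integrable lborel u" "integrable lborel G" using uG by (auto simp: wgrad_def)
  note [measurable] = wgrad_borel[OF uG]
  have \<eta>': "partial_deriv j \<eta> \<in> Cc_inf UNIV" for j by (rule Cc_inf_partial_deriv[OF \<eta>])
  have [measurable]: "partial_deriv j \<eta> \<in> borel_measurable borel" for j by (rule Cc_inf_borel[OF \<eta>'])
  have "integrable lborel (\<lambda>x. outer (u x) (\<lambda>j. partial_deriv j \<eta> x))"
  proof (rule Bochner_Integration.integrable_bound)
    show "integrable lborel (\<lambda>x. \<Sum>j\<in>UNIV. norm (partial_deriv j \<eta> x *\<^sub>R u x))"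
      by (intro Bochner_Integration.integrable_sum integrable_norm integrable_mult_Cc_inf u \<eta>')
    show "AE x in lborel. norm (outer (u x) (\<lambda>j. partial_deriv j \<eta> x)) \<le> norm (\<Sum>j\<in>UNIV. norm (partial_deriv j \<eta> x *\<^sub>R u x))"
    proof (rule AE_I2)
      fix x
      have "norm (outer (u x) (\<lambda>j. partial_deriv j \<eta> x)) \<le> (\<Sum>j\<in>UNIV. norm (partial_deriv j \<eta> x *\<^sub>R u x))"
        using norm_outer_le[of "u x" "\<lambda>j. partial_deriv j \<eta> x"] by (simp add: sum_distrib_left mult.commute)
      then show "norm (outer (u x) (\<lambda>j. partial_deriv j \<eta> x)) \<le> norm (\<Sum>j\<in>UNIV. norm (partial_deriv j \<eta> x *\<^sub>R u x))"
        by simp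
    qed
    show "(\<lambda>x. outer (u x) (\<lambda>j. partial_deriv j \<eta> x)) \<in> borel_measurable lborel"
      unfolding outer_def by (rule borel_measurable_vec_lambda2) measurable
  qed
  then show "integrable lborel (\<lambda>x. \<eta> x *\<^sub>R G x + outer (u x) (\<lambda>j. partial_deriv j \<eta> x))"
    by (intro Bochner_Integration.integrable_add integrable_mult_Cc_inf u \<eta>)
  show "integrable lborel (\<lambda>x. \<eta> x *\<^sub>R u x)" by (rule integrable_mult_Cc_inf[OF u(1) \<eta>])
  fix \<zeta> :: "real^'a \<Rightarrow> real" and i j
  assume \<zeta>: "\<zeta> \<in> Cc_inf UNIV"
  have p: "(\<lambda>x. \<eta> x *\<^sub>R \<zeta> x) \<in> Cc_inf UNIV"
    by (rule Cc_inf_scaleR_Ck[OF Cc_inf_Ck[OF \<eta>] \<zeta>])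
  have p1: "(\<lambda>x. \<eta> x *\<^sub>R partial_deriv j \<zeta> x) \<in> Cc_inf UNIV"
    by (rule Cc_inf_scaleR_Ck[OF Cc_inf_Ck[OF \<eta>] Cc_inf_partial_deriv[OF \<zeta>]])
  have p2: "(\<lambda>x. partial_deriv j \<eta> x *\<^sub>R \<zeta> x) \<in> Cc_inf UNIV"
    by (rule Cc_inf_scaleR_Ck[OF Cc_inf_Ck[OF \<eta>'] \<zeta>])
  have pd: "partial_deriv j (\<lambda>x. \<eta> x *\<^sub>R \<zeta> x) x = \<eta> x * partial_deriv j \<zeta> x + partial_deriv j \<eta> x * \<zeta> x" for x
    using Cc_inf_differentiable[OF \<eta>] Cc_inf_differentiable[OF \<zeta>] by (subst partial_deriv_scaleR) auto
  have "(\<integral>x. (\<eta> x *\<^sub>R u x) $ i * partial_deriv j \<zeta> x \<partial>lborel)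
    = (\<integral>x. u x $ i * partial_deriv j (\<lambda>x. \<eta> x *\<^sub>R \<zeta> x) x - u x $ i * (partial_deriv j \<eta> x *\<^sub>R \<zeta> x) \<partial>lborel)"
    by (intro Bochner_Integration.integral_cong) (auto simp: pd[simplified real_scaleR_def] algebra_simps)
  also have "\<dots> = (\<integral>x. u x $ i * partial_deriv j (\<lambda>x. \<eta> x *\<^sub>R \<zeta> x) x \<partial>lborel) - (\<integral>x. u x $ i * (partial_deriv j \<eta> x *\<^sub>R \<zeta> x) \<partial>lborel)"
    by (intro Bochner_Integration.integral_diff wgrad_integrable[OF uG] p2 Cc_inf_partial_deriv p)
  also have "(\<integral>x. u x $ i * partial_deriv j (\<lambda>x. \<eta> x *\<^sub>R \<zeta> x) x \<partial>lborel) = - (\<integral>x. G x $ i $ j * (\<eta> x *\<^sub>R \<zeta> x) \<partial>lborel)"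
    using uG p by (auto simp: wgrad_def)
  also have "- (\<integral>x. G x $ i $ j * (\<eta> x *\<^sub>R \<zeta> x) \<partial>lborel) - (\<integral>x. u x $ i * (partial_deriv j \<eta> x *\<^sub>R \<zeta> x) \<partial>lborel)
    = - ((\<integral>x. G x $ i $ j * (\<eta> x *\<^sub>R \<zeta> x) \<partial>lborel) + (\<integral>x. u x $ i * (partial_deriv j \<eta> x *\<^sub>R \<zeta> x) \<partial>lborel))" by simp
  also have "\<dots> = - (\<integral>x. G x $ i $ j * (\<eta> x *\<^sub>R \<zeta> x) + u x $ i * (partial_deriv j \<eta> x *\<^sub>R \<zeta> x) \<partial>lborel)"
    by (subst Bochner_Integration.integral_add[OF wgrad_integrable(2)[OF uG p] wgrad_integrable(1)[OF uG p2]]) simp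
  also have "\<dots> = - (\<integral>x. (\<eta> x *\<^sub>R G x + outer (u x) (\<lambda>j. partial_deriv j \<eta> x)) $ i $ j * \<zeta> x \<partial>lborel)"
    by (intro arg_cong[of _ _ uminus] Bochner_Integration.integral_cong) (auto simp: outer_def algebra_simps)
  finally show "(\<integral>x. (\<eta> x *\<^sub>R u x) $ i * partial_deriv j \<zeta> x \<partial>lborel)
     = - (\<integral>x. (\<eta> x *\<^sub>R G x + outer (u x) (\<lambda>j. partial_deriv j \<eta> x)) $ i $ j * \<zeta> x \<partial>lborel)" .
qed

lemma conv_integrable:
  fixes k :: "real^'d::finite \<Rightarrow> real" and f :: "real^'d \<Rightarrow> 'b::euclidean_space"
  assumes k: "k \<in> Cc_inf UNIV" and f: "integrable lborel f"
  shows "integrable lborel (conv k f)"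
proof (rule integrableI_bounded)
  have kint: "integrable lborel k" by (rule Cc_inf_integrable[OF k])
  have [measurable]: "k \<in> borel_measurable borel" "f \<in> borel_measurable borel"
    using Cc_inf_borel[OF k] borel_measurable_integrable[OF f] by auto
  show "conv k f \<in> borel_measurable lborel" using conv_borel_measurable[OF k f] by simp
  have "(\<integral>\<^sup>+x. norm (conv k f x) \<partial>lborel) \<le> (\<integral>\<^sup>+x. \<integral>\<^sup>+y. ennreal \<bar>k (x - y)\<bar> * ennreal (norm (f y)) \<partial>lborel \<partial>lborel)"
  proof (rule nn_integral_mono)
    fix x
    show "ennreal (norm (conv k f x)) \<le> (\<integral>\<^sup>+y. ennreal \<bar>k (x - y)\<bar> * ennreal (norm (f y)) \<partial>lborel)"
      unfolding conv_def using integral_norm_bound_ennreal[OF integrable_conv[OF k f], of x] by (simp add: ennreal_mult')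
  qed
  also have "\<dots> = (\<integral>\<^sup>+y. \<integral>\<^sup>+x. ennreal \<bar>k (x - y)\<bar> * ennreal (norm (f y)) \<partial>lborel \<partial>lborel)"
    by (rule lborel_pair.Fubini'[symmetric]) measurable
  also have "\<dots> = (\<integral>\<^sup>+y. (\<integral>\<^sup>+x. ennreal \<bar>k x\<bar> \<partial>lborel) * ennreal (norm (f y)) \<partial>lborel)"
  proof (rule nn_integral_cong)
    fix y :: "real^'d"
    have "(\<integral>\<^sup>+x. ennreal \<bar>k (x - y)\<bar> * ennreal (norm (f y)) \<partial>lborel) = (\<integral>\<^sup>+x. ennreal \<bar>k (x - y)\<bar> \<partial>lborel) * ennreal (norm (f y))"
      by (rule nn_integral_multc) measurable
    then show "(\<integral>\<^sup>+x. ennreal \<bar>k (x - y)\<bar> * ennreal (norm (f y)) \<partial>lborel) = (\<integral>\<^sup>+x. ennreal \<bar>k x\<bar> \<partial>lborel) * ennreal (norm (f y))"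
      using nn_integral_lborel_translate[of "\<lambda>x. ennreal \<bar>k x\<bar>" "- y"] by simp
  qed
  also have "\<dots> = (\<integral>\<^sup>+x. ennreal \<bar>k x\<bar> \<partial>lborel) * (\<integral>\<^sup>+y. ennreal (norm (f y)) \<partial>lborel)"
    by (rule nn_integral_cmult) measurable
  also have "\<dots> < \<infinity>"
    using kint f by (auto simp: integrable_iff_bounded ennreal_mult_less_top)
  finally show "(\<integral>\<^sup>+x. norm (conv k f x) \<partial>lborel) < \<infinity>" .
qed

text \<open>Limits inside nonlinear functions call for pointwise convergence, while the
  mollifications converge in L1; a subsequence reconciles the two.\<close>

lemma conv_rescale_AE_subseq:
  fixes f :: "real^'d::finite \<Rightarrow> 'b::euclidean_space"
  assumes k: "k \<in> Cc_inf UNIV" "\<And>x. k x \<ge> 0" "(\<integral>x. k x \<partial>lborel) = 1"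
    and f: "integrable lborel f" and t: "\<And>n. t n > 0" "t \<longlonglongrightarrow> 0"
  shows "\<exists>r. strict_mono r \<and> (AE x in lborel. (\<lambda>n. conv (rescale (t (r n)) k) f x) \<longlonglongrightarrow> f x)"
proof -
  have int: "integrable lborel (\<lambda>x. conv (rescale (t n) k) f x - f x)" for n
    using conv_integrable[OF rescale_Cc_inf[OF k(1) t(1)] f] f by simp
  have "ennreal (\<integral>x. norm (conv (rescale (t n) k) f x - f x) \<partial>lborel)
     = (\<integral>\<^sup>+x. norm (conv (rescale (t n) k) f x - f x) \<partial>lborel)" for n
    using int[of n] by (intro nn_integral_eq_integral[symmetric]) auto
  with conv_rescale_tendsto_L1[OF assms]
  have "(\<lambda>n. ennreal (\<integral>x. norm (conv (rescale (t n) k) f x - f x) \<partial>lborel)) \<longlonglongrightarrow> ennreal 0" by simp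
  then have "(\<lambda>n. \<integral>x. norm (conv (rescale (t n) k) f x - f x) \<partial>lborel) \<longlonglongrightarrow> 0"
    by (subst (asm) tendsto_ennreal_iff) auto
  from tendsto_L1_AE_subseq[OF int this] obtain r where r: "strict_mono r"
    "AE x in lborel. (\<lambda>n. conv (rescale (t (r n)) k) f x - f x) \<longlonglongrightarrow> 0" by blast
  have "AE x in lborel. (\<lambda>n. conv (rescale (t (r n)) k) f x) \<longlonglongrightarrow> f x"
    using r(2) by eventually_elim (rule LIM_zero_cancel)
  with r(1) show ?thesis by blast
qed

text \<open>Covers integrands that depend on \<open>u\<close> in a Lipschitz way, such as a smooth
  truncation multiplied by a bounded factor.\<close>

lemma integral_tendsto_of_L1_bound:
  fixes f :: "nat \<Rightarrow> 'a \<Rightarrow> real" and u :: "nat \<Rightarrow> 'a \<Rightarrow> 'b::euclidean_space"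
  assumes f: "\<And>n. integrable M (f n)" "integrable M g"
    and le: "\<And>n x. norm (f n x - g x) \<le> B * norm (u n x - v x)"
    and lim: "(\<lambda>n. \<integral>\<^sup>+x. norm (u n x - v x) \<partial>M) \<longlonglongrightarrow> 0"
    and u: "B \<ge> 0" "\<And>n. integrable M (u n)" "integrable M v"
  shows "(\<lambda>n. \<integral>x. f n x \<partial>M) \<longlonglongrightarrow> (\<integral>x. g x \<partial>M)"
proof (rule tendsto_L1_int[OF f])
  have "(\<lambda>n. ennreal B * (\<integral>\<^sup>+x. norm (u n x - v x) \<partial>M)) \<longlonglongrightarrow> ennreal B * 0"
    by (intro ennreal_tendsto_cmult lim) auto
  then have lim': "(\<lambda>n. ennreal B * (\<integral>\<^sup>+x. norm (u n x - v x) \<partial>M)) \<longlonglongrightarrow> 0" by simp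
  have le': "(\<integral>\<^sup>+x. norm (f n x - g x) \<partial>M) \<le> ennreal B * (\<integral>\<^sup>+x. norm (u n x - v x) \<partial>M)" for n
  proof -
    have "(\<integral>\<^sup>+x. norm (f n x - g x) \<partial>M) \<le> (\<integral>\<^sup>+x. ennreal B * ennreal (norm (u n x - v x)) \<partial>M)"
      using u(1) by (intro nn_integral_mono) (use le[of n] in \<open>simp add: ennreal_leI flip: ennreal_mult\<close>)
    also have "\<dots> = ennreal B * (\<integral>\<^sup>+x. norm (u n x - v x) \<partial>M)"
      using u(2)[of n] u(3) by (intro nn_integral_cmult) auto
    finally show ?thesis .
  qed
  show "(\<lambda>n. \<integral>\<^sup>+x. norm (f n x - g x) \<partial>M) \<longlonglongrightarrow> 0"
    by (rule tendsto_sandwich[OF _ _ tendsto_const lim']) (use le' in auto)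
qed

lemma Ck1_compose:
  fixes g :: "real^'d::finite \<Rightarrow> real"
  assumes F: "\<And>s. (F has_real_derivative F' s) (at s)" "continuous_on UNIV F'" and g: "Ck (Suc 0) g"
  shows "Ck (Suc 0) (\<lambda>x. F (g x))" "partial_deriv j (\<lambda>x. F (g x)) x = F' (g x) * partial_deriv j g x"
proof -
  have d: "((\<lambda>x. F (g x)) has_derivative (\<lambda>h. F' (g x) * (\<Sum>j\<in>UNIV. h $ j *\<^sub>R partial_deriv j g x))) (at x)" for x
    by (rule has_derivative_compose[OF Ck_has_derivative[OF g] F(1)[unfolded has_field_derivative_def]])
  from partial_deriv_eqI[OF d, of j] show "partial_deriv j (\<lambda>x. F (g x)) x = F' (g x) * partial_deriv j g x" by simp
  have "continuous_on UNIV g" "\<And>j. continuous_on UNIV (partial_deriv j g)" using g Ck_continuous[OF g] by auto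
  then show "Ck (Suc 0) (\<lambda>x. F (g x))"
    by (intro Ck_SucI[OF d]) (auto intro!: continuous_intros continuous_on_compose2[OF F(2)])
qed

section \<open>Smooth truncation and the chain rule\<close>

text \<open>The function K arctan(s / K) is bounded by 2 K, 1-Lipschitz, close to the identity for
  large K, and continuously differentiable. A sharp cut-off of the values would have corners and
  require an argument on level sets.\<close>

definition trunc :: "real \<Rightarrow> real^'n::finite \<Rightarrow> real^'n" where
  "trunc K v = (\<chi> i. K * arctan (v $ i / K))"

text \<open>The chain rule for \<open>trunc\<close>: row \<open>i\<close> of the gradient is
  multiplied by the derivative of K arctan(s / K) at the component \<open>i\<close> of the
  value.\<close>

definition trunc_grad :: "real \<Rightarrow> real^'n::finite \<Rightarrow> real^'d::finite^'n \<Rightarrow> real^'d^'n" where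
  "trunc_grad K v A = (\<chi> i j. A $ i $ j / (1 + (v $ i / K)\<^sup>2))"

lemma norm_vec_mono:
  fixes x y :: "real^'n::finite"
  assumes "\<And>i. \<bar>x $ i\<bar> \<le> \<bar>y $ i\<bar>" shows "norm x \<le> norm y"
  unfolding norm_vec_def by (rule L2_set_mono) (use assms in auto)

lemma norm_matrix_mono:
  fixes x y :: "real^'d::finite^'n::finite"
  assumes "\<And>i j. \<bar>x $ i $ j\<bar> \<le> \<bar>y $ i $ j\<bar>" shows "norm x \<le> norm y"
  unfolding norm_vec_def[of x] norm_vec_def[of y] by (rule L2_set_mono) (auto intro!: norm_vec_mono assms)

lemma one_plus_square_factor: "\<bar>a / (1 + s\<^sup>2)\<bar> \<le> \<bar>a::real\<bar>"
proof -
  have "\<bar>a\<bar> * 1 \<le> \<bar>a\<bar> * (1 + s\<^sup>2)" by (intro mult_left_mono) auto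
  then show ?thesis by (simp add: abs_divide divide_le_eq add_pos_nonneg abs_of_pos)
qed

lemma norm_trunc_grad_le: "norm (trunc_grad K v A) \<le> norm A"
  by (rule norm_matrix_mono) (use one_plus_square_factor in \<open>simp add: trunc_grad_def\<close>)

text \<open>The entries are multiplied by 1 - 1/(1 + s^2), again a number between 0 and 1. This
  provides the majorant when the truncation level tends to infinity.\<close>

lemma norm_diff_trunc_grad_le: "norm (A - trunc_grad K v A) \<le> norm A"
proof (rule norm_matrix_mono)
  fix i j
  have "a - a / (1 + s\<^sup>2) = a * (s\<^sup>2 / (1 + s\<^sup>2))" for a s :: real
    by (simp add: field_simps add_nonneg_eq_0_iff)
  moreover have "\<bar>a * (s\<^sup>2 / (1 + s\<^sup>2))\<bar> \<le> \<bar>a\<bar>" for a s :: real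
    unfolding abs_mult by (rule mult_left_le) (auto simp: divide_le_eq_1 add_pos_nonneg)
  ultimately show "\<bar>(A - trunc_grad K v A) $ i $ j\<bar> \<le> \<bar>A $ i $ j\<bar>"
    by (simp add: trunc_grad_def)
qed

lemma arctan_scaled_lipschitz:
  assumes "K > 0" shows "\<bar>K * arctan (s / K) - K * arctan (t / K)\<bar> \<le> \<bar>s - t\<bar>"
proof -
  have "norm (K * arctan (s / K) - K * arctan (t / K)) \<le> 1 * norm (s - t)"
  proof (rule field_differentiable_bound[of UNIV "\<lambda>s. K * arctan (s / K)" "\<lambda>s. 1 / (1 + (s / K)\<^sup>2)"])
    show "((\<lambda>s. K * arctan (s / K)) has_field_derivative 1 / (1 + (z / K)\<^sup>2)) (at z within UNIV)" for z
      using assms by (auto intro!: derivative_eq_intros simp: inverse_eq_divide)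
    show "norm (1 / (1 + (z / K)\<^sup>2)) \<le> 1" for z using one_plus_square_factor[of 1] by simp
  qed auto
  then show ?thesis by simp
qed

lemma norm_trunc_le: "K > 0 \<Longrightarrow> norm (trunc K v) \<le> norm v"
  using arctan_scaled_lipschitz[of K _ 0] by (intro norm_vec_mono) (simp add: trunc_def)

lemma norm_trunc_bound: "K > 0 \<Longrightarrow> norm (trunc K (v :: real^'n::finite)) \<le> real CARD('n) * (K * 2)"
proof -
  assume K: "K > 0"
  have "norm (trunc K v) \<le> (\<Sum>i\<in>UNIV. \<bar>trunc K v $ i\<bar>)" by (rule norm_le_l1_cart)
  also have "\<dots> \<le> (\<Sum>i::'n\<in>UNIV. K * 2)"
  proof (rule sum_mono)
    fix i
    have "\<bar>arctan (v $ i / K)\<bar> \<le> 2" using arctan_bounded[of "v $ i / K"] pi_less_4 by linarith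
    then show "\<bar>trunc K v $ i\<bar> \<le> K * 2" using K by (simp add: trunc_def abs_mult)
  qed
  finally show ?thesis by simp
qed

text \<open>The chain rule holds classically for the mollifications \<open>U n\<close> and passes to
  the limit. The values converge by the Lipschitz bound. In the gradient term,
  \<open>H n - G\<close> tends to 0 in L1 and has a bounded factor, while \<open>F' (U n)\<close>
  times the fixed \<open>G\<close> converges by domination along an almost everywhere convergent
  subsequence.\<close>

lemma wgrad_trunc:
  fixes u :: "real^'d::finite \<Rightarrow> real^'n::finite"
  assumes uG: "wgrad u G" and K: "K > 0"
  shows "wgrad (\<lambda>x. trunc K (u x)) (\<lambda>x. trunc_grad K (u x) (G x))"
  unfolding wgrad_def
proof (intro conjI ballI allI)
  have u: "integrable lborel u" "integrable lborel G" using uG by (auto simp: wgrad_def)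
  note [measurable] = wgrad_borel[OF uG]
  show "integrable lborel (\<lambda>x. trunc K (u x))"
  proof (rule Bochner_Integration.integrable_bound[OF u(1)])
    show "(\<lambda>x. trunc K (u x)) \<in> borel_measurable lborel"
      unfolding trunc_def using K
      by (intro borel_measurable_vec_lambda1 borel_measurable_times borel_measurable_const measurable_compose[OF _ borel_measurable_arctan] borel_measurable_divide) measurable
  qed (use K in \<open>auto intro: norm_trunc_le\<close>)
  show "integrable lborel (\<lambda>x. trunc_grad K (u x) (G x))"
  proof (rule Bochner_Integration.integrable_bound[OF u(2)])
    show "(\<lambda>x. trunc_grad K (u x) (G x)) \<in> borel_measurable lborel"
      unfolding trunc_grad_def by (rule borel_measurable_vec_lambda2) measurable
  qed (auto intro: norm_trunc_grad_le)
  fix \<zeta> :: "real^'d \<Rightarrow> real" and i j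
  assume \<zeta>: "\<zeta> \<in> Cc_inf UNIV"
  have \<zeta>': "partial_deriv j \<zeta> \<in> Cc_inf UNIV" by (rule Cc_inf_partial_deriv[OF \<zeta>])
  obtain B1 where B1: "\<And>x. norm (\<zeta> x) \<le> B1" using Cc_inf_bounded[OF \<zeta>] by metis
  obtain B2 where B2: "\<And>x. norm (partial_deriv j \<zeta> x) \<le> B2" using Cc_inf_bounded[OF \<zeta>'] by metis
  have B0: "B1 \<ge> 0" "B2 \<ge> 0" using order.trans[OF norm_ge_zero B1] order.trans[OF norm_ge_zero B2] by auto
  note [measurable] = Cc_inf_borel[OF \<zeta>] Cc_inf_borel[OF \<zeta>']
  define F where "F s = K * arctan (s / K)" for s
  define F' where "F' s = 1 / (1 + (s / K)\<^sup>2)" for s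
  have F: "(F has_real_derivative F' s) (at s)" for s
    unfolding F_def F'_def using K by (auto intro!: derivative_eq_intros simp: inverse_eq_divide)
  have Fcont: "continuous_on UNIV F'" unfolding F'_def using K
    by (intro continuous_intros) (auto simp: add_nonneg_eq_0_iff)
  have F'le: "\<bar>F' s\<bar> \<le> 1" for s using one_plus_square_factor[of 1 "s / K"] by (simp add: F'_def)
  have [measurable]: "F \<in> borel_measurable borel" "F' \<in> borel_measurable borel"
    using DERIV_continuous_on[of UNIV F F'] F Fcont by (auto intro!: borel_measurable_continuous_onI)
  have Flip: "\<bar>F s - F t\<bar> \<le> \<bar>s - t\<bar>" for s t unfolding F_def by (rule arctan_scaled_lipschitz[OF K])
  obtain k :: "real^'d \<Rightarrow> real" where k: "k \<in> Cc_inf UNIV" "\<And>x. k x \<ge> 0" "\<And>x. x \<notin> ball 0 1 \<Longrightarrow> k x = 0" "(\<integral>x. k x \<partial>lborel) = 1"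
    using ex_mollifier[of 1 0] by auto
  define T where "T n = 1 / real (Suc n)" for n
  have T: "T n > 0" for n by (simp add: T_def)
  have T0: "T \<longlonglongrightarrow> 0" unfolding T_def
    using LIMSEQ_inverse_real_of_nat by (simp add: inverse_eq_divide)
  obtain r where r: "strict_mono r" "AE x in lborel. (\<lambda>n. conv (rescale (T (r n)) k) u x) \<longlonglongrightarrow> u x"
    using conv_rescale_AE_subseq[OF k(1,2,4) u(1) T T0] by blast
  define t where "t n = T (r n)" for n
  have t: "t n > 0" for n using T by (simp add: t_def)
  have t0: "t \<longlonglongrightarrow> 0" unfolding t_def using LIMSEQ_subseq_LIMSEQ[OF T0 r(1)] by (simp add: o_def)
  define U where "U n = conv (rescale (t n) k) u" for n
  define H where "H n = conv (rescale (t n) k) G" for n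
  have kt: "rescale (t n) k \<in> Cc_inf UNIV" for n by (rule rescale_Cc_inf[OF k(1) t])
  have [measurable]: "U n \<in> borel_measurable borel" "H n \<in> borel_measurable borel" for n
    unfolding U_def H_def using conv_borel_measurable[OF kt] u by auto
  have UC: "Ck m (U n)" for n m unfolding U_def by (rule Ck_conv[OF kt u(1)])
  have Ulim: "(\<lambda>n. \<integral>\<^sup>+x. norm (U n x - u x) \<partial>lborel) \<longlonglongrightarrow> 0"
    and Hlim: "(\<lambda>n. \<integral>\<^sup>+x. norm (H n x - G x) \<partial>lborel) \<longlonglongrightarrow> 0"
    unfolding U_def H_def by (rule conv_rescale_tendsto_L1[OF k(1,2,4) _ t t0], fact)+
  have Uint: "integrable lborel (U n)" and Hint: "integrable lborel (H n)" for n
    unfolding U_def H_def using conv_integrable[OF kt] u by auto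
  have [measurable]: "(\<lambda>x. U n x $ i) \<in> borel_measurable borel" for n
    using borel_measurable_integrable[OF integrable_vec_nth[OF Uint]] by simp
  have int1: "integrable lborel (\<lambda>x. F (v x $ i) * partial_deriv j \<zeta> x)"
    if v: "integrable lborel v" for v :: "real^'d \<Rightarrow> real^'n"
  proof (rule Bochner_Integration.integrable_bound)
    have [measurable]: "(\<lambda>x. v x $ i) \<in> borel_measurable borel"
      using borel_measurable_integrable[OF integrable_vec_nth[OF v]] by simp
    show "integrable lborel (\<lambda>x. partial_deriv j \<zeta> x *\<^sub>R v x)" by (rule integrable_mult_Cc_inf[OF v \<zeta>'])
    show "AE x in lborel. norm (F (v x $ i) * partial_deriv j \<zeta> x) \<le> norm (partial_deriv j \<zeta> x *\<^sub>R v x)"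
    proof (rule AE_I2)
      fix x
      have "\<bar>F (v x $ i)\<bar> \<le> norm (v x)" using Flip[of "v x $ i" 0] component_le_norm_cart[of "v x" i] by (simp add: F_def)
      then show "norm (F (v x $ i) * partial_deriv j \<zeta> x) \<le> norm (partial_deriv j \<zeta> x *\<^sub>R v x)"
        unfolding norm_scaleR real_norm_def abs_mult mult.commute[of "\<bar>partial_deriv j \<zeta> x\<bar>" "norm (v x)"]
        by (intro mult_right_mono) auto
    qed
    show "(\<lambda>x. F (v x $ i) * partial_deriv j \<zeta> x) \<in> borel_measurable lborel" by measurable
  qed
  have int2: "integrable lborel (\<lambda>x. F' (v x $ i) * W x $ i $ j * \<zeta> x)"
    if v: "integrable lborel v" and W: "integrable lborel W" for v :: "real^'d \<Rightarrow> real^'n" and W :: "real^'d \<Rightarrow> real^'d^'n"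
  proof (rule Bochner_Integration.integrable_bound)
    have [measurable]: "(\<lambda>x. v x $ i) \<in> borel_measurable borel"
      using borel_measurable_integrable[OF integrable_vec_nth[OF v]] by simp
    have [measurable]: "(\<lambda>x. W x $ i $ j) \<in> borel_measurable borel"
      using borel_measurable_integrable[OF integrable_vec_nth[OF integrable_vec_nth[OF W]]] by simp
    show "integrable lborel (\<lambda>x. \<zeta> x *\<^sub>R W x $ i $ j)"
      by (rule integrable_mult_Cc_inf[OF integrable_vec_nth[OF integrable_vec_nth[OF W]] \<zeta>])
    show "AE x in lborel. norm (F' (v x $ i) * W x $ i $ j * \<zeta> x) \<le> norm (\<zeta> x *\<^sub>R W x $ i $ j)"
      using F'le by (auto simp: abs_mult mult_ac intro!: AE_I2 mult_left_mono mult_right_le_one_le mult_left_le_one_le)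
    show "(\<lambda>x. F' (v x $ i) * W x $ i $ j * \<zeta> x) \<in> borel_measurable lborel" by measurable
  qed
  have A: "(\<lambda>n. \<integral>x. F (U n x $ i) * partial_deriv j \<zeta> x \<partial>lborel) \<longlonglongrightarrow> (\<integral>x. F (u x $ i) * partial_deriv j \<zeta> x \<partial>lborel)"
  proof (rule integral_tendsto_of_L1_bound[OF int1[OF Uint] int1[OF u(1)] _ Ulim])
    fix n x
    have "\<bar>F (U n x $ i) - F (u x $ i)\<bar> \<le> norm (U n x - u x)"
      using Flip[of "U n x $ i" "u x $ i"] component_le_norm_cart[of "U n x - u x" i] by simp
    then have "\<bar>F (U n x $ i) - F (u x $ i)\<bar> * \<bar>partial_deriv j \<zeta> x\<bar> \<le> norm (U n x - u x) * B2"
      using B2[of x] B0 by (intro mult_mono) auto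
    then show "norm (F (U n x $ i) * partial_deriv j \<zeta> x - F (u x $ i) * partial_deriv j \<zeta> x) \<le> B2 * norm (U n x - u x)"
      unfolding left_diff_distrib[symmetric] by (simp add: abs_mult mult.commute)
  qed (use B0 Uint u in auto)
  have C: "(\<lambda>n. \<integral>x. F' (U n x $ i) * (H n x - G x) $ i $ j * \<zeta> x \<partial>lborel) \<longlonglongrightarrow> (\<integral>x. 0 \<partial>(lborel :: (real^'d) measure))"
  proof (rule integral_tendsto_of_L1_bound[OF int2[OF Uint Bochner_Integration.integrable_diff[OF Hint u(2)]] _ _ Hlim])
    fix n x
    have "\<bar>F' (U n x $ i)\<bar> * \<bar>(H n x - G x) $ i $ j\<bar> \<le> 1 * norm (H n x - G x)"
      by (intro mult_mono F'le norm_matrix_component_le) auto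
    then have "\<bar>F' (U n x $ i)\<bar> * \<bar>(H n x - G x) $ i $ j\<bar> * \<bar>\<zeta> x\<bar> \<le> (1 * norm (H n x - G x)) * B1"
      by (rule mult_mono) (use B1[of x] in auto)
    then show "norm (F' (U n x $ i) * (H n x - G x) $ i $ j * \<zeta> x - 0) \<le> B1 * norm (H n x - G x)"
      by (simp add: abs_mult mult.commute)
  qed (use B0 Hint u in auto)
  have E: "(\<lambda>n. \<integral>x. F' (U n x $ i) * G x $ i $ j * \<zeta> x \<partial>lborel) \<longlonglongrightarrow> (\<integral>x. F' (u x $ i) * G x $ i $ j * \<zeta> x \<partial>lborel)"
  proof (rule integral_dominated_convergence)
    show "integrable lborel (\<lambda>x. norm (\<zeta> x *\<^sub>R G x $ i $ j))"
      by (intro integrable_norm integrable_mult_Cc_inf[OF integrable_vec_nth[OF integrable_vec_nth[OF u(2)]] \<zeta>])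
    show "AE x in lborel. norm (F' (U n x $ i) * G x $ i $ j * \<zeta> x) \<le> norm (\<zeta> x *\<^sub>R G x $ i $ j)" for n
      using F'le by (auto simp: abs_mult mult_ac intro!: AE_I2 mult_left_mono mult_right_le_one_le mult_left_le_one_le)
    show "AE x in lborel. (\<lambda>n. F' (U n x $ i) * G x $ i $ j * \<zeta> x) \<longlonglongrightarrow> F' (u x $ i) * G x $ i $ j * \<zeta> x"
      using r(2)
    proof eventually_elim
      case (elim x)
      then have "(\<lambda>n. U n x $ i) \<longlonglongrightarrow> u x $ i" unfolding U_def t_def by (rule tendsto_vec_nth)
      then have "(\<lambda>n. F' (U n x $ i)) \<longlonglongrightarrow> F' (u x $ i)"
        using Fcont by (intro continuous_on_tendsto_compose[OF Fcont]) auto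
      then show ?case by (intro tendsto_intros)
    qed
    show "(\<lambda>x. F' (U n x $ i) * G x $ i $ j * \<zeta> x) \<in> borel_measurable lborel" for n by measurable
  qed measurable
  \<comment> \<open>The classical identity for the mollified function, with \<open>H n\<close>
    written as \<open>H n - G\<close> plus \<open>G\<close> to match the limits \<open>C\<close> and
    \<open>E\<close>.\<close>
  have zero: "(\<integral>x. F (U n x $ i) * partial_deriv j \<zeta> x \<partial>lborel) + (\<integral>x. F' (U n x $ i) * (H n x - G x) $ i $ j * \<zeta> x \<partial>lborel)
    + (\<integral>x. F' (U n x $ i) * G x $ i $ j * \<zeta> x \<partial>lborel) = 0" for n
  proof -
    define g where "g x = U n x $ i" for x
    have g: "Ck m g" for m unfolding g_def by (rule Ck_bounded_linear[OF bounded_linear_vec_nth UC])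
    have Ud: "U n differentiable_on UNIV" using UC[of "Suc 0" n] by simp
    have pg: "partial_deriv j g x = H n x $ i $ j" for x
      unfolding g_def using Ud wgrad_conv[OF uG kt]
      by (simp add: partial_deriv_bounded_linear[OF bounded_linear_vec_nth] U_def H_def)
    note Fg = Ck1_compose[OF F Fcont g[of "Suc 0"]]
    have "(\<integral>x. partial_deriv j (\<lambda>x. F (g x) *\<^sub>R \<zeta> x) x \<partial>lborel) = 0"
      using \<zeta>
    proof (rule Cc_infE)
      fix K assume K: "compact K" "\<And>x. x \<notin> K \<Longrightarrow> \<zeta> x = 0"
      show ?thesis
        by (rule integral_partial_deriv_eq_0[OF Ck_scaleR[OF Fg(1) Cc_inf_Ck[OF \<zeta>]] K(1)]) (simp add: K(2))
    qed
    moreover have "partial_deriv j (\<lambda>x. F (g x) *\<^sub>R \<zeta> x) x = F (U n x $ i) * partial_deriv j \<zeta> x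
       + F' (U n x $ i) * (H n x - G x) $ i $ j * \<zeta> x + F' (U n x $ i) * G x $ i $ j * \<zeta> x" for x
    proof -
      have "(\<lambda>x. F (g x)) differentiable_on UNIV" using Fg(1) by simp
      from partial_deriv_scaleR[OF this Cc_inf_differentiable[OF \<zeta>], of j x]
      show ?thesis unfolding Fg(2) pg by (simp add: g_def algebra_simps)
    qed
    ultimately show ?thesis
      using int1[OF Uint[of n]] int2[OF Uint[of n] Bochner_Integration.integrable_diff[OF Hint[of n] u(2)]] int2[OF Uint[of n] u(2)]
      by simp
  qed
  have "(\<lambda>n. 0) \<longlonglongrightarrow> (\<integral>x. F (u x $ i) * partial_deriv j \<zeta> x \<partial>lborel) + (\<integral>x. 0 \<partial>(lborel :: (real^'d) measure)) + (\<integral>x. F' (u x $ i) * G x $ i $ j * \<zeta> x \<partial>lborel)"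
    using tendsto_add[OF tendsto_add[OF A C] E] unfolding zero .
  then have "(\<integral>x. F (u x $ i) * partial_deriv j \<zeta> x \<partial>lborel) + (\<integral>x. F' (u x $ i) * G x $ i $ j * \<zeta> x \<partial>lborel) = 0"
    by (simp add: LIMSEQ_const_iff)
  then show "(\<integral>x. trunc K (u x) $ i * partial_deriv j \<zeta> x \<partial>lborel) = - (\<integral>x. trunc_grad K (u x) (G x) $ i $ j * \<zeta> x \<partial>lborel)"
    by (simp add: trunc_def trunc_grad_def F_def F'_def)
qed

section \<open>Sobolev spaces with zero boundary values\<close>

text \<open>The indicator of the ball of radius 3 r / 2 is mollified at scale r / 2, so from
  \<open>ball x0 r\<close> the kernel sees only the inside, and from outside
  \<open>ball x0 (2 * r)\<close> only the outside.\<close>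

lemma ex_cutoff:
  fixes x0 :: "real^'d::finite"
  assumes r: "r > 0"
  obtains \<beta> :: "real^'d \<Rightarrow> real" where "\<beta> \<in> Cc_inf UNIV" "\<And>x. x \<in> ball x0 r \<Longrightarrow> \<beta> x = 1"
    "\<And>x. x \<notin> ball x0 (2 * r) \<Longrightarrow> \<beta> x = 0"
proof -
  obtain k :: "real^'d \<Rightarrow> real" where k: "k \<in> Cc_inf UNIV" "\<And>x. k x \<ge> 0" "\<And>x. x \<notin> ball 0 (r/2) \<Longrightarrow> k x = 0" "(\<integral>x. k x \<partial>lborel) = 1"
    using ex_mollifier[of "r/2" 0] r by auto
  have kint: "integrable lborel k" by (rule Cc_inf_integrable[OF k(1)])
  have [measurable]: "k \<in> borel_measurable borel" by (rule Cc_inf_borel[OF k(1)])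
  let ?A = "ball x0 (3 * r / 2)"
  define \<beta> where "\<beta> = conv k (indicator ?A :: _ \<Rightarrow> real)"
  have A: "integrable lborel (indicator ?A :: _ \<Rightarrow> real)"
    using emeasure_bounded_finite[OF bounded_ball, of x0 "3 * r / 2"]
    by (intro integrable_real_indicator) (auto simp: top.not_eq_extremum)
  have kx: "integrable lborel (\<lambda>y. k (x - y))" "(\<integral>y. k (x - y) \<partial>lborel) = 1" for x
  proof -
    have "(\<integral>y. k y \<partial>lborel) = \<bar>- 1 :: real\<bar> ^ DIM(real^'d) *\<^sub>R (\<integral>y. k (x + (- 1) *\<^sub>R y) \<partial>lborel)"
      by (rule integral_lborel_affine) auto
    then show "(\<integral>y. k (x - y) \<partial>lborel) = 1" using k(4) by simp
    then show "integrable lborel (\<lambda>y. k (x - y))" using not_integrable_integral_eq by force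
  qed
  show ?thesis
  proof (rule that)
    have zero: "\<beta> x = 0" if x: "x \<notin> ball x0 (2 * r)" for x
    proof -
      have "k (x - y) *\<^sub>R indicator ?A y = (0 :: real)" for y
      proof (cases "y \<in> ?A")
        case True
        have "dist x0 x \<le> dist x0 y + dist y x" by (rule dist_triangle)
        then have "x - y \<notin> ball 0 (r/2)" using True x by (auto simp: dist_norm norm_minus_commute)
        then show ?thesis using k(3) by simp
      qed simp
      then show ?thesis unfolding \<beta>_def conv_def by (simp only: Bochner_Integration.integral_zero)
    qed
    then show "x \<notin> ball x0 (2 * r) \<Longrightarrow> \<beta> x = 0" for x .
    show "\<beta> \<in> Cc_inf UNIV"
      by (rule Cc_infI[of _ "cball x0 (2 * r)"]) (use zero Ck_conv[OF k(1) A] in \<open>auto simp: \<beta>_def\<close>)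
    show "\<beta> x = 1" if x: "x \<in> ball x0 r" for x
    proof -
      have "k (x - y) *\<^sub>R indicator ?A y = k (x - y)" for y
      proof (cases "y \<in> ?A")
        case False
        have "dist x0 y \<le> dist x0 x + dist x y" by (rule dist_triangle)
        then have "x - y \<notin> ball 0 (r/2)" using False x by (auto simp: dist_norm norm_minus_commute)
        then show ?thesis using k(3) by simp
      qed simp
      then show ?thesis unfolding \<beta>_def conv_def by (simp only: kx)
    qed
  qed
qed

section \<open>Lebesgue and Sobolev spaces on a domain\<close>

lemma borel_measurable_lebesgue_on_AE:
  fixes f :: "'a::euclidean_space \<Rightarrow> 'b::euclidean_space"
  assumes S: "S \<in> sets borel" and f: "f \<in> borel_measurable (lebesgue_on S)" and eq: "AE x in lebesgue_on S. f x = g x"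
  shows "g \<in> borel_measurable (lebesgue_on S)"
proof -
  have S': "S \<inter> space lebesgue \<in> sets lebesgue" using S by simp
  have "(\<lambda>x. indicator S x *\<^sub>R f x) \<in> borel_measurable lebesgue"
    using f borel_measurable_restrict_space_iff[OF S', of f] by simp
  moreover have "AE x in lebesgue. indicator S x *\<^sub>R f x = indicator S x *\<^sub>R g x"
    using eq S by (subst (asm) AE_restrict_space_iff) (auto elim!: eventually_mono simp: indicator_def)
  ultimately have "(\<lambda>x. indicator S x *\<^sub>R g x) \<in> borel_measurable lebesgue"
    by (rule borel_measurable_AE)
  then show ?thesis using borel_measurable_restrict_space_iff[OF S', of g] by simp
qed

lemma Lp_cong_AE:
  fixes f :: "'a::euclidean_space \<Rightarrow> 'b::euclidean_space"
  assumes S: "S \<in> sets borel" and f: "f \<in> Lp S p" and eq: "AE x in lebesgue_on S. f x = g x"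
  shows "g \<in> Lp S p" "Lp_norm S p g = Lp_norm S p f"
proof -
  have fm: "f \<in> borel_measurable (lebesgue_on S)" using f by (simp add: Lp_def)
  have gm: "g \<in> borel_measurable (lebesgue_on S)"
    by (rule borel_measurable_lebesgue_on_AE[OF S fm eq])
  have eq': "AE x in lebesgue_on S. norm (f x) powr p = norm (g x) powr p" using eq by eventually_elim simp
  have m: "(\<lambda>x. norm (f x) powr p) \<in> borel_measurable (lebesgue_on S)" "(\<lambda>x. norm (g x) powr p) \<in> borel_measurable (lebesgue_on S)"
    using fm gm by measurable
  show "g \<in> Lp S p" using gm f integrable_cong_AE[OF m eq'] by (simp add: Lp_def)
  show "Lp_norm S p g = Lp_norm S p f" unfolding Lp_norm_def using integral_cong_AE[OF m eq'] by simp
qed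

lemma is_weak_grad_weak_grad: "is_weak_grad S u G \<Longrightarrow> is_weak_grad S u (weak_grad S u)"
  unfolding weak_grad_def by (rule someI[of "is_weak_grad S u"])

lemma W1p_weak_grad:
  assumes "open S" "u \<in> W1p S p"
  shows "is_weak_grad S u (weak_grad S u)" "weak_grad S u \<in> Lp S p"
proof -
  obtain G where G: "G \<in> Lp S p" "is_weak_grad S u G" using assms by (auto simp: W1p_def)
  show "is_weak_grad S u (weak_grad S u)" using is_weak_grad_weak_grad G by blast
  have "AE x in lebesgue_on S. G x = weak_grad S u x"
    using weak_grad_AE_eq[OF assms(1) G(2)] by eventually_elim simp
  then show "weak_grad S u \<in> Lp S p" using Lp_cong_AE(1)[OF _ G(1)] assms(1) by simp
qed

lemma W1p_norm_eq:
  assumes "open S" "G \<in> Lp S p" "is_weak_grad S u G"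
  shows "W1p_norm S p u = Lp_norm S p u + Lp_norm S p G"
proof -
  have "AE x in lebesgue_on S. G x = weak_grad S u x"
    using weak_grad_AE_eq[OF assms(1,3)] by eventually_elim simp
  then have "Lp_norm S p (weak_grad S u) = Lp_norm S p G"
    by (rule Lp_cong_AE(2)[OF borel_open[OF assms(1)] assms(2)])
  then show ?thesis by (simp add: W1p_norm_def)
qed

lemma Lp_norm_nonneg: "Lp_norm S p f \<ge> 0"
  by (simp add: Lp_norm_def)

lemma Lp_1_iff: "f \<in> Lp S 1 \<longleftrightarrow> integrable (lebesgue_on S) f"
  by (auto simp: Lp_def integrable_norm_iff)

lemma Lp_norm_1: "Lp_norm S 1 f = (\<integral>x. norm (f x) \<partial>lebesgue_on S)"
  by (simp add: Lp_norm_def)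

text \<open>Only membership is wanted, so it is enough that a difference is at most twice the larger
  of the two norms.\<close>

lemma Lp_diff:
  assumes "p \<ge> 0" "f \<in> Lp S p" "g \<in> Lp S p" shows "(\<lambda>x. f x - g x) \<in> Lp S p"
proof -
  have m: "f \<in> borel_measurable (lebesgue_on S)" "g \<in> borel_measurable (lebesgue_on S)" using assms by (auto simp: Lp_def)
  have "integrable (lebesgue_on S) (\<lambda>x. norm (f x - g x) powr p)"
  proof (rule Bochner_Integration.integrable_bound)
    show "integrable (lebesgue_on S) (\<lambda>x. 2 powr p * (norm (f x) powr p + norm (g x) powr p))"
      using assms by (auto simp: Lp_def)
    show "(\<lambda>x. norm (f x - g x) powr p) \<in> borel_measurable (lebesgue_on S)" using m by measurable
    show "AE x in lebesgue_on S. norm (norm (f x - g x) powr p) \<le> norm (2 powr p * (norm (f x) powr p + norm (g x) powr p))"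
    proof (rule AE_I2)
      fix x
      let ?m = "max (norm (f x)) (norm (g x))"
      have "norm (f x - g x) \<le> 2 * ?m" using norm_triangle_ineq4[of "f x" "g x"] by linarith
      then have "norm (f x - g x) powr p \<le> (2 * ?m) powr p" using assms(1) by (intro powr_mono2) auto
      also have "\<dots> = 2 powr p * ?m powr p" by (simp add: powr_mult)
      also have "\<dots> \<le> 2 powr p * (norm (f x) powr p + norm (g x) powr p)"
        by (intro mult_left_mono) (auto simp: max_def)
      finally show "norm (norm (f x - g x) powr p) \<le> norm (2 powr p * (norm (f x) powr p + norm (g x) powr p))" by simp
    qed
  qed
  then show ?thesis using m by (simp add: Lp_def)
qed

text \<open>One factor of the power is kept for integrability, the others are bounded by
  \<open>B\<close>.\<close>

lemma Lp_bounded: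
  assumes "p \<ge> 1" "integrable (lebesgue_on S) f" "\<And>x. norm (f x) \<le> B"
  shows "f \<in> Lp S p"
proof -
  have m: "f \<in> borel_measurable (lebesgue_on S)" using assms by auto
  have "integrable (lebesgue_on S) (\<lambda>x. norm (f x) powr p)"
  proof (rule Bochner_Integration.integrable_bound)
    show "integrable (lebesgue_on S) (\<lambda>x. B powr (p - 1) * norm (f x))" using assms by auto
    show "(\<lambda>x. norm (f x) powr p) \<in> borel_measurable (lebesgue_on S)" using m by measurable
    show "AE x in lebesgue_on S. norm (norm (f x) powr p) \<le> norm (B powr (p - 1) * norm (f x))"
    proof (rule AE_I2)
      fix x
      have "norm (f x) powr p = norm (f x) powr (p - 1) * norm (f x)"
        by (cases "f x = 0") (auto simp: powr_diff)
      also have "\<dots> \<le> B powr (p - 1) * norm (f x)"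
        using assms by (intro mult_right_mono powr_mono2) auto
      finally show "norm (norm (f x) powr p) \<le> norm (B powr (p - 1) * norm (f x))" by simp
    qed
  qed
  with m show ?thesis by (simp add: Lp_def)
qed

lemma Cc_inf_Lp:
  fixes \<phi> :: "real^'d::finite \<Rightarrow> real^'n::finite"
  assumes "open S" "p \<ge> 1" "\<phi> \<in> Cc_inf UNIV"
  shows "\<phi> \<in> Lp S p" "grad \<phi> \<in> Lp S p" "\<phi> \<in> W1p S p"
proof -
  obtain B where B: "\<And>x. norm (\<phi> x) \<le> B" using Cc_inf_bounded[OF assms(3)] by metis
  obtain B' where B': "\<And>x. norm (grad \<phi> x) \<le> B'" using Cc_inf_grad_bounded[OF assms(3)] by metis
  show 1: "\<phi> \<in> Lp S p"
    by (rule Lp_bounded[OF assms(2) integrable_lborel_imp_lebesgue_on[OF Cc_inf_integrable[OF assms(3)]] B])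
      (use assms(1) in simp)
  show 2: "grad \<phi> \<in> Lp S p"
    by (rule Lp_bounded[OF assms(2) integrable_lborel_imp_lebesgue_on[OF Cc_inf_grad_integrable[OF assms(3)]] B'])
      (use assms(1) in simp)
  show "\<phi> \<in> W1p S p" using 1 2 Cc_inf_is_weak_grad[OF assms(1,3)] by (auto simp: W1p_def)
qed

lemma Cc_inf_UNIV: "\<phi> \<in> Cc_inf S \<Longrightarrow> \<phi> \<in> Cc_inf UNIV"
  using Cc_inf_mono[of S UNIV] by auto

lemma Cc_inf_subset_W1p0:
  assumes "open S" "p \<ge> 1"
  shows "(Cc_inf S :: (real^'d::finite \<Rightarrow> real^'n::finite) set) \<subseteq> W1p0 S p"
proof
  fix \<phi> :: "real^'d::finite \<Rightarrow> real^'n::finite" assume \<phi>: "\<phi> \<in> Cc_inf S"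
  have g0: "grad (\<lambda>x. 0 :: real^'n) = (\<lambda>x::real^'d. 0)"
  proof
    fix x :: "real^'d"
    show "grad (\<lambda>x. 0 :: real^'n) x = 0"
      by (rule grad_eq_0, rule partial_deriv_eq_0[of UNIV]) auto
  qed
  have "W1p_norm S p (\<lambda>x. 0 :: real^'n) = Lp_norm S p (\<lambda>x. 0 :: real^'n) + Lp_norm S p (grad (\<lambda>x. 0 :: real^'n))"
    by (rule W1p_norm_eq[OF assms(1) Cc_inf_Lp(2)[OF assms Cc_inf_zero] Cc_inf_is_weak_grad[OF assms(1) Cc_inf_zero]])
  then have "W1p_norm S p (\<lambda>x. 0 :: real^'n) = 0"
    unfolding g0 using assms(2) by (simp add: Lp_norm_def)
  then show "\<phi> \<in> W1p0 S p"
    using \<phi> Cc_inf_Lp(3)[OF assms Cc_inf_UNIV[OF \<phi>]] by (auto simp: W1p0_def intro!: bexI[of _ \<phi>])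
qed

section \<open>Comparison of exponents on a set of finite measure\<close>

text \<open>For x at most s the first term dominates; for larger x the second does, since the
  exponent p - q is nonpositive. With \<open>s\<close> left free, it plays the part of the
  inequalities of Holder and Young.\<close>

lemma powr_split_le:
  fixes x s :: real
  assumes "0 \<le> x" "0 < s" "0 \<le> p" "p \<le> q"
  shows "x powr p \<le> s powr p + s powr (p - q) * x powr q"
proof (cases "x \<le> s")
  case True
  then have "x powr p \<le> s powr p" using assms by (intro powr_mono2) auto
  then show ?thesis by (smt (verit) mult_nonneg_nonneg powr_ge_zero)
next
  case False
  then have "x powr p = x powr (p - q) * x powr q" using assms by (simp flip: powr_add)
  also have "\<dots> \<le> s powr (p - q) * x powr q"
    using False assms by (intro mult_right_mono powr_mono2') auto
  finally show ?thesis by (smt (verit) powr_ge_zero)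
qed

lemma Lp_powr_integral_le:
  assumes "0 < s" "0 \<le> p" "p \<le> q" "f \<in> Lp S q" "emeasure lebesgue S < \<infinity>" "S \<in> sets borel"
  shows "f \<in> Lp S p" "(\<integral>x. norm (f x) powr p \<partial>lebesgue_on S)
     \<le> s powr p * measure lebesgue S + s powr (p - q) * (\<integral>x. norm (f x) powr q \<partial>lebesgue_on S)"
proof -
  have m: "f \<in> borel_measurable (lebesgue_on S)" using assms by (auto simp: Lp_def)
  have S: "S \<in> sets lebesgue" using assms by simp
  have c: "integrable (lebesgue_on S) (\<lambda>x. c)" "(\<integral>x. c \<partial>lebesgue_on S) = c * measure lebesgue S" for c :: real
  proof -
    interpret finite_measure "lebesgue_on S" using assms S
      by (intro finite_measureI) (auto simp: emeasure_restrict_space)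
    show "integrable (lebesgue_on S) (\<lambda>x. c)" by simp
    show "(\<integral>x. c \<partial>lebesgue_on S) = c * measure lebesgue S" using S by (simp add: measure_restrict_space)
  qed
  have q: "integrable (lebesgue_on S) (\<lambda>x. norm (f x) powr q)" using assms by (simp add: Lp_def)
  have i: "integrable (lebesgue_on S) (\<lambda>x. s powr p + s powr (p - q) * norm (f x) powr q)"
    using c(1) q by simp
  have p: "integrable (lebesgue_on S) (\<lambda>x. norm (f x) powr p)"
  proof (rule Bochner_Integration.integrable_bound[OF i])
    show "(\<lambda>x. norm (f x) powr p) \<in> borel_measurable (lebesgue_on S)" using m by measurable
    show "AE x in lebesgue_on S. norm (norm (f x) powr p) \<le> norm (s powr p + s powr (p - q) * norm (f x) powr q)"
      using powr_split_le[OF norm_ge_zero assms(1-3)]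
      by (intro AE_I2) (simp add: order.trans[OF _ abs_ge_self])
  qed
  then show "f \<in> Lp S p" using m by (simp add: Lp_def)
  have "(\<integral>x. norm (f x) powr p \<partial>lebesgue_on S) \<le> (\<integral>x. s powr p + s powr (p - q) * norm (f x) powr q \<partial>lebesgue_on S)"
    by (rule integral_mono[OF p i]) (rule powr_split_le[OF norm_ge_zero assms(1-3)])
  also have "\<dots> = s powr p * measure lebesgue S + s powr (p - q) * (\<integral>x. norm (f x) powr q \<partial>lebesgue_on S)"
    using c q by simp
  finally show "(\<integral>x. norm (f x) powr p \<partial>lebesgue_on S)
     \<le> s powr p * measure lebesgue S + s powr (p - q) * (\<integral>x. norm (f x) powr q \<partial>lebesgue_on S)" .
qed

text \<open>Continuity of the embedding of the larger exponent into the smaller one, stated as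
  closeness to 0 so that no embedding constant has to be carried along.\<close>

lemma Lp_norm_small:
  fixes S :: "'a::euclidean_space set"
  assumes "1 \<le> p" "p \<le> q" "emeasure lebesgue S < \<infinity>" "S \<in> sets borel" "e > 0"
  obtains d where "d > 0" "\<And>f :: 'a \<Rightarrow> 'b::euclidean_space. f \<in> Lp S q \<Longrightarrow> Lp_norm S q f < d \<Longrightarrow> Lp_norm S p f < e"
proof -
  define m where "m = measure lebesgue S"
  have m: "m \<ge> 0" by (simp add: m_def)
  define X where "X = e powr p"
  have X: "X > 0" using assms by (simp add: X_def)
  \<comment> \<open>The choice of \<open>s\<close> makes the first term of the split at most X / 4,
    and that of \<open>d\<close> then makes the second at most X / 4. The summand 1 in m + 1 guards
    against null sets.\<close>
  define s where "s = (X / (4 * (m + 1))) powr (1 / p)"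
  have s: "s > 0" "s powr p = X / (4 * (m + 1))" using X m assms by (auto simp: s_def powr_powr)
  define d where "d = (X / 4 * s powr (q - p)) powr (1 / q)"
  have d: "d > 0" "d powr q = X / 4 * s powr (q - p)" using X s assms by (auto simp: d_def powr_powr)
  show ?thesis
  proof (rule that[OF d(1)])
    fix f :: "'a \<Rightarrow> 'b" assume f: "f \<in> Lp S q" "Lp_norm S q f < d"
    let ?I = "\<integral>x. norm (f x) powr q \<partial>lebesgue_on S"
    have I0: "?I \<ge> 0" by simp
    have "?I = (Lp_norm S q f) powr q" using I0 assms by (simp add: Lp_norm_def powr_powr)
    also have "\<dots> \<le> d powr q" using f assms by (intro powr_mono2) (auto simp: Lp_norm_nonneg)
    finally have "?I \<le> X / 4 * s powr (q - p)" using d by simp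
    then have "s powr (p - q) * ?I \<le> s powr (p - q) * (X / 4 * s powr (q - p))" by (intro mult_left_mono) auto
    also have "\<dots> = X / 4" using s(1) by (simp flip: powr_add)
    finally have 1: "s powr (p - q) * ?I \<le> X / 4" .
    have "s powr p * m \<le> X / 4" using X m by (simp add: s field_simps)
    with 1 have "(\<integral>x. norm (f x) powr p \<partial>lebesgue_on S) < X"
      using Lp_powr_integral_le(2)[OF s(1) _ assms(2) f(1) assms(3,4)] assms(1) X unfolding m_def by simp
    then have "(\<integral>x. norm (f x) powr p \<partial>lebesgue_on S) powr (1 / p) < X powr (1 / p)"
      using assms by (intro powr_less_mono2) auto
    also have "X powr (1 / p) = e" using assms by (simp add: X_def powr_powr)
    finally show "Lp_norm S p f < e" by (simp add: Lp_norm_def)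
  qed
qed

lemma bounded_open_emeasure_lebesgue:
  fixes S :: "'a::euclidean_space set"
  shows "open S \<Longrightarrow> bounded S \<Longrightarrow> emeasure lebesgue S < \<infinity>"
  using emeasure_bounded_finite[of S] by (simp add: emeasure_completion)

lemma Lp_mono_exponent:
  fixes S :: "'a::euclidean_space set"
  assumes "open S" "bounded S" "0 \<le> p" "p \<le> q"
  shows "Lp S q \<subseteq> Lp S p"
  using Lp_powr_integral_le(1)[OF zero_less_one assms(3,4) _ bounded_open_emeasure_lebesgue[OF assms(1,2)]] assms(1)
  by auto

lemma W1p_mono_exponent:
  assumes "open S" "bounded S" "0 \<le> p" "p \<le> q"
  shows "W1p S q \<subseteq> W1p S p"
  by (auto simp: W1p_def dest: subsetD[OF Lp_mono_exponent[OF assms]])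

text \<open>The same test functions approximate in both norms; the transfer of smallness is applied
  to functions and to gradients separately, as their value types differ.\<close>

lemma W1p0_mono_exponent:
  fixes S :: "(real^'d::finite) set"
  assumes S: "open S" "bounded S" and p: "1 \<le> p" "p \<le> q"
  shows "(W1p0 S q :: (real^'d \<Rightarrow> real^'n::finite) set) \<subseteq> W1p0 S p"
proof
  fix u :: "real^'d \<Rightarrow> real^'n" assume u: "u \<in> W1p0 S q"
  then have uq: "u \<in> W1p S q" by (simp add: W1p0_def)
  have "\<exists>\<phi>\<in>Cc_inf S. W1p_norm S p (\<lambda>x. u x - \<phi> x) < e" if "e > 0" for e
  proof -
    have e2: "e / 2 > 0" using that by simp
    obtain d1 where d1: "d1 > 0" "\<And>f :: _ \<Rightarrow> real^'n. f \<in> Lp S q \<Longrightarrow> Lp_norm S q f < d1 \<Longrightarrow> Lp_norm S p f < e / 2"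
      using Lp_norm_small[OF p bounded_open_emeasure_lebesgue[OF S] borel_open[OF S(1)] e2] by metis
    obtain d2 where d2: "d2 > 0" "\<And>f :: _ \<Rightarrow> real^'d^'n. f \<in> Lp S q \<Longrightarrow> Lp_norm S q f < d2 \<Longrightarrow> Lp_norm S p f < e / 2"
      using Lp_norm_small[OF p bounded_open_emeasure_lebesgue[OF S] borel_open[OF S(1)] e2] by metis
    obtain \<phi> where \<phi>: "\<phi> \<in> Cc_inf S" "W1p_norm S q (\<lambda>x. u x - \<phi> x) < min d1 d2"
      using u d1(1) d2(1) by (auto simp: W1p0_def dest!: spec[of _ "min d1 d2"])
    note \<phi>U = Cc_inf_UNIV[OF \<phi>(1)]
    have q: "q \<ge> 1" "q \<ge> 0" using p by auto
    have "(\<lambda>x. u x - \<phi> x) \<in> Lp S q"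
      using uq Cc_inf_Lp(1)[OF S(1) q(1) \<phi>U] q by (intro Lp_diff) (auto simp: W1p_def)
    moreover have "weak_grad S (\<lambda>x. u x - \<phi> x) \<in> Lp S q"
    proof -
      have "(\<lambda>x. weak_grad S u x - grad \<phi> x) \<in> Lp S q"
        by (rule Lp_diff[OF q(2) W1p_weak_grad(2)[OF S(1) uq] Cc_inf_Lp(2)[OF S(1) q(1) \<phi>U]])
      moreover have "is_weak_grad S (\<lambda>x. u x - \<phi> x) (\<lambda>x. weak_grad S u x - grad \<phi> x)"
        by (rule is_weak_grad_diff[OF S(1) W1p_weak_grad(1)[OF S(1) uq] Cc_inf_is_weak_grad[OF S(1) \<phi>U]])
      ultimately have "(\<lambda>x. u x - \<phi> x) \<in> W1p S q"
        using \<open>(\<lambda>x. u x - \<phi> x) \<in> Lp S q\<close> by (auto simp: W1p_def)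
      then show ?thesis by (rule W1p_weak_grad(2)[OF S(1)])
    qed
    moreover have "Lp_norm S q (\<lambda>x. u x - \<phi> x) < d1" "Lp_norm S q (weak_grad S (\<lambda>x. u x - \<phi> x)) < d2"
      using \<phi>(2) Lp_norm_nonneg[of S q "\<lambda>x. u x - \<phi> x"] Lp_norm_nonneg[of S q "weak_grad S (\<lambda>x. u x - \<phi> x)"]
      by (auto simp: W1p_norm_def)
    ultimately have "Lp_norm S p (\<lambda>x. u x - \<phi> x) < e / 2" "Lp_norm S p (weak_grad S (\<lambda>x. u x - \<phi> x)) < e / 2"
      by (simp_all only: d1(2) d2(2))
    then have "W1p_norm S p (\<lambda>x. u x - \<phi> x) < e" by (simp add: W1p_norm_def)
    with \<phi>(1) show ?thesis by blast
  qed
  moreover have "u \<in> W1p S p" using W1p_mono_exponent[OF S _ p(2)] p(1) uq by auto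
  ultimately show "u \<in> W1p0 S p" by (simp add: W1p0_def)
qed

text \<open>For the approximating test functions integration by parts over the whole space is exact,
  and both sides depend continuously on function and gradient in L1. Since \<zeta> need not vanish
  at the boundary of \<open>S\<close>, this is where zero boundary values are used.\<close>

lemma W1p0_imp_wgrad:
  fixes v :: "real^'d::finite \<Rightarrow> real^'n::finite"
  assumes S: "open S" and v: "v \<in> W1p0 S 1"
  obtains u G where "wgrad u G" "\<And>x. x \<notin> S \<Longrightarrow> u x = 0" "\<And>x. x \<notin> S \<Longrightarrow> G x = 0"
    "AE x in lebesgue_on S. v x = u x" "AE x in lebesgue_on S. weak_grad S v x = G x"
proof -
  have Sb: "S \<in> sets borel" using S by simp
  have vW: "v \<in> W1p S 1" using v by (simp add: W1p0_def)
  have vi: "integrable (lebesgue_on S) v" using vW by (simp add: W1p_def Lp_1_iff)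
  have gi: "integrable (lebesgue_on S) (weak_grad S v)" using W1p_weak_grad(2)[OF S vW] by (simp add: Lp_1_iff)
  have wg: "is_weak_grad S v (weak_grad S v)" by (rule W1p_weak_grad(1)[OF S vW])
  obtain u where u: "u \<in> borel_measurable borel" "\<And>x. x \<notin> S \<Longrightarrow> u x = 0" "AE x in lebesgue_on S. v x = u x"
    by (rule ex_borel_representative[OF Sb borel_measurable_integrable[OF vi]]) (rule that)
  obtain G where G: "G \<in> borel_measurable borel" "\<And>x. x \<notin> S \<Longrightarrow> G x = 0" "AE x in lebesgue_on S. weak_grad S v x = G x"
    by (rule ex_borel_representative[OF Sb borel_measurable_integrable[OF gi]]) (rule that)
  have ui': "integrable (lebesgue_on S) u"
    by (rule integrable_cong_AE_imp[OF vi borel_measurable_imp_lebesgue_on[OF u(1)] u(3)])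
  have Gi': "integrable (lebesgue_on S) G"
    by (rule integrable_cong_AE_imp[OF gi borel_measurable_imp_lebesgue_on[OF G(1)] G(3)])
  have ui: "integrable lborel u" using ui' integrable_lebesgue_on_zero_outside[OF Sb u(1,2)] by simp
  have Gi: "integrable lborel G" using Gi' integrable_lebesgue_on_zero_outside[OF Sb G(1,2)] by simp
  have "wgrad u G" unfolding wgrad_def
  proof (intro conjI ballI allI ui Gi)
    fix \<zeta> :: "real^'d \<Rightarrow> real" and i j
    assume \<zeta>: "\<zeta> \<in> Cc_inf UNIV"
    have \<zeta>': "partial_deriv j \<zeta> \<in> Cc_inf UNIV" by (rule Cc_inf_partial_deriv[OF \<zeta>])
    obtain B1 where B1: "\<And>x. norm (\<zeta> x) \<le> B1" using Cc_inf_bounded[OF \<zeta>] by metis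
    obtain B2 where B2: "\<And>x. norm (partial_deriv j \<zeta> x) \<le> B2" using Cc_inf_bounded[OF \<zeta>'] by metis
    have B0: "B1 \<ge> 0" "B2 \<ge> 0" using order.trans[OF norm_ge_zero B1] order.trans[OF norm_ge_zero B2] by auto
    have int1: "integrable lborel (\<lambda>x. w x $ i * partial_deriv j \<zeta> x)" if "integrable lborel w" for w :: "_ \<Rightarrow> real^'n"
      using integrable_mult_Cc_inf[OF integrable_vec_nth[OF that] \<zeta>'] by (simp add: mult.commute)
    have int2: "integrable lborel (\<lambda>x. w x $ i $ j * \<zeta> x)" if "integrable lborel w" for w :: "_ \<Rightarrow> real^'d^'n"
      using integrable_mult_Cc_inf[OF integrable_vec_nth[OF integrable_vec_nth[OF that]] \<zeta>] by (simp add: mult.commute)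
    let ?I = "(\<integral>x. u x $ i * partial_deriv j \<zeta> x \<partial>lborel) + (\<integral>x. G x $ i $ j * \<zeta> x \<partial>lborel)"
    have "\<bar>?I\<bar> \<le> e" if e: "e > 0" for e
    proof -
      \<comment> \<open>The defect \<open>?I\<close> is at most (B1 + B2) d when
        \<open>\<phi>\<close> is within \<open>d\<close> of \<open>v\<close>; the summand 1 keeps
        the divisor positive.\<close>
      define d where "d = e / (B1 + B2 + 1)"
      have d: "d > 0" "(B1 + B2) * d \<le> e" using e B0 by (auto simp: d_def field_simps)
      obtain \<phi> where \<phi>: "\<phi> \<in> Cc_inf S" "W1p_norm S 1 (\<lambda>x. v x - \<phi> x) < d"
        using v d(1) by (auto simp: W1p0_def)
      note \<phi>U = Cc_inf_UNIV[OF \<phi>(1)]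
      have g\<phi>0: "grad \<phi> x = 0" if "x \<notin> S" for x
        using Cc_inf_eq_0[OF Cc_inf_partial_deriv[OF \<phi>(1)] that] by (rule grad_eq_0)
      have \<phi>i: "integrable lborel \<phi>" "integrable lborel (grad \<phi>)"
        using Cc_inf_integrable[OF \<phi>U] Cc_inf_grad_integrable[OF \<phi>U] .
      have \<phi>m: "\<phi> \<in> borel_measurable borel" "grad \<phi> \<in> borel_measurable borel"
        using borel_measurable_integrable[OF \<phi>i(1)] borel_measurable_integrable[OF \<phi>i(2)] by auto
      have du: "integrable lborel (\<lambda>x. u x - \<phi> x)" and dG: "integrable lborel (\<lambda>x. G x - grad \<phi> x)"
        using ui Gi \<phi>i by auto
      have wd: "is_weak_grad S (\<lambda>x. v x - \<phi> x) (\<lambda>x. weak_grad S v x - grad \<phi> x)"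
        by (rule is_weak_grad_diff[OF S wg Cc_inf_is_weak_grad[OF S \<phi>U]])
      have "(\<lambda>x. weak_grad S v x - grad \<phi> x) \<in> Lp S 1"
        using W1p_weak_grad(2)[OF S vW] Cc_inf_Lp(2)[OF S _ \<phi>U] by (intro Lp_diff) auto
      note nrm = W1p_norm_eq[OF S this wd]
      note [measurable] = borel_measurable_integrable[OF vi] borel_measurable_integrable[OF gi]
        borel_measurable_imp_lebesgue_on[OF u(1)] borel_measurable_imp_lebesgue_on[OF G(1)]
        borel_measurable_imp_lebesgue_on[OF \<phi>m(1)] borel_measurable_imp_lebesgue_on[OF \<phi>m(2)]
      have "Lp_norm S 1 (\<lambda>x. v x - \<phi> x) = (\<integral>x. norm (u x - \<phi> x) \<partial>lebesgue_on S)"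
        unfolding Lp_norm_1
        by (rule integral_cong_AE) (use u(3) in \<open>measurable, auto elim!: eventually_mono\<close>)
      also have "\<dots> = (\<integral>x. norm (u x - \<phi> x) \<partial>lborel)"
        by (rule integral_lebesgue_on_zero_outside[OF Sb]) (use u \<phi>m Cc_inf_eq_0[OF \<phi>(1)] in auto)
      finally have n1: "Lp_norm S 1 (\<lambda>x. v x - \<phi> x) = (\<integral>x. norm (u x - \<phi> x) \<partial>lborel)" .
      have "Lp_norm S 1 (\<lambda>x. weak_grad S v x - grad \<phi> x) = (\<integral>x. norm (G x - grad \<phi> x) \<partial>lebesgue_on S)"
        unfolding Lp_norm_1
        by (rule integral_cong_AE) (use G(3) in \<open>measurable, auto elim!: eventually_mono\<close>)
      also have "\<dots> = (\<integral>x. norm (G x - grad \<phi> x) \<partial>lborel)"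
        by (rule integral_lebesgue_on_zero_outside[OF Sb]) (use G \<phi>m g\<phi>0 in auto)
      finally have n2: "Lp_norm S 1 (\<lambda>x. weak_grad S v x - grad \<phi> x) = (\<integral>x. norm (G x - grad \<phi> x) \<partial>lborel)" .
      have le: "(\<integral>x. norm (u x - \<phi> x) \<partial>lborel) \<le> d" "(\<integral>x. norm (G x - grad \<phi> x) \<partial>lborel) \<le> d"
        using \<phi>(2) nrm Lp_norm_nonneg[of S 1 "\<lambda>x. v x - \<phi> x"] Lp_norm_nonneg[of S 1 "\<lambda>x. weak_grad S v x - grad \<phi> x"]
        unfolding n1 n2 by linarith+
      have "(\<integral>x. \<phi> x $ i * partial_deriv j \<zeta> x \<partial>lborel) + (\<integral>x. grad \<phi> x $ i $ j * \<zeta> x \<partial>lborel) = 0"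
        using Cc_inf_wgrad[OF \<phi>U] \<zeta> by (simp add: wgrad_def)
      then have "?I = (\<integral>x. (u x - \<phi> x) $ i * partial_deriv j \<zeta> x \<partial>lborel) + (\<integral>x. (G x - grad \<phi> x) $ i $ j * \<zeta> x \<partial>lborel)"
        using int1[OF ui] int1[OF \<phi>i(1)] int2[OF Gi] int2[OF \<phi>i(2)] by (simp add: left_diff_distrib)
      then have "\<bar>?I\<bar> \<le> \<bar>\<integral>x. (u x - \<phi> x) $ i * partial_deriv j \<zeta> x \<partial>lborel\<bar> + \<bar>\<integral>x. (G x - grad \<phi> x) $ i $ j * \<zeta> x \<partial>lborel\<bar>"
        by simp
      also have "\<bar>\<integral>x. (u x - \<phi> x) $ i * partial_deriv j \<zeta> x \<partial>lborel\<bar> \<le> (\<integral>x. B2 * norm (u x - \<phi> x) \<partial>lborel)"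
      proof (rule integral_abs_bound_integral[OF int1[OF du]])
        fix x
        have "\<bar>(u x - \<phi> x) $ i\<bar> * \<bar>partial_deriv j \<zeta> x\<bar> \<le> norm (u x - \<phi> x) * B2"
          by (intro mult_mono component_le_norm_cart) (use B2[of x] in auto)
        then show "\<bar>(u x - \<phi> x) $ i * partial_deriv j \<zeta> x\<bar> \<le> B2 * norm (u x - \<phi> x)"
          by (simp only: abs_mult mult.commute[of B2])
      qed (use du in simp)
      also have "\<bar>\<integral>x. (G x - grad \<phi> x) $ i $ j * \<zeta> x \<partial>lborel\<bar> \<le> (\<integral>x. B1 * norm (G x - grad \<phi> x) \<partial>lborel)"
      proof (rule integral_abs_bound_integral[OF int2[OF dG]])
        fix x
        have "\<bar>(G x - grad \<phi> x) $ i $ j\<bar> * \<bar>\<zeta> x\<bar> \<le> norm (G x - grad \<phi> x) * B1"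
          by (intro mult_mono norm_matrix_component_le) (use B1[of x] in auto)
        then show "\<bar>(G x - grad \<phi> x) $ i $ j * \<zeta> x\<bar> \<le> B1 * norm (G x - grad \<phi> x)"
          by (simp only: abs_mult mult.commute[of B1])
      qed (use dG in simp)
      also have "(\<integral>x. B2 * norm (u x - \<phi> x) \<partial>lborel) + (\<integral>x. B1 * norm (G x - grad \<phi> x) \<partial>lborel) \<le> B2 * d + B1 * d"
        using le B0 by (simp add: add_mono mult_left_mono)
      also have "\<dots> \<le> e" using d by (simp add: algebra_simps)
      finally show ?thesis by simp
    qed
    then have "\<bar>?I\<bar> \<le> 0" using field_le_epsilon[of "\<bar>?I\<bar>" 0] by simp
    then show "(\<integral>x. u x $ i * partial_deriv j \<zeta> x \<partial>lborel) = - (\<integral>x. G x $ i $ j * \<zeta> x \<partial>lborel)" by simp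
  qed
  then show ?thesis using that u G by blast
qed

section \<open>The integrand\<close>

lemma integrable_kernel:
  assumes "k \<in> Cc_inf UNIV" "t > 0" shows "integrable lborel (\<lambda>y. rescale t k (x - y))"
  using Cc_inf_integrable[OF Cc_inf_affine[OF _ rescale_Cc_inf[OF assms], of "-1" x]] by simp

text \<open>The left-hand side is the convolution with the constant function 1.\<close>

lemma integral_kernel:
  fixes k :: "real^'d::finite \<Rightarrow> real"
  assumes "k \<in> Cc_inf UNIV" "t > 0" shows "(\<integral>y. rescale t k (x - y) \<partial>lborel) = (\<integral>z. k z \<partial>lborel)"
  using conv_rescale[of k "\<lambda>_. 1 :: real" t x] Cc_inf_borel[OF assms(1)] assms(2) by (simp add: conv_def)

lemma rescale_nonneg: "(\<And>x. k x \<ge> 0) \<Longrightarrow> t > 0 \<Longrightarrow> rescale t k x \<ge> 0"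
  by (simp add: rescale_def)

lemma grad_conv: "wgrad u G \<Longrightarrow> k \<in> Cc_inf UNIV \<Longrightarrow> grad (conv k u) = conv k G"
  by (auto simp: fun_eq_iff grad_def vec_eq_iff wgrad_conv)

text \<open>The derivative is thrown on the kernel, which costs a factor 1 / t, whereas the L1 norm
  of the dilated kernel derivative is independent of \<open>t\<close>.\<close>

lemma conv_gradient_bound_of_bounded:
  fixes w :: "real^'d::finite \<Rightarrow> real^'n::finite"
  assumes wG: "wgrad w G" and K: "\<And>x. norm (w x) \<le> K" and k: "k \<in> Cc_inf UNIV"
  obtains C where "C \<ge> 0" "\<And>t x. t > 0 \<Longrightarrow> norm (conv (rescale t k) G x) \<le> C * t powr (-1)"
proof -
  have w: "integrable lborel w" using wG by (simp add: wgrad_def)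
  have k': "partial_deriv j k \<in> Cc_inf UNIV" for j by (rule Cc_inf_partial_deriv[OF k])
  define I where "I j = (\<integral>z. norm (partial_deriv j k z) \<partial>lborel)" for j
  have ki: "integrable lborel (\<lambda>z. norm (partial_deriv j k z))" for j using Cc_inf_integrable[OF k'] by simp
  have I0: "I j \<ge> 0" for j by (simp add: I_def)
  have K0: "K \<ge> 0" using order.trans[OF norm_ge_zero K] .
  show ?thesis
  proof (rule that)
    show "(\<Sum>j\<in>UNIV. I j * K) \<ge> 0" using I0 K0 by (intro sum_nonneg) auto
    fix t :: real and x :: "real^'d" assume t: "t > 0"
    have b: "norm (partial_deriv j (conv (rescale t k) w) x) \<le> (1 / t) * (I j * K)" for j
    proof -
      have "partial_deriv j (conv (rescale t k) w) x = conv (\<lambda>x. (1 / t) * rescale t (partial_deriv j k) x) w x"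
        using partial_deriv_conv[OF rescale_Cc_inf[OF k t] w] partial_deriv_rescale[OF k t] by (simp add: conv_def)
      also have "\<dots> = (1 / t) *\<^sub>R conv (rescale t (partial_deriv j k)) w x"
        unfolding conv_def integral_scaleR_right[symmetric] by simp
      also have "conv (rescale t (partial_deriv j k)) w x = (\<integral>z. partial_deriv j k z *\<^sub>R w (x - t *\<^sub>R z) \<partial>lborel)"
        using wgrad_borel(1)[OF wG] Cc_inf_borel[OF k'] t by (intro conv_rescale) auto
      finally have "norm (partial_deriv j (conv (rescale t k) w) x) = (1 / t) * norm (\<integral>z. partial_deriv j k z *\<^sub>R w (x - t *\<^sub>R z) \<partial>lborel)"
        using t by simp
      also have "\<dots> \<le> (1 / t) * (\<integral>z. norm (partial_deriv j k z *\<^sub>R w (x - t *\<^sub>R z)) \<partial>lborel)"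
        using t by (intro mult_left_mono Bochner_Integration.integral_norm_bound) auto
      finally have le: "norm (partial_deriv j (conv (rescale t k) w) x) \<le> (1 / t) * (\<integral>z. norm (partial_deriv j k z *\<^sub>R w (x - t *\<^sub>R z)) \<partial>lborel)" .
      have "(\<integral>z. norm (partial_deriv j k z *\<^sub>R w (x - t *\<^sub>R z)) \<partial>lborel) \<le> (\<integral>z. norm (partial_deriv j k z) * K \<partial>lborel)"
        by (intro integral_mono') (use ki K K0 in \<open>auto intro!: mult_left_mono\<close>)
      also have "\<dots> = I j * K" by (simp add: I_def)
      finally show ?thesis
        by (intro order.trans[OF le mult_left_mono]) (use t in auto)
    qed
    have "norm (conv (rescale t k) G x) \<le> (\<Sum>j\<in>UNIV. norm (partial_deriv j (conv (rescale t k) w) x))"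
      using grad_norm_le[of "conv (rescale t k) w" x] grad_conv[OF wG rescale_Cc_inf[OF k t]] by simp
    also have "\<dots> \<le> (\<Sum>j\<in>UNIV. (1 / t) * (I j * K))" by (rule sum_mono) (rule b)
    also have "\<dots> = (\<Sum>j\<in>UNIV. I j * K) * t powr (-1)"
      using t by (simp add: powr_minus_divide sum_divide_distrib)
    finally show "norm (conv (rescale t k) G x) \<le> (\<Sum>j\<in>UNIV. I j * K) * t powr (-1)" .
  qed
qed

lemma norm_conv_le_integral:
  fixes G :: "real^'d::finite \<Rightarrow> 'b::euclidean_space"
  assumes k: "k \<in> Cc_inf UNIV" "\<And>x. k x \<ge> 0" and G: "integrable lborel G"
  shows "norm (conv k G x) \<le> (\<integral>y. k (x - y) * norm (G y) \<partial>lborel)"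
    and "integrable lborel (\<lambda>y. k (x - y) * norm (G y))"
proof -
  have "norm (conv k G x) \<le> (\<integral>y. norm (k (x - y) *\<^sub>R G y) \<partial>lborel)"
    unfolding conv_def by (rule Bochner_Integration.integral_norm_bound)
  then show "norm (conv k G x) \<le> (\<integral>y. k (x - y) * norm (G y) \<partial>lborel)"
    using k(2) by simp
  show "integrable lborel (\<lambda>y. k (x - y) * norm (G y))"
    using integrable_conv[OF k(1) integrable_norm[OF G]] by simp
qed

text \<open>The exponent comes from balancing \<open>A + A\<^sup>1\<^sup>-\<^sup>p t\<^sup>-\<^sup>d\<close> in Young's inequality, with \<open>A = t\<^sup>-\<^sup>d\<^sup>/\<^sup>p\<close>.\<close>

lemma conv_bound_of_Lp:
  fixes G :: "real^'d::finite \<Rightarrow> 'b::euclidean_space"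
  assumes k: "k \<in> Cc_inf UNIV" "\<And>x. k x \<ge> 0" "(\<integral>x. k x \<partial>lborel) = 1"
    and G: "integrable lborel G" "integrable lborel (\<lambda>x. norm (G x) powr p)" and p: "p > 1"
  obtains C where "C \<ge> 0"
    "\<And>t x. t > 0 \<Longrightarrow> norm (conv (rescale t k) G x) \<le> C * t powr (- (real CARD('d) / p))"
proof -
  obtain B where B: "B > 0" "\<And>x. norm (k x) \<le> B" using Cc_inf_bounded[OF k(1)] by metis
  define P where "P = (\<integral>x. norm (G x) powr p \<partial>lborel)"
  have P0: "P \<ge> 0" by (simp add: P_def)
  show ?thesis
  proof (rule that)
    show "1 + B * P \<ge> 0" using B P0 by simp
    fix t :: real and x :: "real^'d" assume t: "t > 0"
    define A where "A = t powr (- (real CARD('d) / p))"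
    have A: "A > 0" using t by (simp add: A_def)
    note kt = rescale_Cc_inf[OF k(1) t]
    have kb: "rescale t k z \<le> (1 / t) ^ CARD('d) * B" for z
      unfolding rescale_def using B(2)[of "(1 / t) *\<^sub>R z"] t by (simp add: mult_left_mono)
    have kp: "integrable lborel (\<lambda>y. rescale t k (x - y) * norm (G y) powr p)"
      using integrable_conv[OF kt G(2)] by simp
    have "norm (conv (rescale t k) G x) \<le> (\<integral>y. rescale t k (x - y) * norm (G y) \<partial>lborel)"
      by (rule norm_conv_le_integral[OF kt _ G(1)]) (use rescale_nonneg[of k, OF k(2) t] in auto)
    also have "\<dots> \<le> (\<integral>y. A * rescale t k (x - y) + A powr (1 - p) * (rescale t k (x - y) * norm (G y) powr p) \<partial>lborel)"
    proof (rule integral_mono)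
      show "integrable lborel (\<lambda>y. rescale t k (x - y) * norm (G y))"
        by (rule norm_conv_le_integral[OF kt _ G(1)]) (use rescale_nonneg[of k, OF k(2) t] in auto)
      show "integrable lborel (\<lambda>y. A * rescale t k (x - y) + A powr (1 - p) * (rescale t k (x - y) * norm (G y) powr p))"
        using integrable_kernel[OF k(1) t] kp by simp
      fix y
      \<comment> \<open>Young's inequality, in the form of \<open>powr_split_le\<close> with
        threshold \<open>A\<close> and exponents 1 and p. The kernel has integral 1, so the first
        term contributes exactly \<open>A\<close>.\<close>
      have "norm (G y) \<le> A + A powr (1 - p) * norm (G y) powr p"
        using powr_split_le[of "norm (G y)" A 1 p] A p by simp
      then have "rescale t k (x - y) * norm (G y) \<le> rescale t k (x - y) * (A + A powr (1 - p) * norm (G y) powr p)"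
        using rescale_nonneg[of k, OF k(2) t] by (intro mult_left_mono) auto
      then show "rescale t k (x - y) * norm (G y) \<le> A * rescale t k (x - y) + A powr (1 - p) * (rescale t k (x - y) * norm (G y) powr p)"
        by (simp add: algebra_simps)
    qed
    also have "\<dots> = A + A powr (1 - p) * (\<integral>y. rescale t k (x - y) * norm (G y) powr p \<partial>lborel)"
      using integrable_kernel[OF k(1) t] kp integral_kernel[OF k(1) t] k(3) by simp
    also have "(\<integral>y. rescale t k (x - y) * norm (G y) powr p \<partial>lborel) \<le> (\<integral>y. ((1 / t) ^ CARD('d) * B) * norm (G y) powr p \<partial>lborel)"
      by (rule integral_mono[OF kp]) (use G kb in \<open>auto intro!: mult_right_mono\<close>)
    also have "\<dots> = (1 / t) ^ CARD('d) * B * P" by (simp add: P_def)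
    finally have "norm (conv (rescale t k) G x) \<le> A + A powr (1 - p) * ((1 / t) ^ CARD('d) * B * P)"
      by (simp add: mult_left_mono)
    also have "A powr (1 - p) * ((1 / t) ^ CARD('d) * B * P) = A * (B * P)"
    proof -
      have "(1 / t) ^ CARD('d) = t powr (- real CARD('d))"
        using t by (simp add: powr_minus powr_realpow power_one_over inverse_eq_divide)
      \<comment> \<open>The powers of \<open>t\<close> from A^(1 - p) and from the height of the
        kernel combine to that of \<open>A\<close> itself: -(d/p)(1 - p) - d = -d/p.\<close>
      then have "A powr (1 - p) * (1 / t) ^ CARD('d) = t powr (- (real CARD('d) / p) * (1 - p) + - real CARD('d))"
        by (simp only: A_def powr_powr powr_add)
      also have "- (real CARD('d) / p) * (1 - p) + - real CARD('d) = - (real CARD('d) / p)"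
        using p by (simp add: field_simps)
      finally show ?thesis by (simp add: A_def mult.assoc[symmetric])
    qed
    finally show "norm (conv (rescale t k) G x) \<le> (1 + B * P) * t powr (- (real CARD('d) / p))"
      by (simp add: A_def algebra_simps)
  qed
qed

section \<open>Consequences of the structural conditions\<close>

text \<open>The structural conditions on the open set, with all constants fixed except those of
  (Cont), which depend on \<open>D\<close>. The comparison is a two-point statement, with
  \<open>x\<close> as centre of the ball, and its constants are nonnegative so that they can
  multiply inequalities.\<close>

locale orlicz_integrand =
  fixes \<Omega> :: "(real^'d::finite) set" and \<psi> :: "real^'d \<Rightarrow> real \<Rightarrow> real" and p q C1 C2 C4 \<xi>0 :: real
  assumes open_dom: "open \<Omega>" and bounded_dom: "bounded \<Omega>"
    and psi_nonneg: "\<And>x \<xi>. x \<in> \<Omega> \<Longrightarrow> 0 \<le> \<xi> \<Longrightarrow> 0 \<le> \<psi> x \<xi>"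
    and psi_meas: "\<And>\<xi>. 0 \<le> \<xi> \<Longrightarrow> (\<lambda>x. \<psi> x \<xi>) \<in> borel_measurable (lebesgue_on \<Omega>)"
    and psi_zero: "\<And>x. x \<in> \<Omega> \<Longrightarrow> \<psi> x 0 = 0"
    and psi_convex: "\<And>x. x \<in> \<Omega> \<Longrightarrow> convex_on {0..} (\<psi> x)"
    and lower: "\<And>x \<xi>. x \<in> \<Omega> \<Longrightarrow> \<xi>0 \<le> \<xi> \<Longrightarrow> C1 * \<xi> powr p \<le> \<psi> x \<xi>"
    and upper: "\<And>x \<xi>. x \<in> \<Omega> \<Longrightarrow> 0 \<le> \<xi> \<Longrightarrow> \<psi> x \<xi> \<le> C2 * (1 + \<xi> powr q)"
    and doubling: "\<And>x \<xi>. x \<in> \<Omega> \<Longrightarrow> 0 \<le> \<xi> \<Longrightarrow> \<psi> x (2 * \<xi>) \<le> C4 * \<psi> x \<xi>"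
    and const_bounds: "\<xi>0 \<ge> 1" "C1 > 0" "C2 > 0" "C4 \<ge> 1" "p > 1" "q > 1"
    and comparison: "\<And>D. D > 1 \<Longrightarrow> \<exists>M\<ge>0. \<exists>N\<ge>0. \<forall>\<gamma>\<in>{0<..<1/2}. \<forall>x\<in>\<Omega>. \<forall>y\<in>\<Omega>. dist x y < \<gamma> \<longrightarrow>
        (\<forall>\<xi>\<in>{0..D * \<gamma> powr (- min 1 (real CARD('d) / p))}. \<psi> x \<xi> \<le> M * \<psi> y \<xi> + N)"
begin

lemma dom_borel: "\<Omega> \<in> sets borel" using open_dom by simp

lemma dom_fin: "emeasure lebesgue \<Omega> < \<infinity>"
  by (rule bounded_open_emeasure_lebesgue[OF open_dom bounded_dom])

text \<open>Convexity along the chord from 0, where \<psi> vanishes. Monotonicity and continuity at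
  0 both follow from it.\<close>

lemma psi_scale:
  assumes "x \<in> \<Omega>" "0 \<le> t" "0 \<le> c" "c \<le> 1" shows "\<psi> x (c * t) \<le> c * \<psi> x t"
proof -
  have "\<psi> x ((1 - c) *\<^sub>R 0 + c *\<^sub>R t) \<le> (1 - c) * \<psi> x 0 + c * \<psi> x t"
    by (rule convex_onD[OF psi_convex]) (use assms in auto)
  then show ?thesis using psi_zero assms by simp
qed

lemma psi_mono:
  assumes "x \<in> \<Omega>" "0 \<le> s" "s \<le> t" shows "\<psi> x s \<le> \<psi> x t"
proof (cases "t = 0")
  case False
  then have "\<psi> x ((s / t) * t) \<le> (s / t) * \<psi> x t" using assms by (intro psi_scale) auto
  also have "\<dots> \<le> 1 * \<psi> x t" using assms False psi_nonneg by (intro mult_right_mono) auto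
  finally show ?thesis using False by simp
qed (use assms in auto)

lemma psi_midpoint:
  assumes "x \<in> \<Omega>" "0 \<le> s" "0 \<le> t" shows "\<psi> x (s + t) \<le> \<psi> x (2 * s) / 2 + \<psi> x (2 * t) / 2"
proof -
  have "\<psi> x ((1 - 1/2) *\<^sub>R (2 * s) + (1/2) *\<^sub>R (2 * t)) \<le> (1 - 1/2) * \<psi> x (2 * s) + (1/2) * \<psi> x (2 * t)"
    by (rule convex_onD[OF psi_convex]) (use assms in auto)
  then show ?thesis by simp
qed

text \<open>The sum of the norms is the midpoint of their doubles, and the doubling condition
  removes the factor 2. Hence the modular is subadditive up to the factor \<open>C4\<close>.\<close>

lemma psi_norm_add:
  fixes a b :: "'b::real_normed_vector"
  assumes x: "x \<in> \<Omega>" shows "\<psi> x (norm (a + b)) \<le> C4 * (\<psi> x (norm a) + \<psi> x (norm b))"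
proof -
  have "\<psi> x (norm (a + b)) \<le> \<psi> x (norm a + norm b)" by (intro psi_mono x norm_triangle_ineq) auto
  also have "\<dots> \<le> \<psi> x (2 * norm a) / 2 + \<psi> x (2 * norm b) / 2" by (intro psi_midpoint x) auto
  also have "\<dots> \<le> C4 * \<psi> x (norm a) / 2 + C4 * \<psi> x (norm b) / 2"
    using doubling[OF x] by (intro add_mono divide_right_mono) auto
  also have "\<dots> \<le> C4 * (\<psi> x (norm a) + \<psi> x (norm b))"
    using psi_nonneg[OF x] const_bounds by (simp add: field_simps)
  finally show ?thesis .
qed

lemma psi_norm_diff:
  fixes a b :: "'b::real_normed_vector"
  assumes x: "x \<in> \<Omega>" shows "\<psi> x (norm (a - b)) \<le> C4 * (\<psi> x (norm a) + \<psi> x (norm b))"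
  using psi_norm_add[OF x, of a "- b"] by simp

lemma psi_dbl_pow:
  assumes x: "x \<in> \<Omega>" "0 \<le> t" shows "\<psi> x (2 ^ m * t) \<le> C4 ^ m * \<psi> x t"
proof (induction m)
  case (Suc m)
  have "\<psi> x (2 * (2 ^ m * t)) \<le> C4 * \<psi> x (2 ^ m * t)" using x by (intro doubling) auto
  also have "\<dots> \<le> C4 * (C4 ^ m * \<psi> x t)" using Suc const_bounds by (intro mult_left_mono) auto
  finally show ?case by (simp add: mult.assoc)
qed simp

text \<open>A superlevel set is a countable union over rational r below f x. Monotonicity gives one
  inclusion, left continuity at f x the other; the latter holds at positive arguments, by
  convexity.\<close>

lemma psi_measurable:
  assumes f: "f \<in> borel_measurable (lebesgue_on \<Omega>)" "\<And>x. f x \<ge> 0"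
  shows "(\<lambda>x. \<psi> x (f x)) \<in> borel_measurable (lebesgue_on \<Omega>)"
proof (rule borel_measurable_iff_greater[THEN iffD2], rule allI)
  fix c :: real
  have sp: "space (lebesgue_on \<Omega>) = \<Omega>" using open_dom by simp
  show "{x \<in> space (lebesgue_on \<Omega>). c < \<psi> x (f x)} \<in> sets (lebesgue_on \<Omega>)"
  proof (cases "c < 0")
    case True
    then have "{x \<in> space (lebesgue_on \<Omega>). c < \<psi> x (f x)} = space (lebesgue_on \<Omega>)"
      using psi_nonneg f(2) sp by (auto intro: less_le_trans)
    then show ?thesis by simp
  next
    case False
    have "{x \<in> space (lebesgue_on \<Omega>). c < \<psi> x (f x)} =
      (\<Union>r\<in>{r\<in>\<rat>. 0 \<le> r}. {x \<in> space (lebesgue_on \<Omega>). r < f x} \<inter> {x \<in> space (lebesgue_on \<Omega>). c < \<psi> x r})"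
    proof safe
      fix x assume x: "x \<in> space (lebesgue_on \<Omega>)" "c < \<psi> x (f x)"
      then have xO: "x \<in> \<Omega>" using sp by simp
      \<comment> \<open>A level c at least 0 is exceeded only at positive arguments, so f x is
        interior to the half-line on which convexity gives continuity.\<close>
      have fx: "f x > 0" using x(2) False psi_zero[OF xO] f(2)[of x] by (cases "f x = 0") auto
      have "continuous_on {0<..} (\<psi> x)"
        by (rule convex_on_continuous) (use psi_convex[OF xO] in \<open>auto intro: convex_on_subset\<close>)
      then have "isCont (\<psi> x) (f x)" using fx by (simp add: continuous_on_eq_continuous_at)
      then have "(\<psi> x \<longlongrightarrow> \<psi> x (f x)) (at_left (f x))"
        by (auto simp: isCont_def filterlim_at_split)
      then have "eventually (\<lambda>r. c < \<psi> x r) (at_left (f x))" using x(2) by (rule order_tendstoD)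
      then obtain b where b: "b < f x" "\<And>r. b < r \<Longrightarrow> r < f x \<Longrightarrow> c < \<psi> x r"
        by (auto simp: eventually_at_left_field)
      obtain r where "r \<in> \<rat>" "max b 0 < r" "r < f x"
        using Rats_dense_in_real[of "max b 0" "f x"] b(1) fx by auto
      then show "x \<in> (\<Union>r\<in>{r\<in>\<rat>. 0 \<le> r}. {x \<in> space (lebesgue_on \<Omega>). r < f x} \<inter> {x \<in> space (lebesgue_on \<Omega>). c < \<psi> x r})"
        using b x(1) by (auto intro!: bexI[of _ r])
    next
      fix x r assume "x \<in> space (lebesgue_on \<Omega>)" "(0::real) \<le> r" "r < f x" "c < \<psi> x r"
      then show "c < \<psi> x (f x)" using psi_mono[of x r "f x"] sp by auto
    qed
    moreover have "countable {r\<in>\<rat>. (0::real) \<le> r}"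
      using countable_rat by (rule countable_subset[rotated]) auto
    ultimately show ?thesis using f(1) psi_meas
      by (auto intro!: sets.countable_UN' sets.Int simp: borel_measurable_iff_greater)
  qed
qed

lemma psi_norm_measurable:
  fixes f :: "real^'d \<Rightarrow> 'b::euclidean_space"
  assumes "f \<in> borel_measurable (lebesgue_on \<Omega>)"
  shows "(\<lambda>x. \<psi> x (norm (f x))) \<in> borel_measurable (lebesgue_on \<Omega>)"
  using assms by (intro psi_measurable) auto

text \<open>The Musielak--Orlicz modular of an arbitrary field. Detached from weak gradients, it
  applies to sums, differences and scalings of fields and to explicit representatives of
  gradients.\<close>

definition modular :: "(real^'d \<Rightarrow> 'b::euclidean_space) \<Rightarrow> ennreal" where
  "modular f = (\<integral>\<^sup>+x. ennreal (\<psi> x (norm (f x))) \<partial>lebesgue_on \<Omega>)"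

text \<open>From the lower growth bound in (A4) and p > 1. It absorbs an additive constant
  multiplied by \<open>t\<close>, as arises when the support line is followed beyond the range of
  (Cont).\<close>

lemma psi_linear_le:
  assumes "y \<in> \<Omega>" "0 \<le> t" shows "t \<le> \<xi>0 + \<psi> y t / C1"
proof (cases "t \<le> \<xi>0")
  case True
  then show ?thesis using psi_nonneg[OF assms] const_bounds by (simp add: add_increasing2)
next
  case False
  then have "t powr 1 \<le> t powr p" using const_bounds by (intro powr_mono) auto
  then have "C1 * t \<le> C1 * t powr p" using False const_bounds by (intro mult_left_mono) auto
  also have "\<dots> \<le> \<psi> y t" using lower[OF assms(1)] False by simp
  finally have "t \<le> \<psi> y t / C1" using const_bounds by (simp add: field_simps)
  then show ?thesis using const_bounds by simp
qed

text \<open>Jensen's inequality is used for the fixed convex function \<open>\<psi> x\<close>, through a support line at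
  \<open>\<xi>\<close>. (Cont) compares \<open>\<psi> x\<close> with \<open>\<psi> y\<close> only below the threshold \<open>L\<close>; above it, the line still lies
  below a multiple of \<open>\<psi> y\<close>, because its slope at \<open>\<xi> \<le> L / 2\<close> is at most \<open>2 \<psi> x L / L\<close>.\<close>

lemma support_line:
  assumes "D > 1"
  shows "\<exists>M\<ge>0. \<exists>N\<ge>0. \<forall>\<gamma>\<in>{0<..<1/2}. \<forall>x\<in>\<Omega>. \<forall>\<xi>. 0 \<le> \<xi> \<and> 2 * \<xi> \<le> D * \<gamma> powr (- min 1 (real CARD('d) / p)) \<longrightarrow>
    (\<exists>s\<ge>0. \<forall>y\<in>\<Omega>. dist x y < \<gamma> \<longrightarrow> (\<forall>t\<ge>0. \<psi> x \<xi> + s * (t - \<xi>) \<le> M * \<psi> y t + N))"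
proof -
  obtain M N where M: "M \<ge> 0" "N \<ge> 0" and MN: "\<And>\<gamma> x y \<xi>. 0 < \<gamma> \<Longrightarrow> \<gamma> < 1/2 \<Longrightarrow> x \<in> \<Omega> \<Longrightarrow> y \<in> \<Omega> \<Longrightarrow> dist x y < \<gamma> \<Longrightarrow>
     0 \<le> \<xi> \<Longrightarrow> \<xi> \<le> D * \<gamma> powr (- min 1 (real CARD('d) / p)) \<Longrightarrow> \<psi> x \<xi> \<le> M * \<psi> y \<xi> + N"
    using comparison[OF assms] by (metis atLeastAtMost_iff greaterThanLessThan_iff)
  \<comment> \<open>Both come from arguments above the threshold, where the bound is 2 M
    \<open>\<psi> y t\<close> + 2 N t and \<open>psi_linear_le\<close> replaces the last t. The
    first summand N of \<open>N'\<close> covers arguments below the threshold.\<close>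
  define M' where "M' = 2 * M + 2 * N / C1"
  define N' where "N' = N + 2 * N * \<xi>0"
  have M'0: "M' \<ge> 0" "N' \<ge> 0" "M \<le> M'" "N \<le> N'" using M const_bounds by (auto simp: M'_def N'_def)
  show ?thesis
  proof (rule exI[of _ M'], rule conjI[OF M'0(1)], rule exI[of _ N'], rule conjI[OF M'0(2)], intro ballI allI impI)
    fix \<gamma> x \<xi> assume \<gamma>: "\<gamma> \<in> {0<..<1/2::real}" and x: "x \<in> \<Omega>"
      and \<xi>: "0 \<le> \<xi> \<and> 2 * \<xi> \<le> D * \<gamma> powr (- min 1 (real CARD('d) / p))"
    define L where "L = D * \<gamma> powr (- min 1 (real CARD('d) / p))"
    \<comment> \<open>The radius is below 1 and the exponent is nonpositive, so the threshold is at
      least \<open>D\<close>, in particular at least 1.\<close>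
    have "\<gamma> powr 0 \<le> \<gamma> powr (- min 1 (real CARD('d) / p))"
      using \<gamma> const_bounds by (intro powr_mono') auto
    then have L: "L \<ge> 1" using assms \<gamma> mult_mono[of 1 D 1 "\<gamma> powr (- min 1 (real CARD('d) / p))"] by (simp add: L_def)
    show "\<exists>s\<ge>0. \<forall>y\<in>\<Omega>. dist x y < \<gamma> \<longrightarrow> (\<forall>t\<ge>0. \<psi> x \<xi> + s * (t - \<xi>) \<le> M' * \<psi> y t + N')"
    proof (cases "\<xi> = 0")
      case True
      then show ?thesis using psi_zero[OF x] psi_nonneg M'0 by (intro exI[of _ 0]) auto
    next
      case False
      then have \<xi>0: "\<xi> > 0" using \<xi> by simp
      \<comment> \<open>A support line is obtained at interior points of the half-line; hence \<xi>
        = 0 is a separate case, with slope 0.\<close>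
      have "interior {0::real..} = {0<..}" by (simp add: interior_Ici)
      then have "\<xi> \<in> interior {0..}" using \<xi>0 by simp
      from convex_le_Inf_differential[OF psi_convex[OF x] this] obtain s where
        s: "\<And>t. 0 \<le> t \<Longrightarrow> \<psi> x \<xi> + s * (t - \<xi>) \<le> \<psi> x t" by auto
      \<comment> \<open>At t = 0 the line lies below \<psi> x 0 = 0, so its intercept is
        nonpositive; as the value at \<xi> is nonnegative, so is the slope.\<close>
      have s0: "\<psi> x \<xi> - s * \<xi> \<le> 0" using s[of 0] psi_zero[OF x] by simp
      then have "s * \<xi> \<ge> 0" using psi_nonneg[OF x, of \<xi>] \<xi>0 by simp
      then have spos: "s \<ge> 0" using \<xi>0 by (simp add: zero_le_mult_iff)
      show ?thesis
      proof (intro exI[of _ s] conjI spos ballI impI allI)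
        fix y t assume y: "y \<in> \<Omega>" "dist x y < \<gamma>" and t: "(0::real) \<le> t"
        have \<psi>y: "\<psi> y t \<ge> 0" using psi_nonneg[OF y(1) t] .
        show "\<psi> x \<xi> + s * (t - \<xi>) \<le> M' * \<psi> y t + N'"
        proof (cases "t \<le> L")
          case True
          have "\<psi> x \<xi> + s * (t - \<xi>) \<le> \<psi> x t" by (rule s[OF t])
          also have "\<dots> \<le> M * \<psi> y t + N" using MN[OF _ _ x y t] True \<gamma> by (simp add: L_def)
          also have "\<dots> \<le> M' * \<psi> y t + N'" using M'0 \<psi>y by (intro add_mono mult_right_mono) auto
          finally show ?thesis .
        next
          case False
          then have tL: "L < t" by simp
          have "s * (L / 2) \<le> s * (L - \<xi>)" using spos \<xi> by (intro mult_left_mono) (auto simp: L_def)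
          also have "\<dots> \<le> \<psi> x L" using s[of L] psi_nonneg[OF x, of \<xi>] \<xi>0 L by simp
          finally have sL: "s * L \<le> 2 * \<psi> x L" by simp
          \<comment> \<open>Convexity and \<psi> y 0 = 0 make \<psi> y grow at least linearly beyond
            \<open>L\<close>; this takes the place of (Cont) there.\<close>
          have "(t / L) * \<psi> y L \<le> \<psi> y t"
          proof -
            have "\<psi> y ((L / t) * t) \<le> (L / t) * \<psi> y t" using y(1) t tL L by (intro psi_scale) auto
            then have "\<psi> y L \<le> (L / t) * \<psi> y t" using tL L by simp
            then have "(t / L) * \<psi> y L \<le> (t / L) * ((L / t) * \<psi> y t)" using t L by (intro mult_left_mono) auto
            then show ?thesis using tL L by simp
          qed
          then have step: "M * ((t / L) * \<psi> y L) \<le> M * \<psi> y t" using M by (intro mult_left_mono)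
          have "\<psi> x \<xi> + s * (t - \<xi>) \<le> s * t" using s0 by (simp add: algebra_simps)
          also have "\<dots> = (t / L) * (s * L)" using L by simp
          also have "\<dots> \<le> (t / L) * (2 * \<psi> x L)" using sL t L by (intro mult_left_mono) auto
          also have "\<dots> \<le> (t / L) * (2 * (M * \<psi> y L + N))"
            using MN[OF _ _ x y, of L] \<gamma> L t by (intro mult_left_mono) (auto simp: L_def)
          also have "\<dots> = 2 * (M * ((t / L) * \<psi> y L)) + 2 * N * (t / L)" by (simp add: algebra_simps)
          also have "2 * (M * ((t / L) * \<psi> y L)) + 2 * N * (t / L) \<le> 2 * (M * \<psi> y t) + 2 * N * t"
          proof -
            have "t / L \<le> t" using L t by (simp add: divide_le_eq mult_le_cancel_left1)
            then have "2 * N * (t / L) \<le> 2 * N * t" using M by (intro mult_left_mono) auto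
            with step show "2 * (M * ((t / L) * \<psi> y L)) + 2 * N * (t / L) \<le> 2 * (M * \<psi> y t) + 2 * N * t" by linarith
          qed
          also have "\<dots> \<le> 2 * (M * \<psi> y t) + 2 * N * (\<xi>0 + \<psi> y t / C1)"
            using psi_linear_le[OF y(1) t] M by (intro add_left_mono mult_left_mono) auto
          also have "\<dots> \<le> M' * \<psi> y t + N'" using M by (simp add: M'_def N'_def algebra_simps)
          finally show ?thesis .
        qed
      qed
    qed
  qed
qed

end

lemma nn_integral_lebesgue_on_le:
  fixes f :: "'a::euclidean_space \<Rightarrow> ennreal"
  assumes "S \<in> sets lebesgue" shows "(\<integral>\<^sup>+x. f x \<partial>lebesgue_on S) \<le> (\<integral>\<^sup>+x. f x \<partial>lborel)"
proof -
  have "(\<integral>\<^sup>+x. f x \<partial>lebesgue_on S) = (\<integral>\<^sup>+x. f x * indicator S x \<partial>lebesgue)"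
    using assms by (intro nn_integral_restrict_space) auto
  also have "\<dots> \<le> (\<integral>\<^sup>+x. f x \<partial>lebesgue)" by (intro nn_integral_mono) (auto simp: indicator_def)
  finally show ?thesis by (simp add: nn_integral_completion)
qed

context orlicz_integrand
begin

section \<open>Convergence of mollified gradients in the modular\<close>

lemma psi_tendsto_0:
  assumes x: "x \<in> \<Omega>" and s: "\<And>n. s n \<ge> 0" "s \<longlonglongrightarrow> 0"
  shows "(\<lambda>n. \<psi> x (s n)) \<longlonglongrightarrow> 0"
proof -
  have lim: "(\<lambda>n. s n * \<psi> x 1) \<longlonglongrightarrow> 0" using tendsto_mult[OF s(2) tendsto_const, of "\<psi> x 1"] by simp
  have "eventually (\<lambda>n. s n < 1) sequentially" using s(2) by (rule order_tendstoD) simp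
  then have "eventually (\<lambda>n. \<psi> x (s n) \<le> s n * \<psi> x 1) sequentially"
    by eventually_elim (use psi_scale[OF x, of 1] s(1) in auto)
  then show ?thesis
    by (intro tendsto_sandwich[OF _ _ tendsto_const lim]) (use psi_nonneg[OF x] s(1) in auto)
qed

lemma dom_const_integrable: "integrable (lebesgue_on \<Omega>) (\<lambda>x. c :: real)"
proof -
  interpret finite_measure "lebesgue_on \<Omega>" using dom_fin dom_borel
    by (intro finite_measureI) (auto simp: emeasure_restrict_space)
  show ?thesis by simp
qed

lemma space_lebesgue_on_dom: "space (lebesgue_on \<Omega>) = \<Omega>"
  using dom_borel by simp

text \<open>Puts the density of the modular into a form that can be convolved.\<close>

lemma modular_representative:
  fixes G :: "real^'d \<Rightarrow> 'b::euclidean_space"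
  assumes G: "G \<in> borel_measurable borel" and fin: "modular G < \<infinity>"
  obtains g where "g \<in> borel_measurable borel" "\<And>x. x \<notin> \<Omega> \<Longrightarrow> g x = 0"
    "AE x in lborel. x \<in> \<Omega> \<longrightarrow> \<psi> x (norm (G x)) = g x" "integrable lborel g" "integrable (lebesgue_on \<Omega>) g"
proof -
  have m: "(\<lambda>x. \<psi> x (norm (G x))) \<in> borel_measurable (lebesgue_on \<Omega>)"
    by (rule psi_norm_measurable[OF borel_measurable_imp_lebesgue_on[OF G]])
  have int: "integrable (lebesgue_on \<Omega>) (\<lambda>x. \<psi> x (norm (G x)))"
  proof (rule integrableI_nonneg[OF m])
    show "AE x in lebesgue_on \<Omega>. 0 \<le> \<psi> x (norm (G x))"
      by (rule AE_I2) (use psi_nonneg space_lebesgue_on_dom in auto)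
  qed (use fin in \<open>simp add: modular_def\<close>)
  obtain g where g: "g \<in> borel_measurable borel" "\<And>x. x \<notin> \<Omega> \<Longrightarrow> g x = 0" "AE x in lebesgue_on \<Omega>. \<psi> x (norm (G x)) = g x"
    by (rule ex_borel_representative[OF dom_borel m]) (rule that)
  have gi: "integrable (lebesgue_on \<Omega>) g"
    by (rule integrable_cong_AE_imp[OF int borel_measurable_imp_lebesgue_on[OF g(1)] g(3)])
  then have gi2: "integrable lborel g" using integrable_lebesgue_on_zero_outside[OF dom_borel g(1,2)] by simp
  have g3: "AE x in lborel. x \<in> \<Omega> \<longrightarrow> \<psi> x (norm (G x)) = g x"
    using g(3) by (subst (asm) AE_lebesgue_on_iff[OF dom_borel])
  show ?thesis by (rule that[OF g(1) _ g3 gi2 gi]) (rule g(2))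
qed

text \<open>Where the norm is below \<xi>0 the p-th power is bounded, on a set of finite measure;
  elsewhere the lower growth bound in (A4) controls it by the density divided by
  \<open>C1\<close>.\<close>

lemma Lp_of_modular:
  fixes G :: "real^'d \<Rightarrow> 'b::euclidean_space"
  assumes G: "G \<in> borel_measurable borel" and off: "\<And>x. x \<notin> \<Omega> \<Longrightarrow> G x = 0" and fin: "modular G < \<infinity>"
  shows "integrable lborel (\<lambda>x. norm (G x) powr p)"
proof -
  obtain g where g: "g \<in> borel_measurable borel" "\<And>x. x \<notin> \<Omega> \<Longrightarrow> g x = 0"
    "AE x in lborel. x \<in> \<Omega> \<longrightarrow> \<psi> x (norm (G x)) = g x" "integrable lborel g"
    "integrable (lebesgue_on \<Omega>) g"
    by (rule modular_representative[OF G fin]) (rule that)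
  have dom1: "integrable lborel (indicator \<Omega> :: _ \<Rightarrow> real)"
    using dom_fin dom_borel by (intro integrable_real_indicator) (auto simp: emeasure_completion)
  show ?thesis
  proof (rule Bochner_Integration.integrable_bound)
    show "integrable lborel (\<lambda>x. \<xi>0 powr p * indicator \<Omega> x + g x / C1)"
      using g(4) dom1 by auto
    show "(\<lambda>x. norm (G x) powr p) \<in> borel_measurable lborel" using G by measurable
    show "AE x in lborel. norm (norm (G x) powr p) \<le> norm (\<xi>0 powr p * indicator \<Omega> x + g x / C1)"
      using g(3)
    proof eventually_elim
      case (elim x)
      show ?case
      proof (cases "x \<in> \<Omega>")
        case True
        then have gx: "\<psi> x (norm (G x)) = g x" "g x \<ge> 0" using elim psi_nonneg[of x "norm (G x)"] by auto
        have "norm (G x) powr p \<le> \<xi>0 powr p + g x / C1"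
        proof (cases "\<xi>0 \<le> norm (G x)")
          case True
          then have "C1 * norm (G x) powr p \<le> g x" using lower[OF \<open>x \<in> \<Omega>\<close> True] gx by simp
          then have "norm (G x) powr p \<le> g x / C1" using const_bounds by (simp add: field_simps)
          then show ?thesis by (simp add: add_increasing)
        next
          case False
          then have "norm (G x) powr p \<le> \<xi>0 powr p" using const_bounds by (intro powr_mono2) auto
          then show ?thesis using gx const_bounds by (simp add: add_increasing2)
        qed
        then show ?thesis using True gx const_bounds by simp
      next
        case False
        then show ?thesis using off by simp
      qed
    qed
  qed
qed

text \<open>Of the two bounds, the one with the smaller exponent is used, so the result matches the
  range in (Cont) for every ratio of d and p.\<close>

lemma gradient_bound:
  fixes w :: "real^'d \<Rightarrow> real^'n::finite"
  assumes wG: "wgrad w G" and off: "\<And>x. x \<notin> \<Omega> \<Longrightarrow> G x = 0" and K: "\<And>x. norm (w x) \<le> K"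
    and fin: "modular G < \<infinity>"
    and k: "k \<in> Cc_inf UNIV" "\<And>x. k x \<ge> 0" "(\<integral>x. k x \<partial>lborel) = 1"
  obtains C where "C \<ge> 0"
    "\<And>t x. t > 0 \<Longrightarrow> norm (conv (rescale t k) G x) \<le> C * t powr (- min 1 (real CARD('d) / p))"
proof (cases "1 \<le> real CARD('d) / p")
  case True
  then show ?thesis using conv_gradient_bound_of_bounded[OF wG K k(1)] that by (metis min.absorb1)
next
  case False
  have Gi: "integrable lborel G" using wG by (simp add: wgrad_def)
  have "p > 1" using const_bounds by simp
  from conv_bound_of_Lp[OF k Gi Lp_of_modular[OF wgrad_borel(2)[OF wG] off fin] this]
  obtain C where "C \<ge> 0" "\<And>t x. t > 0 \<Longrightarrow> norm (conv (rescale t k) G x) \<le> C * t powr (- (real CARD('d) / p))" by metis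
  moreover have "min 1 (real CARD('d) / p) = real CARD('d) / p" using False by simp
  ultimately show ?thesis using that by simp
qed

text \<open>The support line at the norm of the mollified gradient is integrated against the kernel,
  a probability density. Its slope is nonnegative, so the norm of the average may be replaced by the
  average of the norms.\<close>

lemma mollified_density_bound:
  fixes w :: "real^'d \<Rightarrow> real^'n::finite"
  assumes wG: "wgrad w G" and off: "\<And>x. x \<notin> \<Omega> \<Longrightarrow> G x = 0" and K: "\<And>x. norm (w x) \<le> K"
    and fin: "modular G < \<infinity>"
    and k: "k \<in> Cc_inf UNIV" "\<And>x. k x \<ge> 0" "(\<integral>x. k x \<partial>lborel) = 1" "\<And>x. x \<notin> ball 0 2 \<Longrightarrow> k x = 0"
    and g: "AE x in lborel. x \<in> \<Omega> \<longrightarrow> \<psi> x (norm (G x)) = g x" "integrable lborel g" "\<And>x. x \<notin> \<Omega> \<Longrightarrow> g x = 0"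
  obtains M N where "M \<ge> 0" "N \<ge> 0"
    "\<And>t x. 0 < t \<Longrightarrow> t < 1/4 \<Longrightarrow> x \<in> \<Omega> \<Longrightarrow> \<psi> x (norm (conv (rescale t k) G x)) \<le> M * conv (rescale t k) g x + N"
proof -
  define \<mu> where "\<mu> = min 1 (real CARD('d) / p)"
  have \<mu>: "0 \<le> \<mu>" "\<mu> \<le> 1" using const_bounds by (auto simp: \<mu>_def)
  have Gi: "integrable lborel G" using wG by (simp add: wgrad_def)
  obtain C where C: "C \<ge> 0" "\<And>t x. t > 0 \<Longrightarrow> norm (conv (rescale t k) G x) \<le> C * t powr (- \<mu>)"
    using gradient_bound[OF wG off K fin k(1-3)] unfolding \<mu>_def by metis
  \<comment> \<open>One factor 2 meets the condition on 2 \<xi> in the support line, the other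
    converts \<open>t\<close> into the radius 2 t; the maximum ensures D > 1.\<close>
  define D where "D = max 2 (4 * C)"
  have D: "D > 1" "4 * C \<le> D" by (auto simp: D_def)
  obtain M N where M: "M \<ge> 0" "N \<ge> 0" and MN: "\<And>\<gamma> x \<xi>. 0 < \<gamma> \<Longrightarrow> \<gamma> < 1/2 \<Longrightarrow> x \<in> \<Omega> \<Longrightarrow> 0 \<le> \<xi> \<Longrightarrow> 2 * \<xi> \<le> D * \<gamma> powr (- \<mu>) \<Longrightarrow>
      \<exists>s\<ge>0. \<forall>y\<in>\<Omega>. dist x y < \<gamma> \<longrightarrow> (\<forall>t\<ge>0. \<psi> x \<xi> + s * (t - \<xi>) \<le> M * \<psi> y t + N)"
    using support_line[OF D(1)] unfolding \<mu>_def by (metis greaterThanLessThan_iff)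
  show ?thesis
  proof (rule that[OF M])
    fix t :: real and x assume t: "0 < t" "t < 1/4" and x: "x \<in> \<Omega>"
    define \<xi> where "\<xi> = norm (conv (rescale t k) G x)"
    \<comment> \<open>The kernel lives in the ball of radius 2, hence after dilation it sees only
      points within distance 2 t of \<open>x\<close>.\<close>
    define \<gamma> where "\<gamma> = 2 * t"
    have \<gamma>: "0 < \<gamma>" "\<gamma> < 1/2" using t by (auto simp: \<gamma>_def)
    have "2 powr (- 1) \<le> 2 powr (- \<mu>)" using \<mu> by (intro powr_mono) auto
    then have "1/2 * t powr (- \<mu>) \<le> 2 powr (- \<mu>) * t powr (- \<mu>)" by (intro mult_right_mono) (auto simp: powr_minus_divide)
    also have "\<dots> = \<gamma> powr (- \<mu>)" unfolding \<gamma>_def using t by (subst powr_mult) auto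
    finally have "t powr (- \<mu>) \<le> 2 * \<gamma> powr (- \<mu>)" by simp
    then have "C * t powr (- \<mu>) \<le> C * (2 * \<gamma> powr (- \<mu>))" using C by (intro mult_left_mono)
    then have "2 * \<xi> \<le> (4 * C) * \<gamma> powr (- \<mu>)" using C(2)[OF t(1), of x] by (simp add: \<xi>_def)
    also have "\<dots> \<le> D * \<gamma> powr (- \<mu>)" using D by (intro mult_right_mono) auto
    finally obtain s where s: "s \<ge> 0" "\<And>y t. y \<in> \<Omega> \<Longrightarrow> dist x y < \<gamma> \<Longrightarrow> t \<ge> 0 \<Longrightarrow> \<psi> x \<xi> + s * (t - \<xi>) \<le> M * \<psi> y t + N"
      using MN[OF \<gamma> x] by (metis \<xi>_def norm_ge_zero)
    define k' where "k' y = rescale t k (x - y)" for y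
    note kt = rescale_Cc_inf[OF k(1) t(1)]
    have k'0: "k' y \<ge> 0" for y unfolding k'_def by (rule rescale_nonneg[of k, OF k(2) t(1)])
    have k'i: "integrable lborel k'" unfolding k'_def by (rule integrable_kernel[OF k(1) t(1)])
    have k'1: "(\<integral>y. k' y \<partial>lborel) = 1" unfolding k'_def using integral_kernel[OF k(1) t(1)] k(3) by simp
    have kG: "\<xi> \<le> (\<integral>y. k' y * norm (G y) \<partial>lborel)" "integrable lborel (\<lambda>y. k' y * norm (G y))"
      unfolding \<xi>_def k'_def by (rule norm_conv_le_integral[OF kt _ Gi]; use rescale_nonneg[of k, OF k(2) t(1)] in simp)+
    have kg: "integrable lborel (\<lambda>y. k' y * g y)" unfolding k'_def using integrable_conv[OF kt g(2), of x] by simp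
    have "\<psi> x \<xi> \<le> \<psi> x \<xi> + s * ((\<integral>y. k' y * norm (G y) \<partial>lborel) - \<xi>)" using s(1) kG(1) by simp
    also have "\<dots> = (\<integral>y. (\<psi> x \<xi> - s * \<xi>) * k' y + s * (k' y * norm (G y)) \<partial>lborel)"
      using k'i kG(2) k'1 by (simp add: algebra_simps)
    also have "\<dots> \<le> (\<integral>y. M * (k' y * g y) + N * k' y \<partial>lborel)"
    proof (rule integral_mono_AE)
      show "integrable lborel (\<lambda>y. (\<psi> x \<xi> - s * \<xi>) * k' y + s * (k' y * norm (G y)))" using k'i kG(2) by simp
      show "integrable lborel (\<lambda>y. M * (k' y * g y) + N * k' y)" using k'i kg by simp
      show "AE y in lborel. (\<psi> x \<xi> - s * \<xi>) * k' y + s * (k' y * norm (G y)) \<le> M * (k' y * g y) + N * k' y"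
        using g(1)
      proof eventually_elim
        case (elim y)
        show ?case
        proof (cases "k' y = 0")
          case False
          have xy: "dist x y < \<gamma>"
          proof (rule ccontr)
            assume "\<not> dist x y < \<gamma>"
            then have "x - y \<notin> ball 0 (t * 2)" by (simp add: \<gamma>_def dist_norm norm_minus_commute mult.commute)
            then have "k' y = 0" unfolding k'_def using k(4) t(1) rescale_eq_0[of 2 k t "x - y"] by blast
            with False show False by simp
          qed
          have "\<psi> x \<xi> + s * (norm (G y) - \<xi>) \<le> M * g y + N"
          proof (cases "y \<in> \<Omega>")
            case True
            then show ?thesis using s(2)[OF True xy, of "norm (G y)"] elim by simp
          next
            case False
            \<comment> \<open>Outside the domain \<open>G\<close> and \<open>g\<close> vanish; what
              remains is the support line at y = x and t = 0, where \<psi> is 0.\<close>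
            then show ?thesis using s(2)[OF x, of 0] \<gamma> psi_zero[OF x] off g(3) by simp
          qed
          then have "k' y * (\<psi> x \<xi> + s * (norm (G y) - \<xi>)) \<le> k' y * (M * g y + N)" using k'0 by (intro mult_left_mono)
          then show ?thesis by (simp add: algebra_simps)
        qed simp
      qed
    qed
    also have "\<dots> = M * (\<integral>y. k' y * g y \<partial>lborel) + N" using kg k'i k'1 by simp
    also have "(\<integral>y. k' y * g y \<partial>lborel) = conv (rescale t k) g x" by (simp add: conv_def k'_def)
    finally show "\<psi> x (norm (conv (rescale t k) G x)) \<le> M * conv (rescale t k) g x + N" by (simp add: \<xi>_def)
  qed
qed

text \<open>The bound on the integrand varies with n but converges in L1. The integrand
  \<open>h n\<close> is therefore split into an error \<open>b n\<close>, which tends to 0 in L1,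
  and \<open>min (h n x) (a x)\<close>, to which dominated convergence applies.\<close>

lemma mollify_modular:
  fixes w :: "real^'d \<Rightarrow> real^'n::finite"
  assumes wG: "wgrad w G" and off: "\<And>x. x \<notin> \<Omega> \<Longrightarrow> G x = 0" and K: "\<And>x. norm (w x) \<le> K"
    and fin: "modular G < \<infinity>"
    and k: "k \<in> Cc_inf UNIV" "\<And>x. k x \<ge> 0" "(\<integral>x. k x \<partial>lborel) = 1" "\<And>x. x \<notin> ball 0 2 \<Longrightarrow> k x = 0"
    and t0: "t0 > 0" and e: "e > (0::real)"
  shows "\<exists>t>0. t < t0 \<and> (\<integral>\<^sup>+x. norm (conv (rescale t k) w x - w x) \<partial>lborel) < e \<and>
     modular (\<lambda>x. grad (conv (rescale t k) w) x - G x) < e"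
proof -
  have wi: "integrable lborel w" and Gi: "integrable lborel G" using wG by (auto simp: wgrad_def)
  note Gm = wgrad_borel(2)[OF wG]
  obtain g where g: "g \<in> borel_measurable borel" "\<And>x. x \<notin> \<Omega> \<Longrightarrow> g x = 0"
    "AE x in lborel. x \<in> \<Omega> \<longrightarrow> \<psi> x (norm (G x)) = g x" "integrable lborel g" "integrable (lebesgue_on \<Omega>) g"
    by (rule modular_representative[OF Gm fin]) (rule that)
  obtain M N where M: "M \<ge> 0" "N \<ge> 0"
    "\<And>t x. 0 < t \<Longrightarrow> t < 1/4 \<Longrightarrow> x \<in> \<Omega> \<Longrightarrow> \<psi> x (norm (conv (rescale t k) G x)) \<le> M * conv (rescale t k) g x + N"
    using mollified_density_bound[OF wG off K fin k g(3,4,2)] by metis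
  \<comment> \<open>The factor 1 / (n + 2) is strictly below 1 and yields strict bounds by
    \<open>t0\<close>, for the shift of the support, and by 1/4, for the density bound.\<close>
  define T where "T n = min t0 (1/4) * (1 / real (Suc (Suc n)))" for n
  have T: "T n > 0" "T n < t0" "T n < 1/4" for n
  proof -
    show "T n > 0" using t0 by (simp add: T_def)
    have "T n < min t0 (1/4) * 1" unfolding T_def using t0 by (intro mult_strict_left_mono) auto
    then show "T n < t0" "T n < 1/4" by auto
  qed
  have T0: "T \<longlonglongrightarrow> 0"
    unfolding T_def using tendsto_mult_left[OF LIMSEQ_Suc[OF LIMSEQ_inverse_real_of_nat], of "min t0 (1/4)"]
    by (simp add: inverse_eq_divide)
  obtain r where r: "strict_mono r" "AE x in lborel. (\<lambda>n. conv (rescale (T (r n)) k) G x) \<longlonglongrightarrow> G x"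
    using conv_rescale_AE_subseq[OF k(1-3) Gi T(1) T0] by blast
  define t where "t n = T (r n)" for n
  have t: "t n > 0" "t n < t0" "t n < 1/4" for n using T by (auto simp: t_def)
  have tlim: "t \<longlonglongrightarrow> 0" unfolding t_def using LIMSEQ_subseq_LIMSEQ[OF T0 r(1)] by (simp add: o_def)
  note kt = rescale_Cc_inf[OF k(1) t(1)]
  define H where "H n = conv (rescale (t n) k) G" for n
  have Hg: "grad (conv (rescale (t n) k) w) = H n" for n unfolding H_def by (rule grad_conv[OF wG kt])
  have Hm: "H n \<in> borel_measurable borel" for n unfolding H_def by (rule conv_borel_measurable[OF kt Gi])
  have cgm: "conv (rescale (t n) k) g \<in> borel_measurable borel" for n by (rule conv_borel_measurable[OF kt g(4)])
  define h where "h n x = \<psi> x (norm (H n x - G x))" for n x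
  \<comment> \<open>\<open>a\<close> is the bound from quasi-subadditivity with the mollified
    density replaced by \<open>g\<close>, and \<open>b n\<close> is the cost of that
    replacement.\<close>
  define a where "a x = C4 * ((1 + M) * g x + N)" for x
  define b where "b n x = C4 * M * \<bar>conv (rescale (t n) k) g x - g x\<bar>" for n x
  have C4: "C4 \<ge> 0" using const_bounds by simp
  have hm[measurable]: "h n \<in> borel_measurable (lebesgue_on \<Omega>)" for n
    unfolding h_def using Hm Gm by (intro psi_norm_measurable borel_measurable_imp_lebesgue_on) auto
  have am[measurable]: "a \<in> borel_measurable (lebesgue_on \<Omega>)"
    unfolding a_def using g(1) by (intro borel_measurable_imp_lebesgue_on) auto
  have bm[measurable]: "b n \<in> borel_measurable (lebesgue_on \<Omega>)" for n
    unfolding b_def using g(1) cgm by (intro borel_measurable_imp_lebesgue_on) auto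
  have b0: "b n x \<ge> 0" for n x unfolding b_def using M C4 by simp
  have hab: "AE x in lebesgue_on \<Omega>. h n x \<le> b n x + min (h n x) (a x)" for n
    unfolding AE_lebesgue_on_iff[OF dom_borel] using g(3)
  proof eventually_elim
    case (elim x)
    show ?case
    proof
      assume x: "x \<in> \<Omega>"
      have "h n x \<le> C4 * (\<psi> x (norm (H n x)) + \<psi> x (norm (G x)))" unfolding h_def by (rule psi_norm_diff[OF x])
      also have "\<dots> \<le> C4 * ((M * conv (rescale (t n) k) g x + N) + g x)"
        using M(3)[OF t(1,3) x, of n] elim x C4 by (intro mult_left_mono add_mono) (auto simp: H_def)
      also have "\<dots> \<le> C4 * ((M * (g x + \<bar>conv (rescale (t n) k) g x - g x\<bar>) + N) + g x)"
        using M C4 by (intro mult_left_mono add_mono) auto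
      also have "\<dots> = a x + b n x" by (simp add: a_def b_def algebra_simps)
      finally show "h n x \<le> b n x + min (h n x) (a x)" using b0[of n x] by (simp add: min_def)
    qed
  qed
  have modle: "modular (\<lambda>x. grad (conv (rescale (t n) k) w) x - G x)
      \<le> (\<integral>\<^sup>+x. ennreal (b n x) \<partial>lborel) + (\<integral>\<^sup>+x. ennreal (min (h n x) (a x)) \<partial>lebesgue_on \<Omega>)" for n
  proof -
    have "modular (\<lambda>x. grad (conv (rescale (t n) k) w) x - G x) = (\<integral>\<^sup>+x. ennreal (h n x) \<partial>lebesgue_on \<Omega>)"
      unfolding modular_def Hg h_def ..
    also have "\<dots> \<le> (\<integral>\<^sup>+x. ennreal (b n x) + ennreal (min (h n x) (a x)) \<partial>lebesgue_on \<Omega>)"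
    proof (rule nn_integral_mono_AE, use hab[of n] in eventually_elim)
      fix x assume le: "h n x \<le> b n x + min (h n x) (a x)"
      have "ennreal (h n x) \<le> ennreal (b n x + min (h n x) (a x))" using le by (rule ennreal_leI)
      also have "\<dots> \<le> ennreal (b n x) + ennreal (min (h n x) (a x))"
        by (metis add.right_neutral b0 ennreal_neg ennreal_plus linorder_le_cases order_refl ennreal_leI add_le_same_cancel1)
      finally show "ennreal (h n x) \<le> ennreal (b n x) + ennreal (min (h n x) (a x))" .
    qed
    also have "\<dots> = (\<integral>\<^sup>+x. ennreal (b n x) \<partial>lebesgue_on \<Omega>) + (\<integral>\<^sup>+x. ennreal (min (h n x) (a x)) \<partial>lebesgue_on \<Omega>)"
      by (rule nn_integral_add) measurable
    also have "\<dots> \<le> (\<integral>\<^sup>+x. ennreal (b n x) \<partial>lborel) + (\<integral>\<^sup>+x. ennreal (min (h n x) (a x)) \<partial>lebesgue_on \<Omega>)"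
      using dom_borel by (intro add_right_mono nn_integral_lebesgue_on_le) auto
    finally show ?thesis .
  qed
  have "(\<lambda>n. ennreal (C4 * M) * (\<integral>\<^sup>+x. norm (conv (rescale (t n) k) g x - g x) \<partial>lborel)) \<longlonglongrightarrow> ennreal (C4 * M) * 0"
    by (intro ennreal_tendsto_cmult conv_rescale_tendsto_L1[OF k(1-3) g(4) t(1) tlim]) auto
  moreover have "(\<integral>\<^sup>+x. ennreal (b n x) \<partial>lborel) = ennreal (C4 * M) * (\<integral>\<^sup>+x. norm (conv (rescale (t n) k) g x - g x) \<partial>lborel)" for n
    using g(1) cgm C4 M by (subst nn_integral_cmult[symmetric]) (auto simp: b_def ennreal_mult)
  ultimately have blim: "(\<lambda>n. \<integral>\<^sup>+x. ennreal (b n x) \<partial>lborel) \<longlonglongrightarrow> 0" by simp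
  have mlim: "(\<lambda>n. \<integral>\<^sup>+x. ennreal (min (h n x) (a x)) \<partial>lebesgue_on \<Omega>) \<longlonglongrightarrow> (\<integral>\<^sup>+x. 0 \<partial>lebesgue_on \<Omega>)"
  proof (rule nn_integral_dominated_convergence[where w = "\<lambda>x. ennreal (a x)"])
    have "integrable (lebesgue_on \<Omega>) a" unfolding a_def using g(5) dom_const_integrable by auto
    then have "(\<integral>\<^sup>+x. norm (a x) \<partial>lebesgue_on \<Omega>) < \<infinity>" by (simp add: integrable_iff_bounded)
    moreover have "(\<integral>\<^sup>+x. ennreal (a x) \<partial>lebesgue_on \<Omega>) \<le> (\<integral>\<^sup>+x. norm (a x) \<partial>lebesgue_on \<Omega>)"
      by (intro nn_integral_mono ennreal_leI) auto
    ultimately show "(\<integral>\<^sup>+x. ennreal (a x) \<partial>lebesgue_on \<Omega>) < \<infinity>" by (rule le_less_trans[rotated])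
    show "AE x in lebesgue_on \<Omega>. (\<lambda>n. ennreal (min (h n x) (a x))) \<longlonglongrightarrow> 0"
      unfolding AE_lebesgue_on_iff[OF dom_borel] using r(2) g(3)
    proof eventually_elim
      case (elim x)
      show ?case
      proof
        assume x: "x \<in> \<Omega>"
        have "(\<lambda>n. H n x) \<longlonglongrightarrow> G x" using elim by (simp add: H_def t_def)
        then have "(\<lambda>n. norm (H n x - G x)) \<longlonglongrightarrow> 0" by (simp add: LIM_zero tendsto_norm_zero)
        then have "(\<lambda>n. h n x) \<longlonglongrightarrow> 0" unfolding h_def by (intro psi_tendsto_0[OF x]) auto
        moreover have "a x \<ge> 0"
          unfolding a_def using elim x psi_nonneg[OF x, of "norm (G x)"] M C4 by auto
        ultimately have "(\<lambda>n. min (h n x) (a x)) \<longlonglongrightarrow> 0"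
          using tendsto_min[of "\<lambda>n. h n x" 0 sequentially "\<lambda>n. a x" "a x"] by simp
        then show "(\<lambda>n. ennreal (min (h n x) (a x))) \<longlonglongrightarrow> 0" by (metis tendsto_ennrealI ennreal_0)
      qed
    qed
  qed (auto intro!: ennreal_leI)
  have "(\<lambda>n. (\<integral>\<^sup>+x. ennreal (b n x) \<partial>lborel) + (\<integral>\<^sup>+x. ennreal (min (h n x) (a x)) \<partial>lebesgue_on \<Omega>)) \<longlonglongrightarrow> 0"
    using tendsto_add[OF blim mlim] by simp
  then have "eventually (\<lambda>n. (\<integral>\<^sup>+x. ennreal (b n x) \<partial>lborel) + (\<integral>\<^sup>+x. ennreal (min (h n x) (a x)) \<partial>lebesgue_on \<Omega>) < ennreal e) sequentially"
    using e by (intro order_tendstoD) auto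
  moreover have "eventually (\<lambda>n. (\<integral>\<^sup>+x. norm (conv (rescale (t n) k) w x - w x) \<partial>lborel) < ennreal e) sequentially"
    using conv_rescale_tendsto_L1[OF k(1-3) wi t(1) tlim] e by (intro order_tendstoD) auto
  ultimately have "eventually (\<lambda>n. (\<integral>\<^sup>+x. norm (conv (rescale (t n) k) w x - w x) \<partial>lborel) < ennreal e \<and>
      modular (\<lambda>x. grad (conv (rescale (t n) k) w) x - G x) < ennreal e) sequentially"
    by eventually_elim (use modle in \<open>auto intro: le_less_trans\<close>)
  then obtain n where "(\<integral>\<^sup>+x. norm (conv (rescale (t n) k) w x - w x) \<partial>lborel) < ennreal e"
      "modular (\<lambda>x. grad (conv (rescale (t n) k) w) x - G x) < ennreal e"
    by (auto simp: eventually_sequentially)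
  then show ?thesis using t by blast
qed

end

section \<open>Approximation up to the boundary\<close>

text \<open>The difference quotient of arctan at 0, along the sequence s / (n + 1), tends to
  1.\<close>

lemma arctan_scaled_tendsto: "(\<lambda>n. real (Suc n) * arctan (s / real (Suc n))) \<longlonglongrightarrow> s"
proof (cases "s = 0")
  case False
  have "((\<lambda>h. arctan h / h) \<longlongrightarrow> 1) (at 0)"
    using DERIV_arctan[of 0] by (simp add: DERIV_def)
  moreover have "filterlim (\<lambda>n. s / real (Suc n)) (at 0) sequentially"
    using tendsto_mult_left[OF LIMSEQ_inverse_real_of_nat, of s] False
    by (intro filterlim_atI) (simp_all add: divide_inverse)
  ultimately have "(\<lambda>n. arctan (s / real (Suc n)) / (s / real (Suc n))) \<longlonglongrightarrow> 1"
    by (rule filterlim_compose)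
  then have "(\<lambda>n. s * (arctan (s / real (Suc n)) / (s / real (Suc n)))) \<longlonglongrightarrow> s * 1"
    by (intro tendsto_mult tendsto_const)
  moreover have "s * (arctan (s / real (Suc n)) / (s / real (Suc n))) = real (Suc n) * arctan (s / real (Suc n))" for n
    using False by (simp add: field_simps)
  ultimately show ?thesis by simp
qed simp

lemma trunc_tendsto: "(\<lambda>n. trunc (real (Suc n)) v) \<longlonglongrightarrow> v"
  unfolding trunc_def by (rule vec_tendstoI) (simp add: arctan_scaled_tendsto del: of_nat_Suc)

lemma trunc_grad_tendsto: "(\<lambda>n. trunc_grad (real (Suc n)) v A) \<longlonglongrightarrow> A"
  unfolding trunc_grad_def
proof (intro vec_tendstoI, simp del: of_nat_Suc)
  fix i j
  have "(\<lambda>n. v $ i / real (Suc n)) \<longlonglongrightarrow> 0"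
    using tendsto_mult_left[OF LIMSEQ_inverse_real_of_nat, of "v $ i"] by (simp add: divide_inverse)
  then have "(\<lambda>n. A $ i $ j / (1 + (v $ i / real (Suc n))\<^sup>2)) \<longlonglongrightarrow> A $ i $ j / (1 + 0\<^sup>2)"
    by (intro tendsto_intros) auto
  then show "(\<lambda>n. A $ i $ j / (1 + (v $ i / real (Suc n))\<^sup>2)) \<longlonglongrightarrow> A $ i $ j" by simp
qed

lemma grad_add:
  "f differentiable_on UNIV \<Longrightarrow> g differentiable_on UNIV \<Longrightarrow> grad (\<lambda>x. f x + g x) = (\<lambda>x. grad f x + grad g x)"
  by (auto simp: fun_eq_iff grad_def vec_eq_iff partial_deriv_add)

text \<open>Translating by \<open>t e\<close> moves the part of \<open>S\<close> near \<open>x0\<close> into \<open>S\<close>, at distance at least \<open>c t\<close> from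
  the complement.\<close>

definition inward_at :: "'a::euclidean_space set \<Rightarrow> 'a \<Rightarrow> real \<Rightarrow> bool" where
  "inward_at S x0 r \<longleftrightarrow> (\<exists>e c t1. norm e \<le> 1 \<and> 0 < c \<and> c \<le> 1 \<and> 0 < t1 \<and>
     (\<forall>t y. 0 < t \<and> t < t1 \<and> y \<in> S \<and> y \<in> ball x0 r \<longrightarrow> ball (y + t *\<^sub>R e) (c * t) \<subseteq> S))"

section \<open>Inward directions on a Lipschitz domain\<close>

text \<open>Inside the domain no shift is made: the direction 0 is allowed, which is why
  \<open>inward_at\<close> asks for norm at most 1. The doubled radius leaves room for balls of
  radius t < r.\<close>

lemma inward_at_interior:
  assumes "ball x0 (2 * r) \<subseteq> S" "r > 0" shows "inward_at S x0 r"
  unfolding inward_at_def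
proof (rule exI[of _ 0], rule exI[of _ 1], rule exI[of _ r], intro conjI allI impI)
  fix t y assume *: "0 < t \<and> t < r \<and> y \<in> S \<and> y \<in> ball x0 r"
  show "ball (y + t *\<^sub>R 0) (1 * t) \<subseteq> S"
  proof
    fix z assume "z \<in> ball (y + t *\<^sub>R 0) (1 * t)"
    then have "z \<in> ball x0 (2 * r)" using * dist_triangle[of x0 z y] by simp
    then show "z \<in> S" using assms by blast
  qed
qed (use assms in auto)

text \<open>Moving by t along the graph direction raises the height by t; a perturbation of size at
  most c t lowers it by at most c t and raises the graph by at most L c t. With c = 1 / (1 + L)
  these losses add up to t.\<close>

lemma inward_at_frontier:
  fixes S :: "'a::euclidean_space set"
  assumes "lipschitz_boundary S" "x0 \<in> frontier S"
  obtains r where "r > 0" "inward_at S x0 r"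
proof -
  obtain R e g L where R: "R > 0" and e: "norm e = 1" and g: "L-lipschitz_on {v. v \<bullet> e = 0} g"
    and S: "S \<inter> ball x0 R = {y \<in> ball x0 R. g (y - (y \<bullet> e) *\<^sub>R e) < y \<bullet> e}"
    using assms by (auto simp: lipschitz_boundary_def)
  have L: "L \<ge> 0" using g by (rule lipschitz_on_nonneg)
  have ee: "e \<bullet> e = 1" using e by (simp add: dot_square_norm)
  define c where "c = 1 / (1 + L)"
  have c: "0 < c" "c \<le> 1" "L * c + c = 1" using L by (auto simp: c_def field_simps)
  \<comment> \<open>The orthogonal projection onto the hyperplane on which \<open>g\<close> is
    defined; it does not increase norms.\<close>
  define P where "P y = y - (y \<bullet> e) *\<^sub>R e" for y
  have P: "P y \<bullet> e = 0" for y by (simp add: P_def inner_diff_left ee)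
  have Pnorm: "norm (P v) \<le> norm v" for v
  proof -
    have "(norm (P v))\<^sup>2 = (norm v)\<^sup>2 - (v \<bullet> e)\<^sup>2"
      unfolding P_def power2_norm_eq_inner by (simp add: inner_diff_left inner_diff_right ee inner_commute power2_eq_square)
    then have "(norm (P v))\<^sup>2 \<le> (norm v)\<^sup>2" by simp
    then show ?thesis by (rule power2_le_imp_le) simp
  qed
  have "inward_at S x0 (R / 2)"
    unfolding inward_at_def
  proof (rule exI[of _ e], rule exI[of _ c], rule exI[of _ "R / 4"], intro conjI allI impI subsetI)
    fix t y z assume *: "0 < t \<and> t < R / 4 \<and> y \<in> S \<and> y \<in> ball x0 (R / 2)" and z: "z \<in> ball (y + t *\<^sub>R e) (c * t)"
    define v where "v = z - (y + t *\<^sub>R e)"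
    have v: "norm v < c * t" using z by (simp add: v_def dist_norm norm_minus_commute)
    have zy: "z = y + t *\<^sub>R e + v" by (simp add: v_def)
    have ct: "c * t \<le> t" using c * by (simp add: mult_left_le_one_le)
    have "z - y = t *\<^sub>R e + v" by (simp add: zy)
    moreover have "dist y z = norm (z - y)" by (simp add: dist_norm norm_minus_commute)
    ultimately have "dist y z \<le> norm (t *\<^sub>R e) + norm v"
      using norm_triangle_ineq[of "t *\<^sub>R e" v] by (simp only:)
    \<comment> \<open>The total displacement is below 2 t, and t < R / 4 keeps \<open>z\<close> in
      the ball where the graph description holds.\<close>
    also have "\<dots> < R / 2" using * v ct e by (simp, linarith)
    finally have zR: "z \<in> ball x0 R" using * dist_triangle[of x0 z y] by simp
    have yR: "y \<in> S \<inter> ball x0 R" using * R by simp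
    then have gy: "g (P y) < y \<bullet> e" unfolding S P_def by simp
    have Pz: "P z = P y + P v" by (simp add: zy P_def inner_add_left ee algebra_simps)
    have "dist (g (P z)) (g (P y)) \<le> L * dist (P z) (P y)"
      by (rule lipschitz_onD[OF g]) (simp_all add: P)
    then have "g (P z) \<le> g (P y) + L * norm (P v)" by (simp add: Pz dist_norm)
    also have "\<dots> \<le> g (P y) + L * (c * t)"
      using order.trans[OF Pnorm less_imp_le[OF v]] L by (intro add_left_mono mult_left_mono)
    also have "\<dots> < y \<bullet> e + L * (c * t)" using gy by simp
    also have "\<dots> = y \<bullet> e + t - c * t" using c(3) by (metis add_diff_cancel_right' add_diff_eq distrib_right mult.assoc mult_1)
    also have "\<dots> \<le> z \<bullet> e"
    proof -
      have "\<bar>v \<bullet> e\<bar> \<le> norm v" using Cauchy_Schwarz_ineq2[of v e] e by simp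
      then have "- (c * t) \<le> v \<bullet> e" using v by linarith
      then show ?thesis by (simp add: zy inner_add_left ee)
    qed
    finally have "z \<in> S \<inter> ball x0 R" unfolding S using zR by (simp add: P_def)
    then show "z \<in> S" by simp
  qed (use e c R in auto)
  then show ?thesis using R that[of "R / 2"] by simp
qed

lemma inward_at_closure:
  assumes "open S" "lipschitz_boundary S" "x0 \<in> closure S"
  obtains r where "r > 0" "inward_at S x0 r"
proof (cases "x0 \<in> S")
  case True
  then obtain R where "R > 0" "ball x0 R \<subseteq> S" using assms(1) open_contains_ball by blast
  then have "inward_at S x0 (R / 2)" by (intro inward_at_interior) auto
  then show ?thesis using that[of "R / 2"] \<open>R > 0\<close> by simp
next
  case False
  then have "x0 \<in> frontier S" using assms by (simp add: frontier_def interior_open)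
  then show ?thesis using inward_at_frontier[OF assms(2)] that by blast
qed

context orlicz_integrand
begin

section \<open>The modular and approximation by test functions\<close>

lemma modular_cong_AE: "AE x in lebesgue_on \<Omega>. f x = g x \<Longrightarrow> modular f = modular g"
  unfolding modular_def by (rule nn_integral_cong_AE) (auto elim: eventually_mono)

lemma modular_mono_norm:
  "(\<And>x. x \<in> \<Omega> \<Longrightarrow> norm (f x) \<le> norm (g x)) \<Longrightarrow> modular f \<le> modular g"
  unfolding modular_def by (intro nn_integral_mono ennreal_leI psi_mono) (use space_lebesgue_on_dom in auto)

lemma modular_add:
  fixes f g :: "real^'d \<Rightarrow> 'b::euclidean_space"
  assumes f: "f \<in> borel_measurable (lebesgue_on \<Omega>)" and g: "g \<in> borel_measurable (lebesgue_on \<Omega>)"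
  shows "modular (\<lambda>x. f x + g x) \<le> ennreal C4 * (modular f + modular g)"
proof -
  note [measurable] = psi_norm_measurable[OF f] psi_norm_measurable[OF g]
  have "modular (\<lambda>x. f x + g x) \<le> (\<integral>\<^sup>+x. ennreal C4 * (ennreal (\<psi> x (norm (f x))) + ennreal (\<psi> x (norm (g x)))) \<partial>lebesgue_on \<Omega>)"
    unfolding modular_def
  proof (rule nn_integral_mono)
    fix x assume "x \<in> space (lebesgue_on \<Omega>)"
    then have x: "x \<in> \<Omega>" using space_lebesgue_on_dom by simp
    have "ennreal (\<psi> x (norm (f x + g x))) \<le> ennreal (C4 * (\<psi> x (norm (f x)) + \<psi> x (norm (g x))))"
      by (rule ennreal_leI[OF psi_norm_add[OF x]])
    also have "\<dots> = ennreal C4 * (ennreal (\<psi> x (norm (f x))) + ennreal (\<psi> x (norm (g x))))"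
      using const_bounds psi_nonneg[OF x] by (simp add: ennreal_mult)
    finally show "ennreal (\<psi> x (norm (f x + g x))) \<le> ennreal C4 * (ennreal (\<psi> x (norm (f x))) + ennreal (\<psi> x (norm (g x))))" .
  qed
  also have "\<dots> = ennreal C4 * (\<integral>\<^sup>+x. ennreal (\<psi> x (norm (f x))) + ennreal (\<psi> x (norm (g x))) \<partial>lebesgue_on \<Omega>)"
    by (rule nn_integral_cmult) measurable
  also have "(\<integral>\<^sup>+x. ennreal (\<psi> x (norm (f x))) + ennreal (\<psi> x (norm (g x))) \<partial>lebesgue_on \<Omega>) = modular f + modular g"
    unfolding modular_def by (rule nn_integral_add) measurable
  finally show ?thesis .
qed

lemma modular_uminus: "modular (\<lambda>x. - f x) = modular f"
  by (simp add: modular_def)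

lemma modular_diff:
  fixes f g :: "real^'d \<Rightarrow> 'b::euclidean_space"
  assumes f: "f \<in> borel_measurable (lebesgue_on \<Omega>)" and g: "g \<in> borel_measurable (lebesgue_on \<Omega>)"
  shows "modular (\<lambda>x. f x - g x) \<le> ennreal C4 * (modular f + modular g)"
  using modular_add[OF f borel_measurable_uminus[OF g]] by (simp add: modular_uminus)

lemma modular_bounded:
  fixes f :: "real^'d \<Rightarrow> 'b::euclidean_space"
  assumes "\<And>x. x \<in> \<Omega> \<Longrightarrow> norm (f x) \<le> B" shows "modular f < \<infinity>"
proof -
  define c where "c = C2 * (1 + (max B 0) powr q)"
  have "modular f \<le> (\<integral>\<^sup>+x. ennreal c \<partial>lebesgue_on \<Omega>)"
    unfolding modular_def
  proof (intro nn_integral_mono ennreal_leI)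
    fix x assume "x \<in> space (lebesgue_on \<Omega>)"
    then have x: "x \<in> \<Omega>" using space_lebesgue_on_dom by simp
    have "\<psi> x (norm (f x)) \<le> C2 * (1 + norm (f x) powr q)" by (rule upper[OF x]) simp
    also have "\<dots> \<le> c" unfolding c_def using const_bounds assms[OF x] by (intro mult_left_mono add_left_mono powr_mono2) auto
    finally show "\<psi> x (norm (f x)) \<le> c" .
  qed
  also have "\<dots> = ennreal c * emeasure lebesgue \<Omega>" using dom_borel by (simp add: emeasure_restrict_space)
  also have "\<dots> < \<infinity>" using dom_fin by (simp add: ennreal_mult_less_top)
  finally show ?thesis .
qed

text \<open>Dominated convergence as \<open>K\<close> grows. The entries removed from the gradient
  by truncation are at most those of \<open>G\<close>, so the density of \<open>modular G\<close>
  itself is a majorant.\<close>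

lemma trunc_modular:
  fixes v :: "real^'d \<Rightarrow> real^'n::finite"
  assumes vG: "wgrad v G" and fin: "modular G < \<infinity>" and e: "e > (0::real)"
  shows "\<exists>K>0. (\<integral>\<^sup>+x. norm (trunc K (v x) - v x) \<partial>lborel) < e \<and> modular (\<lambda>x. trunc_grad K (v x) (G x) - G x) < e"
proof -
  define K where "K n = real (Suc n)" for n
  have K: "K n > 0" for n by (simp add: K_def)
  have vi: "integrable lborel v" using vG by (simp add: wgrad_def)
  note vm[measurable] = wgrad_borel(1)[OF vG]
  have Gm: "G \<in> borel_measurable (lebesgue_on \<Omega>)" by (rule borel_measurable_imp_lebesgue_on[OF wgrad_borel(2)[OF vG]])
  have wt: "wgrad (\<lambda>x. trunc (K n) (v x)) (\<lambda>x. trunc_grad (K n) (v x) (G x))" for n by (rule wgrad_trunc[OF vG K])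
  note [measurable] = wgrad_borel(1)[OF wt]
  have Tm: "(\<lambda>x. trunc_grad (K n) (v x) (G x) - G x) \<in> borel_measurable (lebesgue_on \<Omega>)" for n
    using Gm borel_measurable_imp_lebesgue_on[OF wgrad_borel(2)[OF wt]] by auto
  have "(\<lambda>n. \<integral>\<^sup>+x. norm (v x - trunc (K n) (v x)) \<partial>lborel) \<longlonglongrightarrow> 0"
  proof (rule nn_integral_dominated_convergence_norm[where w = "\<lambda>x. norm (v x)"])
    show "(\<integral>\<^sup>+ x. ennreal (norm (v x)) \<partial>lborel) < \<infinity>" using vi by (simp add: integrable_iff_bounded)
    show "AE x in lborel. (\<lambda>n. trunc (K n) (v x)) \<longlonglongrightarrow> v x" unfolding K_def by (intro AE_I2 trunc_tendsto)
    show "AE x in lborel. norm (trunc (K n) (v x)) \<le> norm (v x)" for n by (intro AE_I2 norm_trunc_le K)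
  qed measurable
  then have "eventually (\<lambda>n. (\<integral>\<^sup>+x. norm (v x - trunc (K n) (v x)) \<partial>lborel) < ennreal e) sequentially"
    using e by (intro order_tendstoD) auto
  moreover have "(\<lambda>n. modular (\<lambda>x. trunc_grad (K n) (v x) (G x) - G x)) \<longlonglongrightarrow> (\<integral>\<^sup>+x. 0 \<partial>lebesgue_on \<Omega>)"
    unfolding modular_def
  proof (rule nn_integral_dominated_convergence[where w = "\<lambda>x. ennreal (\<psi> x (norm (G x)))"])
    show "(\<lambda>x. ennreal (\<psi> x (norm (trunc_grad (K n) (v x) (G x) - G x)))) \<in> borel_measurable (lebesgue_on \<Omega>)" for n
      using psi_norm_measurable[OF Tm] by measurable
    show "(\<lambda>x. ennreal (\<psi> x (norm (G x)))) \<in> borel_measurable (lebesgue_on \<Omega>)"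
      using psi_norm_measurable[OF Gm] by measurable
    show "(\<integral>\<^sup>+ x. ennreal (\<psi> x (norm (G x))) \<partial>lebesgue_on \<Omega>) < \<infinity>" using fin by (simp add: modular_def)
    show "AE x in lebesgue_on \<Omega>. ennreal (\<psi> x (norm (trunc_grad (K n) (v x) (G x) - G x))) \<le> ennreal (\<psi> x (norm (G x)))" for n
    proof (rule AE_I2, rule ennreal_leI)
      fix x assume "x \<in> space (lebesgue_on \<Omega>)"
      then have x: "x \<in> \<Omega>" using space_lebesgue_on_dom by simp
      show "\<psi> x (norm (trunc_grad (K n) (v x) (G x) - G x)) \<le> \<psi> x (norm (G x))"
        by (intro psi_mono x) (use norm_diff_trunc_grad_le in \<open>auto simp: norm_minus_commute\<close>)
    qed
    show "AE x in lebesgue_on \<Omega>. (\<lambda>n. ennreal (\<psi> x (norm (trunc_grad (K n) (v x) (G x) - G x)))) \<longlonglongrightarrow> 0"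
    proof (rule AE_I2)
      fix x assume "x \<in> space (lebesgue_on \<Omega>)"
      then have x: "x \<in> \<Omega>" using space_lebesgue_on_dom by simp
      have "(\<lambda>n. norm (trunc_grad (K n) (v x) (G x) - G x)) \<longlonglongrightarrow> 0"
        unfolding K_def by (rule tendsto_norm_zero[OF LIM_zero[OF trunc_grad_tendsto]])
      then have "(\<lambda>n. \<psi> x (norm (trunc_grad (K n) (v x) (G x) - G x))) \<longlonglongrightarrow> 0" by (intro psi_tendsto_0[OF x]) auto
      then show "(\<lambda>n. ennreal (\<psi> x (norm (trunc_grad (K n) (v x) (G x) - G x)))) \<longlonglongrightarrow> 0" by (metis tendsto_ennrealI ennreal_0)
    qed
  qed simp
  then have "eventually (\<lambda>n. modular (\<lambda>x. trunc_grad (K n) (v x) (G x) - G x) < ennreal e) sequentially"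
    using e by (intro order_tendstoD) auto
  ultimately have "eventually (\<lambda>n. (\<integral>\<^sup>+x. norm (v x - trunc (K n) (v x)) \<partial>lborel) < ennreal e \<and>
     modular (\<lambda>x. trunc_grad (K n) (v x) (G x) - G x) < ennreal e) sequentially" by eventually_elim simp
  then obtain n where "(\<integral>\<^sup>+x. norm (v x - trunc (K n) (v x)) \<partial>lborel) < ennreal e"
     "modular (\<lambda>x. trunc_grad (K n) (v x) (G x) - G x) < ennreal e"
    by (auto simp: eventually_sequentially)
  then show ?thesis using K[of n] by (intro exI[of _ "K n"]) (simp add: norm_minus_commute)
qed

text \<open>The class in which localisation takes place. Boundedness of \<open>v\<close> belongs to
  it, so that the derivative of a cutoff contributes a bounded field.\<close>

definition admissible :: "(real^'d \<Rightarrow> real^'n::finite) \<Rightarrow> (real^'d \<Rightarrow> real^'d^'n) \<Rightarrow> bool" where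
  "admissible v G \<longleftrightarrow> wgrad v G \<and> (\<forall>x. x \<notin> \<Omega> \<longrightarrow> v x = 0 \<and> G x = 0) \<and> modular G < \<infinity> \<and> (\<exists>K. \<forall>x. norm (v x) \<le> K)"

text \<open>The gradient is a separate argument, since it is determined only almost everywhere;
  explicit representatives can then be added and multiplied by cutoffs.\<close>

definition approximable :: "(real^'d \<Rightarrow> real^'n::finite) \<Rightarrow> (real^'d \<Rightarrow> real^'d^'n) \<Rightarrow> bool" where
  "approximable v G \<longleftrightarrow> (\<forall>e. (0::real) < e \<longrightarrow> (\<exists>\<phi>\<in>Cc_inf \<Omega>. (\<integral>\<^sup>+x. norm (\<phi> x - v x) \<partial>lborel) < e \<and> modular (\<lambda>x. grad \<phi> x - G x) < e))"

lemma admissible_measurable: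
  assumes "admissible v G" shows "v \<in> borel_measurable borel" "G \<in> borel_measurable borel" "G \<in> borel_measurable (lebesgue_on \<Omega>)"
  using wgrad_borel(1,2)[of v G] borel_measurable_imp_lebesgue_on assms by (auto simp: admissible_def)

lemma admissible_diff:
  assumes "admissible v G" "admissible w H" shows "admissible (\<lambda>x. v x - w x) (\<lambda>x. G x - H x)"
proof -
  obtain K1 K2 where "\<And>x. norm (v x) \<le> K1" "\<And>x. norm (w x) \<le> K2" using assms by (auto simp: admissible_def)
  then have "norm (v x - w x) \<le> K1 + K2" for x by (meson add_mono norm_triangle_ineq4 order.trans)
  moreover have "modular (\<lambda>x. G x - H x) < \<infinity>"
    by (rule le_less_trans[OF modular_diff[OF admissible_measurable(3)[OF assms(1)] admissible_measurable(3)[OF assms(2)]]])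
      (use assms in \<open>auto simp: admissible_def ennreal_mult_less_top\<close>)
  ultimately show ?thesis using assms wgrad_diff[of v G w H] by (auto simp: admissible_def)
qed

text \<open>A bounded factor costs finitely many doublings. The remaining term is bounded because
  \<open>v\<close> is, and bounded fields have finite modular.\<close>

lemma admissible_mult:
  fixes v :: "real^'d \<Rightarrow> real^'n::finite"
  assumes vG: "admissible v G" and \<eta>: "\<eta> \<in> Cc_inf UNIV"
  shows "admissible (\<lambda>x. \<eta> x *\<^sub>R v x) (\<lambda>x. \<eta> x *\<^sub>R G x + outer (v x) (\<lambda>j. partial_deriv j \<eta> x))"
proof -
  have w: "wgrad v G" using vG by (simp add: admissible_def)
  note w' = wgrad_mult[OF w \<eta>]
  obtain K where K: "\<And>x. norm (v x) \<le> K" using vG by (auto simp: admissible_def)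
  have K0: "K \<ge> 0" using order.trans[OF norm_ge_zero K] .
  obtain B where B: "\<And>x. norm (\<eta> x) \<le> B" using Cc_inf_bounded[OF \<eta>] by metis
  have "\<exists>B. \<forall>x. norm (partial_deriv j \<eta> x) \<le> B" for j
    using Cc_inf_bounded[OF Cc_inf_partial_deriv[OF \<eta>]] by metis
  then obtain B' where B': "\<And>j x. norm (partial_deriv j \<eta> x) \<le> B' j" by metis
  obtain m where m: "B < 2 ^ m" using real_arch_pow[of 2 B] by auto
  have em: "\<eta> \<in> borel_measurable (lebesgue_on \<Omega>)" by (rule borel_measurable_imp_lebesgue_on[OF Cc_inf_borel[OF \<eta>]])
  have Gm: "G \<in> borel_measurable (lebesgue_on \<Omega>)" by (rule admissible_measurable(3)[OF vG])
  have f1: "(\<lambda>x. \<eta> x *\<^sub>R G x) \<in> borel_measurable (lebesgue_on \<Omega>)" using em Gm by simp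
  \<comment> \<open>Measurability of the product term is read off as the difference of the full
    gradient and its first summand.\<close>
  have "(\<lambda>x. (\<eta> x *\<^sub>R G x + outer (v x) (\<lambda>j. partial_deriv j \<eta> x)) - \<eta> x *\<^sub>R G x) \<in> borel_measurable (lebesgue_on \<Omega>)"
    using f1 borel_measurable_imp_lebesgue_on[OF wgrad_borel(2)[OF w']] by (intro borel_measurable_diff)
  then have f2: "(\<lambda>x. outer (v x) (\<lambda>j. partial_deriv j \<eta> x)) \<in> borel_measurable (lebesgue_on \<Omega>)" by simp
  have "modular (\<lambda>x. \<eta> x *\<^sub>R G x) \<le> (\<integral>\<^sup>+x. ennreal (C4 ^ m) * ennreal (\<psi> x (norm (G x))) \<partial>lebesgue_on \<Omega>)"
    unfolding modular_def
  proof (rule nn_integral_mono)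
    fix x assume "x \<in> space (lebesgue_on \<Omega>)"
    then have x: "x \<in> \<Omega>" using space_lebesgue_on_dom by simp
    have "\<bar>\<eta> x\<bar> \<le> 2 ^ m" using B[of x] m by simp
    then have "\<psi> x (norm (\<eta> x *\<^sub>R G x)) \<le> \<psi> x (2 ^ m * norm (G x))" by (intro psi_mono x) (auto intro: mult_right_mono)
    also have "\<dots> \<le> C4 ^ m * \<psi> x (norm (G x))" by (rule psi_dbl_pow[OF x]) simp
    finally have "ennreal (\<psi> x (norm (\<eta> x *\<^sub>R G x))) \<le> ennreal (C4 ^ m * \<psi> x (norm (G x)))" by (rule ennreal_leI)
    then show "ennreal (\<psi> x (norm (\<eta> x *\<^sub>R G x))) \<le> ennreal (C4 ^ m) * ennreal (\<psi> x (norm (G x)))"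
      using const_bounds by (simp add: ennreal_mult')
  qed
  also have "\<dots> = ennreal (C4 ^ m) * modular G" unfolding modular_def
    using psi_norm_measurable[OF Gm] by (intro nn_integral_cmult) measurable
  also have "\<dots> < \<infinity>" using vG by (auto simp: admissible_def ennreal_mult_less_top)
  finally have m1: "modular (\<lambda>x. \<eta> x *\<^sub>R G x) < \<infinity>" .
  have m2: "modular (\<lambda>x. outer (v x) (\<lambda>j. partial_deriv j \<eta> x)) < \<infinity>"
  proof (rule modular_bounded)
    fix x
    have "norm (outer (v x) (\<lambda>j. partial_deriv j \<eta> x)) \<le> norm (v x) * (\<Sum>j\<in>UNIV. \<bar>partial_deriv j \<eta> x\<bar>)"
      by (rule norm_outer_le)
    also have "\<dots> \<le> K * (\<Sum>j\<in>UNIV. B' j)"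
      using K B' K0 by (intro mult_mono sum_mono sum_nonneg) auto
    finally show "norm (outer (v x) (\<lambda>j. partial_deriv j \<eta> x)) \<le> K * (\<Sum>j\<in>UNIV. B' j)" .
  qed
  have "modular (\<lambda>x. \<eta> x *\<^sub>R G x + outer (v x) (\<lambda>j. partial_deriv j \<eta> x)) < \<infinity>"
    by (rule le_less_trans[OF modular_add[OF f1 f2]]) (use m1 m2 in \<open>auto simp: ennreal_mult_less_top\<close>)
  moreover have "norm (\<eta> x *\<^sub>R v x) \<le> B * K" for x
    using mult_mono[OF B K, of x x] order.trans[OF norm_ge_zero B] by simp
  ultimately show ?thesis using vG w' by (auto simp: admissible_def outer_def vec_eq_iff)
qed

lemma approximable_add:
  assumes v: "approximable v G" "G \<in> borel_measurable borel" "v \<in> borel_measurable borel"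
    and w: "approximable w H" "H \<in> borel_measurable borel" "w \<in> borel_measurable borel"
  shows "approximable (\<lambda>x. v x + w x) (\<lambda>x. G x + H x)"
  unfolding approximable_def
proof (intro allI impI)
  fix e :: real assume e: "e > 0"
  \<comment> \<open>Two errors \<open>e'\<close> pass through the quasi-subadditivity constant; as
    C4 is at least 1, the L1 error stays below e as well.\<close>
  define e' where "e' = e / (2 * C4)"
  have e': "e' > 0" "C4 * (e' + e') = e" "e' + e' \<le> e" using e const_bounds by (auto simp: e'_def field_simps)
  obtain \<phi> where \<phi>: "\<phi> \<in> Cc_inf \<Omega>" "(\<integral>\<^sup>+x. norm (\<phi> x - v x) \<partial>lborel) < e'" "modular (\<lambda>x. grad \<phi> x - G x) < e'"
    using v(1) e'(1) by (auto simp: approximable_def)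
  obtain \<theta> where \<theta>: "\<theta> \<in> Cc_inf \<Omega>" "(\<integral>\<^sup>+x. norm (\<theta> x - w x) \<partial>lborel) < e'" "modular (\<lambda>x. grad \<theta> x - H x) < e'"
    using w(1) e'(1) by (auto simp: approximable_def)
  note [measurable] = Cc_inf_borel[OF \<phi>(1)] Cc_inf_borel[OF \<theta>(1)] v(2,3) w(2,3)
    grad_borel_measurable[OF Cc_inf_Ck[OF \<phi>(1)]] grad_borel_measurable[OF Cc_inf_Ck[OF \<theta>(1)]]
  have e2: "ennreal e' + ennreal e' = ennreal (e' + e')" using e'(1) by (subst ennreal_plus) auto
  have "(\<integral>\<^sup>+x. norm ((\<phi> x + \<theta> x) - (v x + w x)) \<partial>lborel)
      \<le> (\<integral>\<^sup>+x. norm (\<phi> x - v x) \<partial>lborel) + (\<integral>\<^sup>+x. norm (\<theta> x - w x) \<partial>lborel)"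
    unfolding add_diff_add by (rule nn_integral_norm_add_le) measurable
  also have "\<dots> < ennreal e' + ennreal e'" using \<phi>(2) \<theta>(2) by (intro add_strict_mono)
  also have "\<dots> \<le> e" unfolding e2 using e'(3) by (rule ennreal_leI)
  finally have 1: "(\<integral>\<^sup>+x. norm ((\<phi> x + \<theta> x) - (v x + w x)) \<partial>lborel) < e" .
  have "grad (\<lambda>x. \<phi> x + \<theta> x) x - (G x + H x) = (grad \<phi> x - G x) + (grad \<theta> x - H x)" for x
    using grad_add[OF Cc_inf_differentiable[OF \<phi>(1)] Cc_inf_differentiable[OF \<theta>(1)]] by simp
  then have "modular (\<lambda>x. grad (\<lambda>x. \<phi> x + \<theta> x) x - (G x + H x)) = modular (\<lambda>x. (grad \<phi> x - G x) + (grad \<theta> x - H x))"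
    by (simp only:)
  also have "\<dots> \<le> ennreal C4 * (modular (\<lambda>x. grad \<phi> x - G x) + modular (\<lambda>x. grad \<theta> x - H x))"
    by (intro modular_add borel_measurable_imp_lebesgue_on) measurable
  also have "\<dots> < ennreal C4 * (ennreal e' + ennreal e')"
    using \<phi>(3) \<theta>(3) const_bounds by (intro ennreal_mult_strict_left_mono add_strict_mono) auto
  also have "\<dots> = e" unfolding e2 using e' const_bounds by (simp flip: ennreal_mult)
  finally have 2: "modular (\<lambda>x. grad (\<lambda>x. \<phi> x + \<theta> x) x - (G x + H x)) < e" .
  show "\<exists>\<phi>\<in>Cc_inf \<Omega>. (\<integral>\<^sup>+x. norm (\<phi> x - (v x + w x)) \<partial>lborel) < e \<and> modular (\<lambda>x. grad \<phi> x - (G x + H x)) < e"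
    by (rule bexI[where x = "\<lambda>x. \<phi> x + \<theta> x"], rule conjI, rule 1, rule 2, rule Cc_inf_add[OF \<phi>(1) \<theta>(1)])
qed

text \<open>A kernel concentrated near \<open>e\<close> moves the support by about t e: where \<phi>
  is nonzero, the point lies within c t / 2 of y + t e for some y in the domain and in the ball. The
  other half of c t keeps the support at a positive distance from the boundary.\<close>

lemma approximable_local:
  fixes w :: "real^'d \<Rightarrow> real^'n::finite"
  assumes inw: "inward_at \<Omega> x0 r" and wG: "admissible w G" and off: "\<And>x. x \<notin> ball x0 r \<Longrightarrow> w x = 0"
  shows "approximable w G"
  unfolding approximable_def
proof (intro allI impI)
  fix \<epsilon> :: real assume \<epsilon>: "\<epsilon> > 0"
  obtain e c t1 where e: "norm e \<le> 1" and c: "0 < c" "c \<le> 1" and t1: "0 < t1"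
    and inw: "\<And>t y. 0 < t \<Longrightarrow> t < t1 \<Longrightarrow> y \<in> \<Omega> \<Longrightarrow> y \<in> ball x0 r \<Longrightarrow> ball (y + t *\<^sub>R e) (c * t) \<subseteq> \<Omega>"
    using inw unfolding inward_at_def by metis
  obtain k :: "real^'d \<Rightarrow> real" where k: "k \<in> Cc_inf UNIV" "\<And>x. k x \<ge> 0" "\<And>x. x \<notin> ball e (c/2) \<Longrightarrow> k x = 0" "(\<integral>x. k x \<partial>lborel) = 1"
    using ex_mollifier[of "c/2" e] c by auto
  \<comment> \<open>The centre \<open>e\<close> has norm at most 1 and the radius is at most 1/2, so
    the kernel fits into the ball of radius 2 assumed in the mollification estimate.\<close>
  have k2: "k x = 0" if "x \<notin> ball 0 2" for x
  proof (rule k(3))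
    have "norm x \<le> norm e + dist e x" using norm_triangle_sub[of x e] by (simp add: dist_norm norm_minus_commute)
    then show "x \<notin> ball e (c/2)" using that e c by auto
  qed
  have w: "wgrad w G" "\<And>x. x \<notin> \<Omega> \<Longrightarrow> G x = 0" "modular G < \<infinity>" "\<And>x. x \<notin> \<Omega> \<Longrightarrow> w x = 0" using wG by (auto simp: admissible_def)
  obtain K where K: "\<And>x. norm (w x) \<le> K" using wG by (auto simp: admissible_def)
  obtain t where t: "t > 0" "t < t1" "(\<integral>\<^sup>+x. norm (conv (rescale t k) w x - w x) \<partial>lborel) < \<epsilon>"
     "modular (\<lambda>x. grad (conv (rescale t k) w) x - G x) < \<epsilon>"
    using mollify_modular[OF w(1,2) K w(3) k(1,2,4) k2 t1 \<epsilon>] by blast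
  define \<phi> where "\<phi> = conv (rescale t k) w"
  have wi: "integrable lborel w" using w(1) by (simp add: wgrad_def)
  have supp: "ball x (c * t / 2) \<subseteq> \<Omega>" if "\<phi> x \<noteq> 0" for x
  proof -
    obtain y where y: "rescale t k (x - y) *\<^sub>R w y \<noteq> 0"
    proof (rule ccontr)
      assume "\<not> thesis"
      then have "rescale t k (x - y) *\<^sub>R w y = 0" for y using that by blast
      then have "\<phi> x = 0" unfolding \<phi>_def conv_def by (simp only: Bochner_Integration.integral_zero)
      with \<open>\<phi> x \<noteq> 0\<close> show False by simp
    qed
    then have "y \<in> \<Omega>" "y \<in> ball x0 r" "k ((1/t) *\<^sub>R (x - y)) \<noteq> 0"
      using w(4) off by (auto simp: rescale_def)
    then have "norm (e - (1/t) *\<^sub>R (x - y)) < c / 2" using k(3) by (force simp: dist_norm)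
    then have "t * norm (e - (1/t) *\<^sub>R (x - y)) < t * (c / 2)" using t by (intro mult_strict_left_mono)
    moreover have "t * norm (e - (1/t) *\<^sub>R (x - y)) = norm ((y + t *\<^sub>R e) - x)"
    proof -
      have "(y + t *\<^sub>R e) - x = t *\<^sub>R (e - (1/t) *\<^sub>R (x - y))" using t by (simp add: algebra_simps)
      then show ?thesis using t by simp
    qed
    ultimately have d: "dist (y + t *\<^sub>R e) x < c * t / 2" by (simp add: dist_norm mult.commute)
    have "ball x (c * t / 2) \<subseteq> ball (y + t *\<^sub>R e) (c * t)"
    proof
      fix z assume "z \<in> ball x (c * t / 2)"
      then show "z \<in> ball (y + t *\<^sub>R e) (c * t)" using d dist_triangle[of "y + t *\<^sub>R e" z x] by simp
    qed
    then show ?thesis using inw[OF t(1,2) \<open>y \<in> \<Omega>\<close> \<open>y \<in> ball x0 r\<close>] by blast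
  qed
  have ct: "c * t / 2 > 0" using c t by simp
  have "\<phi> \<in> Cc_inf \<Omega>"
    unfolding Cc_inf_def
  proof (intro CollectI conjI allI)
    show "Ck n \<phi>" for n unfolding \<phi>_def by (rule Ck_conv[OF rescale_Cc_inf[OF k(1) t(1)] wi])
    show sub: "closure {x. \<phi> x \<noteq> 0} \<subseteq> \<Omega>"
    proof
      fix z assume "z \<in> closure {x. \<phi> x \<noteq> 0}"
      then obtain x where "\<phi> x \<noteq> 0" "dist x z < c * t / 2" using closure_approachable[THEN iffD1, rule_format, OF _ ct] by auto
      then show "z \<in> \<Omega>" using supp[of x] by auto
    qed
    show "compact (closure {x. \<phi> x \<noteq> 0})"
      using bounded_subset[OF bounded_dom sub] by (simp add: compact_eq_bounded_closed)
  qed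
  then show "\<exists>\<phi>\<in>Cc_inf \<Omega>. (\<integral>\<^sup>+x. norm (\<phi> x - w x) \<partial>lborel) < \<epsilon> \<and> modular (\<lambda>x. grad \<phi> x - G x) < \<epsilon>"
    using t unfolding \<phi>_def by blast
qed

lemma approximable_zero: "approximable (\<lambda>x. 0 :: real^'n::finite) (\<lambda>x. 0)"
proof -
  have "grad (\<lambda>x. 0 :: real^'n) = (\<lambda>x::real^'d. 0)"
    by (rule ext, rule grad_eq_0, rule partial_deriv_eq_0[of UNIV]) auto
  then have "modular (\<lambda>x. grad (\<lambda>x. 0 :: real^'n) x - 0) = (\<integral>\<^sup>+x. 0 \<partial>lebesgue_on \<Omega>)"
    unfolding modular_def by (intro nn_integral_cong) (use psi_zero space_lebesgue_on_dom in auto)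
  then have "modular (\<lambda>x. grad (\<lambda>x. 0 :: real^'n) x - 0) < ennreal e" if "e > 0" for e
    using that by (simp only: nn_integral_const) simp
  then show ?thesis unfolding approximable_def
    by (intro allI impI bexI[OF _ Cc_inf_zero] conjI) auto
qed

text \<open>A partition of unity built one ball at a time: the cutoff at \<open>a\<close> splits off
  a piece for the local approximation, and the remainder vanishes on \<open>ball a (r a)\<close>, so
  the other balls cover it. The hypothesis includes the vanishing of \<open>G\<close>, because the
  induction has to pass it on.\<close>

lemma approximable_cover:
  fixes w :: "real^'d \<Rightarrow> real^'n::finite"
  assumes "finite I" "\<And>x. x \<in> I \<Longrightarrow> 0 < r x \<and> inward_at \<Omega> x (3 * r x)"
    and "admissible w G" "\<And>x. x \<notin> (\<Union>y\<in>I. ball y (r y)) \<Longrightarrow> w x = 0 \<and> G x = 0"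
  shows "approximable w G"
  using assms
proof (induction I arbitrary: w G rule: finite_induct)
  case empty
  then have "w = (\<lambda>x. 0)" "G = (\<lambda>x. 0)" by auto
  then show ?case using approximable_zero by simp
next
  case (insert a I)
  have r: "r a > 0" using insert.prems(1) by simp
  obtain \<beta> :: "real^'d \<Rightarrow> real" where \<beta>: "\<beta> \<in> Cc_inf UNIV" "\<And>x. x \<in> ball a (r a) \<Longrightarrow> \<beta> x = 1"
    "\<And>x. x \<notin> ball a (2 * r a) \<Longrightarrow> \<beta> x = 0" using ex_cutoff[OF r] by metis
  define w1 where "w1 x = \<beta> x *\<^sub>R w x" for x
  define G1 where "G1 x = \<beta> x *\<^sub>R G x + outer (w x) (\<lambda>j. partial_deriv j \<beta> x)" for x
  have g1: "admissible w1 G1" unfolding w1_def G1_def by (rule admissible_mult[OF insert.prems(2) \<beta>(1)])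
  have g2: "admissible (\<lambda>x. w x - w1 x) (\<lambda>x. G x - G1 x)" by (rule admissible_diff[OF insert.prems(2) g1])
  have a1: "approximable w1 G1"
  proof (rule approximable_local[OF _ g1, of a "3 * r a"])
    fix x assume "x \<notin> ball a (3 * r a)"
    \<comment> \<open>The cutoff is supported in radius 2 r, inside the radius 3 r of the inward
      condition.\<close>
    then have "x \<notin> ball a (2 * r a)" using r by auto
    then show "w1 x = 0" using \<beta>(3) by (simp add: w1_def)
  qed (use insert.prems(1) in auto)
  have a2: "approximable (\<lambda>x. w x - w1 x) (\<lambda>x. G x - G1 x)"
  proof (rule insert.IH[OF _ g2])
    fix x assume x: "x \<notin> (\<Union>y\<in>I. ball y (r y))"
    show "w x - w1 x = 0 \<and> G x - G1 x = 0"
    proof (cases "x \<in> ball a (r a)")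
      case True
      \<comment> \<open>The cutoff is constant on this ball, so its derivative adds nothing to the
        gradient.\<close>
      have "partial_deriv j \<beta> x = 0" for j
        by (rule partial_deriv_locally_const[OF open_ball True]) (rule \<beta>(2))
      then show ?thesis using \<beta>(2)[OF True] by (simp add: w1_def G1_def outer_def vec_eq_iff)
    next
      case False
      then have "w x = 0 \<and> G x = 0" using x insert.prems(3) by auto
      then show ?thesis by (simp add: w1_def G1_def outer_def vec_eq_iff)
    qed
  qed (use insert.prems(1) in auto)
  show ?case
    using approximable_add[OF a1 admissible_measurable(2,1)[OF g1] a2 admissible_measurable(2,1)[OF g2]] by simp
qed

lemma approximable_admissible:
  fixes w :: "real^'d \<Rightarrow> real^'n::finite"
  assumes "lipschitz_boundary \<Omega>" and wG: "admissible w G"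
  shows "approximable w G"
proof -
  \<comment> \<open>Radii are divided by 3 before compactness is used, to leave room for the cutoff
    around each ball of the cover.\<close>
  have "\<exists>r>0. inward_at \<Omega> x (3 * r)" if x: "x \<in> closure \<Omega>" for x
  proof -
    obtain R where "R > 0" "inward_at \<Omega> x R" using inward_at_closure[OF open_dom assms(1) x] .
    then show ?thesis by (intro exI[of _ "R / 3"]) auto
  qed
  then obtain r where r: "\<And>x. x \<in> closure \<Omega> \<Longrightarrow> r x > 0 \<and> inward_at \<Omega> x (3 * r x)" by metis
  have "compact (closure \<Omega>)" using bounded_dom by (simp add: compact_eq_bounded_closed bounded_closure)
  moreover have "closure \<Omega> \<subseteq> (\<Union>x\<in>closure \<Omega>. ball x (r x))" using r by force
  ultimately obtain I where I: "I \<subseteq> closure \<Omega>" "finite I" "closure \<Omega> \<subseteq> (\<Union>x\<in>I. ball x (r x))"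
    using compactE_image[of "closure \<Omega>" "closure \<Omega>" "\<lambda>x. ball x (r x)"] by (metis open_ball)
  show ?thesis
  proof (rule approximable_cover[OF I(2) _ wG])
    show "0 < r x \<and> inward_at \<Omega> x (3 * r x)" if "x \<in> I" for x using r I(1) that by blast
    fix x assume "x \<notin> (\<Union>y\<in>I. ball y (r y))"
    then have "x \<notin> \<Omega>" using I(3) closure_subset by blast
    then show "w x = 0 \<and> G x = 0" using wG by (simp add: admissible_def)
  qed
qed

text \<open>Truncation reduces the claim to bounded functions. Since arctan 0 = 0, it keeps values
  and gradients zero outside the domain.\<close>

lemma approximable_wgrad:
  fixes v :: "real^'d \<Rightarrow> real^'n::finite"
  assumes lip: "lipschitz_boundary \<Omega>" and vG: "wgrad v G" and off: "\<And>x. x \<notin> \<Omega> \<Longrightarrow> v x = 0" "\<And>x. x \<notin> \<Omega> \<Longrightarrow> G x = 0"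
    and fin: "modular G < \<infinity>"
  shows "approximable v G"
  unfolding approximable_def
proof (intro allI impI)
  fix e :: real assume e: "e > 0"
  define e' where "e' = e / (2 * C4)"
  have e': "e' > 0" "C4 * (e' + e') = e" "e' + e' \<le> e" using e const_bounds by (auto simp: e'_def field_simps)
  obtain K where K: "K > 0" "(\<integral>\<^sup>+x. norm (trunc K (v x) - v x) \<partial>lborel) < e'" "modular (\<lambda>x. trunc_grad K (v x) (G x) - G x) < e'"
    using trunc_modular[OF vG fin e'(1)] by blast
  define w where "w x = trunc K (v x)" for x
  define H where "H x = trunc_grad K (v x) (G x)" for x
  have wH: "wgrad w H" unfolding w_def H_def by (rule wgrad_trunc[OF vG K(1)])
  have "modular H \<le> modular G" unfolding H_def by (rule modular_mono_norm) (rule norm_trunc_grad_le)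
  moreover have "\<exists>B. \<forall>x. norm (w x) \<le> B"
    unfolding w_def using norm_trunc_bound[OF K(1)] by blast
  ultimately have "admissible w H"
    using wH off fin by (auto simp: admissible_def w_def H_def trunc_def trunc_grad_def vec_eq_iff intro: le_less_trans)
  then have "approximable w H" by (rule approximable_admissible[OF lip])
  then obtain \<phi> where \<phi>: "\<phi> \<in> Cc_inf \<Omega>" "(\<integral>\<^sup>+x. norm (\<phi> x - w x) \<partial>lborel) < e'" "modular (\<lambda>x. grad \<phi> x - H x) < e'"
    using e'(1) by (auto simp: approximable_def)
  note [measurable] = Cc_inf_borel[OF \<phi>(1)] grad_borel_measurable[OF Cc_inf_Ck[OF \<phi>(1)]]
    wgrad_borel(1,2)[OF vG] wgrad_borel(1,2)[OF wH]
  have e2: "ennreal e' + ennreal e' = ennreal (e' + e')" using e'(1) by (subst ennreal_plus) auto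
  have "(\<integral>\<^sup>+x. norm (\<phi> x - v x) \<partial>lborel) \<le> (\<integral>\<^sup>+x. norm (\<phi> x - w x) \<partial>lborel) + (\<integral>\<^sup>+x. norm (w x - v x) \<partial>lborel)"
    using nn_integral_norm_add_le[of "\<lambda>x. \<phi> x - w x" lborel "\<lambda>x. w x - v x"] by simp
  also have "\<dots> < ennreal e' + ennreal e'" using \<phi>(2) K(2) unfolding w_def by (intro add_strict_mono)
  also have "\<dots> \<le> e" unfolding e2 using e'(3) by (rule ennreal_leI)
  finally have 1: "(\<integral>\<^sup>+x. norm (\<phi> x - v x) \<partial>lborel) < e" .
  have "modular (\<lambda>x. grad \<phi> x - G x) = modular (\<lambda>x. (grad \<phi> x - H x) + (H x - G x))" by simp
  also have "\<dots> \<le> ennreal C4 * (modular (\<lambda>x. grad \<phi> x - H x) + modular (\<lambda>x. H x - G x))"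
    by (intro modular_add borel_measurable_imp_lebesgue_on) measurable
  also have "\<dots> < ennreal C4 * (ennreal e' + ennreal e')"
    using \<phi>(3) K(3) const_bounds unfolding H_def by (intro ennreal_mult_strict_left_mono add_strict_mono) auto
  also have "\<dots> = e" unfolding e2 using e' const_bounds by (simp flip: ennreal_mult)
  finally have 2: "modular (\<lambda>x. grad \<phi> x - G x) < e" .
  show "\<exists>\<phi>\<in>Cc_inf \<Omega>. (\<integral>\<^sup>+x. norm (\<phi> x - v x) \<partial>lborel) < e \<and> modular (\<lambda>x. grad \<phi> x - G x) < e"
    using 1 2 \<phi>(1) by blast
qed

end

section \<open>Density and absence of the Lavrentiev gap\<close>

text \<open>The sum of the norms is the convex combination of |a|, with weight 1 - l, and of |a| +
  2^m |b|, with weight l = 2^-m. The factor in front of \<open>\<psi> x (norm a)\<close> tends to 1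
  as \<open>m\<close> grows, unlike in quasi-subadditivity; the price is a large factor on the
  perturbation.\<close>

lemma (in orlicz_integrand) psi_perturb:
  fixes a b :: "'b::real_normed_vector"
  assumes x: "x \<in> \<Omega>"
  shows "\<psi> x (norm (a + b)) \<le> (1 + C4 / 2 ^ m) * \<psi> x (norm a) + C4 ^ Suc m * \<psi> x (norm b)"
proof -
  define l where "l = 1 / (2::real) ^ m"
  have l: "0 < l" "l \<le> 1" by (auto simp: l_def)
  have \<psi>0: "\<psi> x (norm a) \<ge> 0" "\<psi> x (norm b) \<ge> 0" using psi_nonneg[OF x] by auto
  have C: "C4 ^ Suc m * \<psi> x (norm b) \<ge> 0" using \<psi>0 const_bounds by simp
  have "\<psi> x (norm (a + b)) \<le> \<psi> x (norm a + norm b)" by (intro psi_mono x norm_triangle_ineq) auto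
  also have "norm a + norm b = (1 - l) *\<^sub>R norm a + l *\<^sub>R (norm a + 2 ^ m * norm b)"
    by (simp add: l_def field_simps)
  also have "\<psi> x \<dots> \<le> (1 - l) * \<psi> x (norm a) + l * \<psi> x (norm a + 2 ^ m * norm b)"
    by (rule convex_onD[OF psi_convex[OF x]]) (use l in auto)
  also have "\<psi> x (norm a + 2 ^ m * norm b) \<le> \<psi> x (2 * norm a) / 2 + \<psi> x (2 * (2 ^ m * norm b)) / 2"
    by (rule psi_midpoint[OF x]) auto
  also have "\<psi> x (2 * norm a) \<le> C4 * \<psi> x (norm a)" by (rule doubling[OF x]) simp
  also have "\<psi> x (2 * (2 ^ m * norm b)) \<le> C4 ^ Suc m * \<psi> x (norm b)"
    using psi_dbl_pow[OF x, of "norm b" "Suc m"] by (simp add: mult.assoc)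
  finally have "\<psi> x (norm (a + b)) \<le> (1 - l) * \<psi> x (norm a) + l * (C4 * \<psi> x (norm a) / 2 + C4 ^ Suc m * \<psi> x (norm b) / 2)"
    using l by (simp add: mult_left_mono)
  also have "\<dots> \<le> \<psi> x (norm a) + l * (C4 * \<psi> x (norm a)) + 1 * (C4 ^ Suc m * \<psi> x (norm b))"
  proof -
    have "(1 - l) * \<psi> x (norm a) \<le> \<psi> x (norm a)" using l \<psi>0 by (simp add: mult_left_le_one_le)
    moreover have "l * (C4 * \<psi> x (norm a) / 2) \<le> l * (C4 * \<psi> x (norm a))" using l \<psi>0 const_bounds by (intro mult_left_mono) auto
    moreover have "l * (C4 ^ Suc m * \<psi> x (norm b) / 2) \<le> 1 * (C4 ^ Suc m * \<psi> x (norm b))" using l C by (intro mult_mono) auto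
    ultimately show ?thesis unfolding distrib_left by linarith
  qed
  also have "\<dots> = (1 + C4 / 2 ^ m) * \<psi> x (norm a) + C4 ^ Suc m * \<psi> x (norm b)"
    by (simp add: l_def algebra_simps)
  finally show ?thesis .
qed

context orlicz_integrand
begin

lemma modular_perturb:
  fixes f g :: "real^'d \<Rightarrow> 'b::euclidean_space"
  assumes f: "f \<in> borel_measurable (lebesgue_on \<Omega>)" and g: "g \<in> borel_measurable (lebesgue_on \<Omega>)"
  shows "modular (\<lambda>x. f x + g x) \<le> ennreal (1 + C4 / 2 ^ m) * modular f + ennreal (C4 ^ Suc m) * modular g"
proof -
  note [measurable] = psi_norm_measurable[OF f] psi_norm_measurable[OF g]
  have "modular (\<lambda>x. f x + g x) \<le> (\<integral>\<^sup>+x. ennreal (1 + C4 / 2 ^ m) * ennreal (\<psi> x (norm (f x))) + ennreal (C4 ^ Suc m) * ennreal (\<psi> x (norm (g x))) \<partial>lebesgue_on \<Omega>)"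
    unfolding modular_def
  proof (rule nn_integral_mono)
    fix x assume "x \<in> space (lebesgue_on \<Omega>)"
    then have x: "x \<in> \<Omega>" using space_lebesgue_on_dom by simp
    have "ennreal (\<psi> x (norm (f x + g x))) \<le> ennreal ((1 + C4 / 2 ^ m) * \<psi> x (norm (f x)) + C4 ^ Suc m * \<psi> x (norm (g x)))"
      by (rule ennreal_leI[OF psi_perturb[OF x]])
    also have "\<dots> = ennreal ((1 + C4 / 2 ^ m) * \<psi> x (norm (f x))) + ennreal (C4 ^ Suc m * \<psi> x (norm (g x)))"
      using psi_nonneg[OF x] const_bounds by (intro ennreal_plus mult_nonneg_nonneg) auto
    also have "\<dots> = ennreal (1 + C4 / 2 ^ m) * ennreal (\<psi> x (norm (f x))) + ennreal (C4 ^ Suc m) * ennreal (\<psi> x (norm (g x)))"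
      using psi_nonneg[OF x] by (simp only: ennreal_mult'' norm_ge_zero)
    finally show "ennreal (\<psi> x (norm (f x + g x))) \<le> ennreal (1 + C4 / 2 ^ m) * ennreal (\<psi> x (norm (f x))) + ennreal (C4 ^ Suc m) * ennreal (\<psi> x (norm (g x)))" .
  qed
  also have "\<dots> = (\<integral>\<^sup>+x. ennreal (1 + C4 / 2 ^ m) * ennreal (\<psi> x (norm (f x))) \<partial>lebesgue_on \<Omega>) + (\<integral>\<^sup>+x. ennreal (C4 ^ Suc m) * ennreal (\<psi> x (norm (g x))) \<partial>lebesgue_on \<Omega>)"
    by (rule nn_integral_add) measurable
  also have "\<dots> = ennreal (1 + C4 / 2 ^ m) * modular f + ennreal (C4 ^ Suc m) * modular g"
    unfolding modular_def by (subst (1 2) nn_integral_cmult) measurable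
  finally show ?thesis .
qed

lemma modular_scale_pow:
  fixes f g :: "real^'d \<Rightarrow> 'b::euclidean_space"
  assumes f: "f \<in> borel_measurable (lebesgue_on \<Omega>)" and le: "\<And>x. norm (g x) \<le> 2 ^ m * norm (f x)"
  shows "modular g \<le> ennreal (C4 ^ m) * modular f"
proof -
  note [measurable] = psi_norm_measurable[OF f]
  have "modular g \<le> (\<integral>\<^sup>+x. ennreal (C4 ^ m) * ennreal (\<psi> x (norm (f x))) \<partial>lebesgue_on \<Omega>)"
    unfolding modular_def
  proof (rule nn_integral_mono)
    fix x assume "x \<in> space (lebesgue_on \<Omega>)"
    then have x: "x \<in> \<Omega>" using space_lebesgue_on_dom by simp
    have "\<psi> x (norm (g x)) \<le> \<psi> x (2 ^ m * norm (f x))" by (rule psi_mono[OF x norm_ge_zero le])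
    also have "\<dots> \<le> C4 ^ m * \<psi> x (norm (f x))" by (rule psi_dbl_pow[OF x]) simp
    finally show "ennreal (\<psi> x (norm (g x))) \<le> ennreal (C4 ^ m) * ennreal (\<psi> x (norm (f x)))"
      using psi_nonneg[OF x] by (simp add: ennreal_leI flip: ennreal_mult'')
  qed
  also have "\<dots> = ennreal (C4 ^ m) * modular f" unfolding modular_def by (rule nn_integral_cmult) measurable
  finally show ?thesis .
qed

lemma lux_norm_alt:
  fixes f :: "real^'d \<Rightarrow> 'b::euclidean_space"
  shows "lux_norm \<Omega> \<psi> f = (INF l \<in> {l. 0 < l \<and> modular (\<lambda>x. (1 / l) *\<^sub>R f x) \<le> 1}. ennreal l)"
proof -
  have "(\<integral>\<^sup>+x. ennreal (\<psi> x (norm (f x) / l)) \<partial>lebesgue_on \<Omega>) = modular (\<lambda>x. (1 / l) *\<^sub>R f x)" if "l > 0" for l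
    unfolding modular_def using that by simp
  then have "{l. 0 < l \<and> (\<integral>\<^sup>+x. ennreal (\<psi> x (norm (f x) / l)) \<partial>lebesgue_on \<Omega>) \<le> 1}
    = {l. 0 < l \<and> modular (\<lambda>x. (1 / l) *\<^sub>R f x) \<le> 1}" by auto
  then show ?thesis by (simp only: lux_norm_def)
qed

text \<open>Division by \<open>l\<close> is covered by \<open>m\<close> doublings, which raise the
  modular by at most the factor \<open>C4 ^ m\<close>. Smallness of the modular thus becomes
  smallness of the norm.\<close>

lemma lux_norm_le:
  fixes f :: "real^'d \<Rightarrow> 'b::euclidean_space"
  assumes f: "f \<in> borel_measurable (lebesgue_on \<Omega>)" and l: "0 < l" "1 / l \<le> 2 ^ m"
    and small: "modular f \<le> ennreal (1 / C4 ^ m)"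
  shows "lux_norm \<Omega> \<psi> f \<le> ennreal l"
proof -
  have "modular (\<lambda>x. (1 / l) *\<^sub>R f x) \<le> ennreal (C4 ^ m) * modular f"
    by (rule modular_scale_pow[OF f]) (use l mult_right_mono[OF l(2) norm_ge_zero] in simp)
  also have "\<dots> \<le> ennreal (C4 ^ m) * ennreal (1 / C4 ^ m)" using small by (intro mult_left_mono) auto
  also have "\<dots> = 1" using const_bounds by (simp flip: ennreal_mult)
  finally show ?thesis unfolding lux_norm_alt using l by (intro INF_lower) auto
qed

text \<open>A finite norm provides a scaled field with modular at most 1; finitely many doublings
  undo the scaling.\<close>

lemma modular_finite_of_lux_norm:
  fixes f :: "real^'d \<Rightarrow> 'b::euclidean_space"
  assumes f: "f \<in> borel_measurable (lebesgue_on \<Omega>)" and fin: "lux_norm \<Omega> \<psi> f < \<infinity>"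
  shows "modular f < \<infinity>"
proof -
  obtain l where l: "0 < l" "modular (\<lambda>x. (1 / l) *\<^sub>R f x) \<le> 1"
    using fin unfolding lux_norm_alt by (auto simp: INF_less_iff)
  obtain m where m: "l < 2 ^ m" using real_arch_pow[of 2 l] by auto
  have fm: "(\<lambda>x. (1 / l) *\<^sub>R f x) \<in> borel_measurable (lebesgue_on \<Omega>)" using f by simp
  have "modular f \<le> ennreal (C4 ^ m) * modular (\<lambda>x. (1 / l) *\<^sub>R f x)"
  proof (rule modular_scale_pow[OF fm])
    fix x
    have "norm (f x) = l * norm ((1 / l) *\<^sub>R f x)" using l by simp
    also have "\<dots> \<le> 2 ^ m * norm ((1 / l) *\<^sub>R f x)" using m by (intro mult_right_mono) auto
    finally show "norm (f x) \<le> 2 ^ m * norm ((1 / l) *\<^sub>R f x)" .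
  qed
  also have "\<dots> < \<infinity>" using l(2) by (auto simp: ennreal_mult_less_top intro: le_less_trans)
  finally show ?thesis .
qed

text \<open>By convexity, dividing the field by l at least 1 divides the modular by at least l; it
  remains to take l no smaller than the modular.\<close>

lemma lux_norm_finite_of_modular:
  fixes f :: "real^'d \<Rightarrow> 'b::euclidean_space"
  assumes f: "f \<in> borel_measurable (lebesgue_on \<Omega>)" and fin: "modular f < \<infinity>"
  shows "lux_norm \<Omega> \<psi> f < \<infinity>"
proof -
  note [measurable] = psi_norm_measurable[OF f]
  obtain c where c: "modular f = ennreal c" "c \<ge> 0" using fin by (cases "modular f") auto
  define l where "l = max 1 c"
  have l: "l \<ge> 1" "c \<le> l" by (auto simp: l_def)
  have "modular (\<lambda>x. (1 / l) *\<^sub>R f x) \<le> (\<integral>\<^sup>+x. ennreal (1 / l) * ennreal (\<psi> x (norm (f x))) \<partial>lebesgue_on \<Omega>)"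
    unfolding modular_def
  proof (rule nn_integral_mono)
    fix x assume "x \<in> space (lebesgue_on \<Omega>)"
    then have x: "x \<in> \<Omega>" using space_lebesgue_on_dom by simp
    have "\<psi> x ((1 / l) * norm (f x)) \<le> (1 / l) * \<psi> x (norm (f x))" using l by (intro psi_scale x) auto
    then show "ennreal (\<psi> x (norm ((1 / l) *\<^sub>R f x))) \<le> ennreal (1 / l) * ennreal (\<psi> x (norm (f x)))"
      using l psi_nonneg[OF x] by (simp add: ennreal_leI flip: ennreal_mult'')
  qed
  also have "\<dots> = ennreal (1 / l) * modular f" unfolding modular_def by (rule nn_integral_cmult) measurable
  also have "\<dots> = ennreal (c / l)" using c l by (simp flip: ennreal_mult)
  also have "\<dots> \<le> 1" using l by (simp add: ennreal_le_1)
  finally have "lux_norm \<Omega> \<psi> f \<le> ennreal l" unfolding lux_norm_alt using l by (intro INF_lower) auto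
  then show ?thesis by (rule le_less_trans) simp
qed

lemma energy_modular: "energy \<Omega> \<psi> u = modular (weak_grad \<Omega> u)"
  by (simp add: energy_def modular_def)

text \<open>The approximation is carried out for the extension by zero, whose values and gradient
  agree with \<open>v\<close> and \<open>weak_grad \<Omega> v\<close> almost everywhere in the
  domain.\<close>

lemma modular_density:
  fixes v :: "real^'d \<Rightarrow> real^'n::finite"
  assumes lip: "lipschitz_boundary \<Omega>" and v: "v \<in> W1p0 \<Omega> 1" and fin: "modular (weak_grad \<Omega> v) < \<infinity>" and e: "0 < (e::real)"
  obtains \<phi> where "\<phi> \<in> Cc_inf \<Omega>" "Lp_norm \<Omega> 1 (\<lambda>x. v x - \<phi> x) < e" "modular (\<lambda>x. weak_grad \<Omega> v x - grad \<phi> x) < e"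
proof -
  obtain u G where uG: "wgrad u G" "\<And>x. x \<notin> \<Omega> \<Longrightarrow> u x = 0" "\<And>x. x \<notin> \<Omega> \<Longrightarrow> G x = 0"
    "AE x in lebesgue_on \<Omega>. v x = u x" "AE x in lebesgue_on \<Omega>. weak_grad \<Omega> v x = G x"
    by (rule W1p0_imp_wgrad[OF open_dom v]) (rule that)
  have "modular G < \<infinity>" using fin modular_cong_AE[OF uG(5)] by simp
  then have "approximable u G" by (intro approximable_wgrad[OF lip uG(1)]) (use uG(2,3) in auto)
  then obtain \<phi> where \<phi>: "\<phi> \<in> Cc_inf \<Omega>" "(\<integral>\<^sup>+x. norm (\<phi> x - u x) \<partial>lborel) < e" "modular (\<lambda>x. grad \<phi> x - G x) < e"
    using e by (auto simp: approximable_def)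
  show ?thesis
  proof (rule that[OF \<phi>(1)])
    have "modular (\<lambda>x. weak_grad \<Omega> v x - grad \<phi> x) = modular (\<lambda>x. G x - grad \<phi> x)"
      by (rule modular_cong_AE) (use uG(5) in \<open>auto elim: eventually_mono\<close>)
    also have "\<dots> = modular (\<lambda>x. grad \<phi> x - G x)" by (simp add: modular_def norm_minus_commute)
    finally show "modular (\<lambda>x. weak_grad \<Omega> v x - grad \<phi> x) < e" using \<phi>(3) by simp
    have vi: "v \<in> borel_measurable (lebesgue_on \<Omega>)" using v by (auto simp: W1p0_def W1p_def Lp_def)
    have um: "u \<in> borel_measurable borel" "\<phi> \<in> borel_measurable borel"
      using wgrad_borel(1)[OF uG(1)] Cc_inf_borel[OF \<phi>(1)] .
    have int: "integrable lborel (\<lambda>x. \<phi> x - u x)"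
      using uG(1) Cc_inf_integrable[OF \<phi>(1)] by (auto simp: wgrad_def)
    have "Lp_norm \<Omega> 1 (\<lambda>x. v x - \<phi> x) = (\<integral>x. norm (\<phi> x - u x) \<partial>lebesgue_on \<Omega>)"
      unfolding Lp_norm_1
    proof (rule integral_cong_AE)
      show "(\<lambda>x. norm (v x - \<phi> x)) \<in> borel_measurable (lebesgue_on \<Omega>)"
        using vi borel_measurable_imp_lebesgue_on[OF um(2)] by measurable
      show "(\<lambda>x. norm (\<phi> x - u x)) \<in> borel_measurable (lebesgue_on \<Omega>)"
        using um by (intro borel_measurable_imp_lebesgue_on) measurable
      show "AE x in lebesgue_on \<Omega>. norm (v x - \<phi> x) = norm (\<phi> x - u x)"
        using uG(4) by eventually_elim (simp add: norm_minus_commute)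
    qed
    also have "\<dots> = (\<integral>x. norm (\<phi> x - u x) \<partial>lborel)"
      by (rule integral_lebesgue_on_zero_outside[OF dom_borel]) (use um uG(2) Cc_inf_eq_0[OF \<phi>(1)] in auto)
    finally have eq: "Lp_norm \<Omega> 1 (\<lambda>x. v x - \<phi> x) = (\<integral>x. norm (\<phi> x - u x) \<partial>lborel)" .
    have "ennreal (\<integral>x. norm (\<phi> x - u x) \<partial>lborel) = (\<integral>\<^sup>+x. norm (\<phi> x - u x) \<partial>lborel)"
      using int by (intro nn_integral_eq_integral[symmetric]) auto
    then have "ennreal (Lp_norm \<Omega> 1 (\<lambda>x. v x - \<phi> x)) < ennreal e" using \<phi>(2) unfolding eq by simp
    then show "Lp_norm \<Omega> 1 (\<lambda>x. v x - \<phi> x) < e" by (simp add: ennreal_less_iff Lp_norm_nonneg)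
  qed
qed

lemma weak_grad_measurable: "u \<in> W1p \<Omega> p' \<Longrightarrow> weak_grad \<Omega> u \<in> borel_measurable (lebesgue_on \<Omega>)"
  using W1p_weak_grad(2)[OF open_dom] by (auto simp: Lp_def)

text \<open>The gradient of a test function is bounded, so its modular and hence its Luxemburg norm
  are finite.\<close>

lemma Cc_inf_subset_W1psi0: "(Cc_inf \<Omega> :: (real^'d \<Rightarrow> real^'n::finite) set) \<subseteq> W1psi0 \<Omega> \<psi>"
proof
  fix \<phi> :: "real^'d \<Rightarrow> real^'n" assume \<phi>: "\<phi> \<in> Cc_inf \<Omega>"
  note \<phi>U = Cc_inf_UNIV[OF \<phi>]
  have W0: "\<phi> \<in> W1p0 \<Omega> 1" using Cc_inf_subset_W1p0[OF open_dom, of 1] \<phi> by auto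
  then have W: "\<phi> \<in> W1p \<Omega> 1" by (simp add: W1p0_def)
  obtain B where B: "\<And>x. norm (grad \<phi> x) \<le> B" using Cc_inf_grad_bounded[OF \<phi>] by metis
  have "modular (weak_grad \<Omega> \<phi>) = modular (grad \<phi>)"
    by (rule modular_cong_AE[OF weak_grad_AE_eq[OF open_dom Cc_inf_is_weak_grad[OF open_dom \<phi>U]]])
  also have "\<dots> < \<infinity>" by (rule modular_bounded[OF B])
  finally have "lux_norm \<Omega> \<psi> (weak_grad \<Omega> \<phi>) < \<infinity>"
    by (rule lux_norm_finite_of_modular[OF weak_grad_measurable[OF W]])
  then show "\<phi> \<in> W1psi0 \<Omega> \<psi>" using W0 W by (simp add: W1psi0_def W1psi_def)
qed

lemma W1psi0_density:
  fixes u :: "real^'d \<Rightarrow> real^'n::finite"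
  assumes lip: "lipschitz_boundary \<Omega>" and u: "u \<in> W1psi0 \<Omega> \<psi>" and e: "0 < (e::ennreal)"
  shows "\<exists>\<phi>\<in>Cc_inf \<Omega>. W1psi_norm \<Omega> \<psi> (\<lambda>x. u x - \<phi> x) < e"
proof -
  have u0: "u \<in> W1p0 \<Omega> 1" and uW: "u \<in> W1p \<Omega> 1" and ulux: "lux_norm \<Omega> \<psi> (weak_grad \<Omega> u) < \<infinity>"
    using u by (auto simp: W1psi0_def W1psi_def)
  have fin: "modular (weak_grad \<Omega> u) < \<infinity>"
    by (rule modular_finite_of_lux_norm[OF weak_grad_measurable[OF uW] ulux])
  \<comment> \<open>The tolerance may be infinite, so a real \<open>e'\<close> below half of it is
    taken; one \<open>e'\<close> serves the L1 norm and one the Luxemburg norm.\<close>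
  obtain e' :: real where e': "e' > 0" "ennreal (2 * e') < e"
  proof -
    obtain b where "0 < b" "b < e" using dense e by blast
    then obtain r where "b = ennreal r" "r > 0" by (cases b) auto
    then show ?thesis using that[of "r / 2"] \<open>b < e\<close> by simp
  qed
  obtain m where m: "1 / e' < 2 ^ m" using real_arch_pow[of 2 "1 / e'"] by auto
  \<comment> \<open>The first bound controls the L1 norm; the second is the smallness that
    \<open>lux_norm_le\<close> turns into a norm of at most \<open>e'\<close>.\<close>
  define \<delta> where "\<delta> = min e' (1 / C4 ^ m)"
  have \<delta>: "\<delta> > 0" using e' const_bounds by (simp add: \<delta>_def)
  obtain \<phi> where \<phi>: "\<phi> \<in> Cc_inf \<Omega>" "Lp_norm \<Omega> 1 (\<lambda>x. u x - \<phi> x) < \<delta>" "modular (\<lambda>x. weak_grad \<Omega> u x - grad \<phi> x) < \<delta>"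
    by (rule modular_density[OF lip u0 fin \<delta>]) (rule that)
  note \<phi>U = Cc_inf_UNIV[OF \<phi>(1)]
  have wg: "is_weak_grad \<Omega> (\<lambda>x. u x - \<phi> x) (\<lambda>x. weak_grad \<Omega> u x - grad \<phi> x)"
    by (rule is_weak_grad_diff[OF open_dom W1p_weak_grad(1)[OF open_dom uW] Cc_inf_is_weak_grad[OF open_dom \<phi>U]])
  note ae = weak_grad_AE_eq[OF open_dom wg]
  have m1: "(\<lambda>x. weak_grad \<Omega> u x - grad \<phi> x) \<in> borel_measurable (lebesgue_on \<Omega>)"
    by (intro borel_measurable_diff weak_grad_measurable[OF uW] borel_measurable_imp_lebesgue_on grad_borel_measurable Cc_inf_Ck[OF \<phi>(1)])
  have "AE x in lebesgue_on \<Omega>. weak_grad \<Omega> u x - grad \<phi> x = weak_grad \<Omega> (\<lambda>x. u x - \<phi> x) x"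
    using ae by eventually_elim simp
  from borel_measurable_lebesgue_on_AE[OF dom_borel m1 this]
  have m2: "weak_grad \<Omega> (\<lambda>x. u x - \<phi> x) \<in> borel_measurable (lebesgue_on \<Omega>)" by simp
  have "modular (weak_grad \<Omega> (\<lambda>x. u x - \<phi> x)) < ennreal \<delta>"
    using modular_cong_AE[OF ae] \<phi>(3) by simp
  also have "\<dots> \<le> ennreal (1 / C4 ^ m)" by (intro ennreal_leI) (simp add: \<delta>_def)
  finally have "lux_norm \<Omega> \<psi> (weak_grad \<Omega> (\<lambda>x. u x - \<phi> x)) \<le> ennreal e'"
    using e' m by (intro lux_norm_le[OF m2, of e' m]) auto
  moreover have "ennreal (Lp_norm \<Omega> 1 (\<lambda>x. u x - \<phi> x)) \<le> ennreal e'"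
    using \<phi>(2) by (intro ennreal_leI) (simp add: \<delta>_def)
  ultimately have "W1psi_norm \<Omega> \<psi> (\<lambda>x. u x - \<phi> x) \<le> ennreal e' + ennreal e'"
    unfolding W1psi_norm_def by (rule add_mono[rotated])
  also have "\<dots> = ennreal (2 * e')" using e' by (simp flip: ennreal_plus)
  also have "\<dots> < e" by fact
  finally show ?thesis using \<phi>(1) by blast
qed

lemma modular_of_Lq:
  fixes f :: "real^'d \<Rightarrow> 'b::euclidean_space"
  assumes f: "f \<in> Lp \<Omega> q" shows "modular f < \<infinity>"
proof -
  have i: "integrable (lebesgue_on \<Omega>) (\<lambda>x. C2 * (1 + norm (f x) powr q))"
    using f dom_const_integrable[of 1] by (auto simp: Lp_def)
  have "modular f \<le> (\<integral>\<^sup>+x. norm (C2 * (1 + norm (f x) powr q)) \<partial>lebesgue_on \<Omega>)"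
    unfolding modular_def
  proof (intro nn_integral_mono ennreal_leI)
    fix x assume "x \<in> space (lebesgue_on \<Omega>)"
    then have x: "x \<in> \<Omega>" using space_lebesgue_on_dom by simp
    have "\<psi> x (norm (f x)) \<le> C2 * (1 + norm (f x) powr q)" by (rule upper[OF x]) simp
    then show "\<psi> x (norm (f x)) \<le> norm (C2 * (1 + norm (f x) powr q))" by simp
  qed
  also have "\<dots> < \<infinity>" using i unfolding integrable_iff_bounded by blast
  finally show ?thesis .
qed

section \<open>Comparison of the infima\<close>

text \<open>Only competitors of finite energy matter. For these the gradient of \<open>w\<close>
  alone has finite modular, because that of \<open>u0\<close> has by the growth bound with exponent
  q, so \<open>w\<close> can be approximated; the perturbation estimate then changes the energy as
  little as desired.\<close>

lemma INF_Cc_inf_le_energy: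
  fixes u0 w :: "real^'d \<Rightarrow> real^'n::finite"
  assumes lip: "lipschitz_boundary \<Omega>" and u0: "u0 \<in> W1p \<Omega> q" and w: "w \<in> W1p0 \<Omega> p"
  shows "(INF \<phi>\<in>Cc_inf \<Omega>. energy \<Omega> \<psi> (\<lambda>x. u0 x + \<phi> x)) \<le> energy \<Omega> \<psi> (\<lambda>x. u0 x + w x)"
proof (cases "energy \<Omega> \<psi> (\<lambda>x. u0 x + w x) < \<infinity>")
  case True
  have w1: "w \<in> W1p0 \<Omega> 1" using W1p0_mono_exponent[OF open_dom bounded_dom, of 1 p] const_bounds w by auto
  then have wW: "w \<in> W1p \<Omega> 1" by (simp add: W1p0_def)
  define a where "a = weak_grad \<Omega> u0"
  define b where "b = weak_grad \<Omega> w"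
  have am: "a \<in> borel_measurable (lebesgue_on \<Omega>)" unfolding a_def by (rule weak_grad_measurable[OF u0])
  have bm: "b \<in> borel_measurable (lebesgue_on \<Omega>)" unfolding b_def by (rule weak_grad_measurable[OF wW])
  have ag: "is_weak_grad \<Omega> u0 a" unfolding a_def by (rule W1p_weak_grad(1)[OF open_dom u0])
  have bg: "is_weak_grad \<Omega> w b" unfolding b_def by (rule W1p_weak_grad(1)[OF open_dom wW])
  have afin: "modular a < \<infinity>" unfolding a_def by (rule modular_of_Lq[OF W1p_weak_grad(2)[OF open_dom u0]])
  have E: "energy \<Omega> \<psi> (\<lambda>x. u0 x + w x) = modular (\<lambda>x. a x + b x)"
    unfolding energy_modular by (rule modular_cong_AE[OF weak_grad_AE_eq[OF open_dom is_weak_grad_add[OF open_dom ag bg]]])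
  have "modular b = modular (\<lambda>x. (a x + b x) - a x)" by simp
  also have "\<dots> \<le> ennreal C4 * (modular (\<lambda>x. a x + b x) + modular a)"
    using am bm by (intro modular_diff) auto
  also have "\<dots> < \<infinity>" using True E afin by (auto simp: ennreal_mult_less_top)
  finally have bfin: "modular (weak_grad \<Omega> w) < \<infinity>" by (simp add: b_def)
  obtain E' where E': "modular (\<lambda>x. a x + b x) = ennreal E'" "E' \<ge> 0"
    using True unfolding E by (cases "modular (\<lambda>x. a x + b x)") auto
  show ?thesis unfolding E
  proof (rule ennreal_le_epsilon)
    fix e :: real assume e: "e > 0"
    \<comment> \<open>\<open>m\<close> depends on the energy \<open>E'\<close> and makes the
      relative error C4 / 2^m cost at most e / 2; only then is \<delta> chosen against the factor
      \<open>C4 ^ Suc m\<close>.\<close>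
    obtain m where m: "2 * C4 * E' / e < 2 ^ m" using real_arch_pow[of 2 "2 * C4 * E' / e"] by auto
    then have m': "C4 / 2 ^ m * E' \<le> e / 2" using e by (simp add: field_simps)
    define \<delta> where "\<delta> = e / (2 * C4 ^ Suc m)"
    have \<delta>: "\<delta> > 0" "C4 ^ Suc m * \<delta> = e / 2" using e const_bounds by (auto simp: \<delta>_def)
    obtain \<phi> where \<phi>: "\<phi> \<in> Cc_inf \<Omega>" "modular (\<lambda>x. weak_grad \<Omega> w x - grad \<phi> x) < \<delta>"
      by (rule modular_density[OF lip w1 bfin \<delta>(1)]) (rule that)
    have gm: "grad \<phi> \<in> borel_measurable (lebesgue_on \<Omega>)"
      by (intro borel_measurable_imp_lebesgue_on grad_borel_measurable Cc_inf_Ck[OF \<phi>(1)])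
    have "(INF \<phi>\<in>Cc_inf \<Omega>. energy \<Omega> \<psi> (\<lambda>x. u0 x + \<phi> x)) \<le> energy \<Omega> \<psi> (\<lambda>x. u0 x + \<phi> x)"
      by (rule INF_lower[OF \<phi>(1)])
    also have "\<dots> = modular (\<lambda>x. a x + grad \<phi> x)"
      unfolding energy_modular
      by (rule modular_cong_AE[OF weak_grad_AE_eq[OF open_dom is_weak_grad_add[OF open_dom ag Cc_inf_is_weak_grad[OF open_dom Cc_inf_UNIV[OF \<phi>(1)]]]]])
    also have "\<dots> = modular (\<lambda>x. (a x + b x) + (grad \<phi> x - b x))" by simp
    also have "\<dots> \<le> ennreal (1 + C4 / 2 ^ m) * modular (\<lambda>x. a x + b x) + ennreal (C4 ^ Suc m) * modular (\<lambda>x. grad \<phi> x - b x)"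
      using am bm gm by (intro modular_perturb) auto
    also have "modular (\<lambda>x. grad \<phi> x - b x) = modular (\<lambda>x. b x - grad \<phi> x)" by (simp add: modular_def norm_minus_commute)
    also have "ennreal (1 + C4 / 2 ^ m) * modular (\<lambda>x. a x + b x) + ennreal (C4 ^ Suc m) * modular (\<lambda>x. b x - grad \<phi> x)
       \<le> ennreal (1 + C4 / 2 ^ m) * ennreal E' + ennreal (C4 ^ Suc m) * ennreal \<delta>"
      unfolding E'(1) using \<phi>(2) by (intro add_left_mono mult_left_mono) (auto simp: b_def)
    also have "\<dots> = ennreal ((1 + C4 / 2 ^ m) * E' + C4 ^ Suc m * \<delta>)"
      using E' \<delta> const_bounds by (subst ennreal_plus) (auto simp: ennreal_mult'')
    also have "\<dots> \<le> ennreal (E' + e)"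
      unfolding \<delta>(2) distrib_right mult_1 using m' by (intro ennreal_leI) linarith
    also have "\<dots> = modular (\<lambda>x. a x + b x) + ennreal e" using E' e by simp
    finally show "(INF \<phi>\<in>Cc_inf \<Omega>. energy \<Omega> \<psi> (\<lambda>x. u0 x + \<phi> x)) \<le> modular (\<lambda>x. a x + b x) + ennreal e" .
  qed
qed (simp add: not_less top_unique)

end

theorem theorem7p2:
  fixes \<Omega> :: "(real^'d::finite) set"
    and \<psi> :: "real^'d \<Rightarrow> real \<Rightarrow> real"
    and \<alpha> p q :: real
  assumes "bounded_lipschitz_domain \<Omega>"
    and "0 < \<alpha>" and "\<alpha> \<le> 1"
    and "1 < p" and "p < q"
    and "q \<le> p + \<alpha> * max 1 (p / real CARD('d))"
    and "integrand \<Omega> \<psi>"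
    and "cond_A1 \<Omega> \<psi>" and "cond_A2 \<Omega> \<psi>" and "cond_A3 \<Omega> \<psi>"
    and "cond_A4 \<Omega> \<psi> p q" and "cond_A5 \<Omega> \<psi>"
    and "cond_Cont \<Omega> \<psi> p"
  shows "(\<forall>u\<^sub>0 :: real^'d \<Rightarrow> real^'n::finite. u\<^sub>0 \<in> W1p \<Omega> q \<longrightarrow>
            (INF w\<in>W1p0 \<Omega> p. energy \<Omega> \<psi> (\<lambda>x. u\<^sub>0 x + w x))
              = (INF w\<in>W1p0 \<Omega> q. energy \<Omega> \<psi> (\<lambda>x. u\<^sub>0 x + w x)) \<and>
            (INF w\<in>W1p0 \<Omega> q. energy \<Omega> \<psi> (\<lambda>x. u\<^sub>0 x + w x))
              = (INF w\<in>Cc_inf \<Omega>. energy \<Omega> \<psi> (\<lambda>x. u\<^sub>0 x + w x))) \<and>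
         (Cc_inf \<Omega> :: (real^'d \<Rightarrow> real^'n) set) \<subseteq> W1psi0 \<Omega> \<psi> \<and>
         (\<forall>u \<in> (W1psi0 \<Omega> \<psi> :: (real^'d \<Rightarrow> real^'n) set). \<forall>\<epsilon>>0.
            \<exists>\<phi>\<in>Cc_inf \<Omega>. W1psi_norm \<Omega> \<psi> (\<lambda>x. u x - \<phi> x) < \<epsilon>)"
proof -
  have dom: "open \<Omega>" "bounded \<Omega>" and lip: "lipschitz_boundary \<Omega>"
    using assms(1) by (auto simp: bounded_lipschitz_domain_def)
  have cl: "x \<in> closure \<Omega>" if "x \<in> \<Omega>" for x using that closure_subset by blast
  obtain \<xi>0 C1 C2 where A4: "\<xi>0 \<ge> 1" "C1 > 0" "C2 > 0"
    "\<And>x \<xi>. x \<in> closure \<Omega> \<Longrightarrow> \<xi> \<ge> \<xi>0 \<Longrightarrow> C1 * \<xi> powr p \<le> \<psi> x \<xi>"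
    "\<And>x \<xi>. x \<in> closure \<Omega> \<Longrightarrow> \<xi> \<ge> 0 \<Longrightarrow> \<psi> x \<xi> \<le> C2 * (1 + \<xi> powr q)"
    using assms(11) unfolding cond_A4_def by metis
  obtain C4 where A5: "\<And>x \<xi>. x \<in> closure \<Omega> \<Longrightarrow> \<xi> \<ge> 0 \<Longrightarrow> \<psi> x (2 * \<xi>) \<le> C4 * \<psi> x \<xi>"
    using assms(12) unfolding cond_A5_def by metis
  have nn: "\<And>x \<xi>. x \<in> closure \<Omega> \<Longrightarrow> \<xi> \<ge> 0 \<Longrightarrow> 0 \<le> \<psi> x \<xi>"
    and me: "\<And>\<xi>. \<xi> \<ge> 0 \<Longrightarrow> (\<lambda>x. \<psi> x \<xi>) \<in> borel_measurable (lebesgue_on (closure \<Omega>))"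
    using assms(7) by (auto simp: integrand_def)
  \<comment> \<open>The doubling constant is raised to at least 1, which nonnegativity of \<psi>
    permits.\<close>
  interpret orlicz_integrand \<Omega> \<psi> p q C1 C2 "max C4 1" \<xi>0
  proof
    show "open \<Omega>" "bounded \<Omega>" by fact+
    show "x \<in> \<Omega> \<Longrightarrow> 0 \<le> \<xi> \<Longrightarrow> 0 \<le> \<psi> x \<xi>" for x \<xi> using nn cl by blast
    show "(\<lambda>x. \<psi> x \<xi>) \<in> borel_measurable (lebesgue_on \<Omega>)" if "0 \<le> \<xi>" for \<xi>
      by (rule measurable_restrict_mono[OF me[OF that] closure_subset])
    show "x \<in> \<Omega> \<Longrightarrow> \<psi> x 0 = 0" for x using assms(8) cl by (auto simp: cond_A1_def)
    show "x \<in> \<Omega> \<Longrightarrow> convex_on {0..} (\<psi> x)" for x using assms(9) cl by (auto simp: cond_A2_def)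
    show "x \<in> \<Omega> \<Longrightarrow> \<xi>0 \<le> \<xi> \<Longrightarrow> C1 * \<xi> powr p \<le> \<psi> x \<xi>" for x \<xi> using A4(4) cl by blast
    show "x \<in> \<Omega> \<Longrightarrow> 0 \<le> \<xi> \<Longrightarrow> \<psi> x \<xi> \<le> C2 * (1 + \<xi> powr q)" for x \<xi> using A4(5) cl by blast
    show "\<psi> x (2 * \<xi>) \<le> max C4 1 * \<psi> x \<xi>" if "x \<in> \<Omega>" "0 \<le> \<xi>" for x \<xi>
      by (rule order.trans[OF A5[OF cl[OF that(1)] that(2)] mult_right_mono]) (use nn cl that in auto)
    show "\<xi>0 \<ge> 1" "C1 > 0" "C2 > 0" "max C4 1 \<ge> 1" "p > 1" "q > 1" using A4 assms(4,5) by auto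
    fix D :: real assume "D > 1"
    then obtain M N where MN: "\<And>\<gamma> x y z \<xi>. \<gamma> \<in> {0<..<1/2} \<Longrightarrow> y \<in> closure (ball x \<gamma>) \<inter> closure \<Omega> \<Longrightarrow>
       z \<in> closure (ball x \<gamma>) \<inter> closure \<Omega> \<Longrightarrow> \<xi> \<in> {0..D * \<gamma> powr (- min 1 (real DIM(real^'d) / p))} \<Longrightarrow> \<psi> z \<xi> \<le> M * \<psi> y \<xi> + N"
      using assms(13) unfolding cond_Cont_def by metis
    show "\<exists>M\<ge>0. \<exists>N\<ge>0. \<forall>\<gamma>\<in>{0<..<1/2}. \<forall>x\<in>\<Omega>. \<forall>y\<in>\<Omega>. dist x y < \<gamma> \<longrightarrow>
        (\<forall>\<xi>\<in>{0..D * \<gamma> powr (- min 1 (real CARD('d) / p))}. \<psi> x \<xi> \<le> M * \<psi> y \<xi> + N)"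
    \<comment> \<open>The constants of (Cont) may be negative; absolute values only enlarge the
      right-hand side.\<close>
    proof (rule exI[of _ "\<bar>M\<bar>"], rule conjI, simp, rule exI[of _ "\<bar>N\<bar>"], rule conjI, simp, intro ballI impI)
      fix \<gamma> :: real and x y \<xi>
      assume \<gamma>: "\<gamma> \<in> {0<..<1/2}" and xy: "x \<in> \<Omega>" "y \<in> \<Omega>" "dist x y < \<gamma>"
        and \<xi>: "\<xi> \<in> {0..D * \<gamma> powr (- min 1 (real CARD('d) / p))}"
      \<comment> \<open>The ball is centred at \<open>x\<close> itself, so it contains both
        \<open>x\<close> and \<open>y\<close>.\<close>
      have "x \<in> ball x \<gamma>" "y \<in> ball x \<gamma>" using \<gamma> xy by auto
      then have "\<psi> x \<xi> \<le> M * \<psi> y \<xi> + N"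
        using closure_subset[of "ball x \<gamma>"] cl xy \<xi> by (intro MN[OF \<gamma>, of y x]) auto
      also have "\<dots> \<le> \<bar>M\<bar> * \<psi> y \<xi> + \<bar>N\<bar>"
        using nn[OF cl[OF xy(2)]] \<xi> by (intro add_mono mult_right_mono) auto
      finally show "\<psi> x \<xi> \<le> \<bar>M\<bar> * \<psi> y \<xi> + \<bar>N\<bar>" .
    qed
  qed
  have sub1: "(Cc_inf \<Omega> :: (real^'d \<Rightarrow> real^'n) set) \<subseteq> W1p0 \<Omega> q"
    using assms(4,5) by (intro Cc_inf_subset_W1p0 dom) simp
  have sub2: "(W1p0 \<Omega> q :: (real^'d \<Rightarrow> real^'n) set) \<subseteq> W1p0 \<Omega> p"
    using assms(4,5) by (intro W1p0_mono_exponent dom) auto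
  show ?thesis
  proof (intro conjI allI impI ballI)
    fix u\<^sub>0 :: "real^'d \<Rightarrow> real^'n" assume u0: "u\<^sub>0 \<in> W1p \<Omega> q"
    let ?E = "\<lambda>w. energy \<Omega> \<psi> (\<lambda>x. u\<^sub>0 x + w x)"
    \<comment> \<open>Smaller classes have larger infima, which gives two inequalities;
      approximation by test functions closes the cycle, so all three infima agree.\<close>
    have pq: "(INF w\<in>W1p0 \<Omega> p. ?E w) \<le> (INF w\<in>W1p0 \<Omega> q. ?E w)" by (rule INF_superset_mono[OF sub2]) simp
    have qc: "(INF w\<in>W1p0 \<Omega> q. ?E w) \<le> (INF w\<in>Cc_inf \<Omega>. ?E w)" by (rule INF_superset_mono[OF sub1]) simp
    have cp: "(INF w\<in>Cc_inf \<Omega>. ?E w) \<le> (INF w\<in>W1p0 \<Omega> p. ?E w)"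
      by (rule INF_greatest) (rule INF_Cc_inf_le_energy[OF lip u0])
    show "(INF w\<in>W1p0 \<Omega> p. ?E w) = (INF w\<in>W1p0 \<Omega> q. ?E w)" using pq qc cp by (meson order.antisym order.trans)
    show "(INF w\<in>W1p0 \<Omega> q. ?E w) = (INF w\<in>Cc_inf \<Omega>. ?E w)" using pq qc cp by (meson order.antisym order.trans)
  next
    show "(Cc_inf \<Omega> :: (real^'d \<Rightarrow> real^'n) set) \<subseteq> W1psi0 \<Omega> \<psi>" by (rule Cc_inf_subset_W1psi0)
  next
    fix u :: "real^'d \<Rightarrow> real^'n" and \<epsilon> :: ennreal assume "u \<in> W1psi0 \<Omega> \<psi>" "0 < \<epsilon>"
    then show "\<exists>\<phi>\<in>Cc_inf \<Omega>. W1psi_norm \<Omega> \<psi> (\<lambda>x. u x - \<phi> x) < \<epsilon>" by (rule W1psi0_density[OF lip])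
  qed
qed

end
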